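(* Let $\Omega\subset\mathbb{H}^2$ (curvature $-1$) be an unbounded open connected domain with $C^2$ boundary on which there is $u\in C^2(\overline\Omega)$ with $\Delta u+f(u)=0$ in $\Omega$, $u>0$ in $\Omega$, $u=0$ and $\langle\nabla u,\vec v\rangle=\alpha$ on $\partial\Omega$, where $\alpha\neq0$ is a constant and $f:(0,+\infty)\to\mathbb{R}$ is Lipschitz with $f(t)\geq\lambda t$ for all $t>0$ for some constant $\lambda>\frac14$. Let $R_{\lambda,2}$ be the radius of a geodesic ball in $\mathbb{H}^2$ whose first Dirichlet eigenvalue of the Laplacian is $\lambda$, let $v$ be the positive first Dirichlet eigenfunction on a geodesic ball $B(p,R_{\lambda,2})$ normalized so that $\langle\nabla v,\vec v\rangle=\alpha$ on $\partial B(p,R_{\lambda,2})$, and set $h_0=\max v=v(p)$. Then every connected component $\Omega'$ of $\{x\in\Omega:u(x)>h_0\}$ has diameter smaller than $2R_{\lambda,2}$.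
   Context: $\alpha$ is a non-positive constant (here nonzero), and $\vec v$ denotes the outward unit normal of the relevant boundary. *)

theory Defs
  imports "HOL-Analysis.Analysis"
begin

text \<open>Upper half-plane model of the hyperbolic plane (curvature -1):
  points are complex numbers z with Im z > 0, metric (dx^2+dy^2)/y^2.\<close>

definition H2 :: "complex set" where
  "H2 = {z. Im z > 0}"

definition hdist :: "complex \<Rightarrow> complex \<Rightarrow> real" where
  "hdist z w = arcosh (1 + (cmod (z - w))^2 / (2 * Im z * Im w))"

definition hball :: "complex \<Rightarrow> real \<Rightarrow> complex set" where
  "hball p r = {z \<in> H2. hdist p z < r}"

definition hbounded :: "complex set \<Rightarrow> bool" where
  "hbounded S \<longleftrightarrow> (\<exists>p r. p \<in> H2 \<and> S \<subseteq> hball p r)"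

text \<open>Hyperbolic diameter (extended real, so that unbounded sets have diameter infinity).\<close>
definition hdiam :: "complex set \<Rightarrow> ereal" where
  "hdiam S = (SUP x\<in>S. SUP y\<in>S. ereal (hdist x y))"

definition hbdry :: "complex set \<Rightarrow> complex set" where
  "hbdry S = frontier S \<inter> H2"

definition hclosure :: "complex set \<Rightarrow> complex set" where
  "hclosure S = closure S \<inter> H2"

text \<open>u is C^2 on the open set S up to its boundary (in H2), with first derivative Du
  and second derivative D2u; Du, D2u on the boundary are the (unique) continuous
  extensions.\<close>
definition C2_upto ::
  "complex set \<Rightarrow> (complex \<Rightarrow> real) \<Rightarrow> (complex \<Rightarrow> complex \<Rightarrow>\<^sub>L real)
     \<Rightarrow> (complex \<Rightarrow> complex \<Rightarrow>\<^sub>L (complex \<Rightarrow>\<^sub>L real)) \<Rightarrow> bool" where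
  "C2_upto S u Du D2u \<longleftrightarrow>
     (\<forall>z\<in>S. (u has_derivative blinfun_apply (Du z)) (at z)
            \<and> (Du has_derivative blinfun_apply (D2u z)) (at z))
     \<and> continuous_on (hclosure S) u
     \<and> continuous_on (hclosure S) Du
     \<and> continuous_on (hclosure S) D2u"

definition hlap ::
  "(complex \<Rightarrow> complex \<Rightarrow>\<^sub>L (complex \<Rightarrow>\<^sub>L real)) \<Rightarrow> complex \<Rightarrow> real" where
  "hlap D2u z = (Im z)^2 *
      (blinfun_apply (blinfun_apply (D2u z) 1) 1 + blinfun_apply (blinfun_apply (D2u z) \<i>) \<i>)"

definition egrad :: "(complex \<Rightarrow>\<^sub>L real) \<Rightarrow> complex" where
  "egrad L = complex_of_real (blinfun_apply L 1) + \<i> * complex_of_real (blinfun_apply L \<i>)"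

text \<open>phi (with derivative Dphi) is a local C^1 defining function of S near the boundary
  point b: S = {phi < 0} in a small disc around b, with nonvanishing gradient at b.
  Its normalized gradient is then the Euclidean outward unit normal of S at b.\<close>
definition local_defining ::
  "complex set \<Rightarrow> complex \<Rightarrow> real \<Rightarrow> (complex \<Rightarrow> real) \<Rightarrow> (complex \<Rightarrow> complex \<Rightarrow>\<^sub>L real) \<Rightarrow> bool" where
  "local_defining S b r phi Dphi \<longleftrightarrow>
     r > 0 \<and> ball b r \<subseteq> H2
     \<and> (\<forall>z\<in>ball b r. (phi has_derivative blinfun_apply (Dphi z)) (at z))
     \<and> continuous_on (ball b r) Dphi
     \<and> Dphi b \<noteq> 0
     \<and> S \<inter> ball b r = {z \<in> ball b r. phi z < 0}"

definition C2_boundary :: "complex set \<Rightarrow> bool" where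
  "C2_boundary S \<longleftrightarrow>
     (\<forall>b\<in>hbdry S. \<exists>r phi Dphi D2phi. local_defining S b r phi Dphi
        \<and> (\<forall>z\<in>ball b r. (Dphi has_derivative blinfun_apply (D2phi z)) (at z))
        \<and> continuous_on (ball b r) D2phi)"

text \<open>Hyperbolic normal derivative <grad_H u, nu_H>_H at a boundary point b equals a.
  With Euclidean outward unit normal n, nu_H = y n and grad_H u = y^2 grad_E u,
  so <grad_H u, nu_H>_H = y * Du(b) n.\<close>
definition normal_deriv_eq ::
  "complex set \<Rightarrow> (complex \<Rightarrow> complex \<Rightarrow>\<^sub>L real) \<Rightarrow> real \<Rightarrow> bool" where
  "normal_deriv_eq S Du a \<longleftrightarrow>
     (\<forall>b\<in>hbdry S. \<forall>r phi Dphi. local_defining S b r phi Dphi \<longrightarrow>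
        Im b * blinfun_apply (Du b) (egrad (Dphi b) / complex_of_real (cmod (egrad (Dphi b)))) = a)"

definition dirichlet_eigenfunction ::
  "complex set \<Rightarrow> real \<Rightarrow> (complex \<Rightarrow> real) \<Rightarrow> (complex \<Rightarrow> complex \<Rightarrow>\<^sub>L real)
     \<Rightarrow> (complex \<Rightarrow> complex \<Rightarrow>\<^sub>L (complex \<Rightarrow>\<^sub>L real)) \<Rightarrow> bool" where
  "dirichlet_eigenfunction S mu w Dw D2w \<longleftrightarrow>
     C2_upto S w Dw D2w \<and> (\<exists>z\<in>S. w z \<noteq> 0)
     \<and> (\<forall>z\<in>S. hlap D2w z + mu * w z = 0)
     \<and> (\<forall>z\<in>hbdry S. w z = 0)"

definition dirichlet_eigenvalue :: "complex set \<Rightarrow> real \<Rightarrow> bool" where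
  "dirichlet_eigenvalue S mu \<longleftrightarrow> (\<exists>w Dw D2w. dirichlet_eigenfunction S mu w Dw D2w)"

definition first_dirichlet_eigenvalue :: "complex set \<Rightarrow> real" where
  "first_dirichlet_eigenvalue S = Inf {mu. dirichlet_eigenvalue S mu}"

end

theory Submission
  imports Defs
begin

text \<open>
  For a centre \<open>c\<close> let \<open>V c\<close> be the translate of \<open>v\<close> to the ball of radius \<open>R\<close> about \<open>c\<close>. Since
  \<open>f t \<ge> lam * t\<close>, the difference \<open>u - V c\<close> is superharmonic wherever it is nonnegative, so
  \<open>V c\<close> cannot touch \<open>u\<close> from below in the interior (strong minimum principle), nor at a
  common boundary point, where the two normal derivatives agree (Hopf lemma). The same comparison,
  applied to \<open>v\<close> and its rotations about \<open>p\<close>, shows that \<open>v\<close> is radial, whence \<open>V c \<le> v p\<close>.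

  If a component of \<open>{u > v p}\<close> had diameter at least \<open>2 * R\<close>, there would be a path in \<open>\<Omega>\<close>, with
  endpoints at distance more than \<open>2 * R\<close>, on which \<open>u\<close> exceeds every \<open>V c\<close> with \<open>c\<close> on the
  perpendicular bisector of the endpoints. The path separates the tube of radius \<open>R\<close> around this
  bisector. Let the ball slide along the bisector from one end to the other: the part of the ball
  that has crossed the path stays inside \<open>\<Omega>\<close> and \<open>V c < u\<close> there, since a first contact is
  impossible. Finally the whole closed ball lies in \<open>\<Omega>\<close>, and then some multiple of \<open>u\<close> touches
  \<open>V c\<close> from above in the interior, a contradiction.
\<close>

section \<open>Minimum principle and Hopf lemma\<close>


text \<open>In the half-plane the hyperbolic Laplacian is \<open>(Im z)^2\<close> times the flat
  one, so its sign is a flat notion and the Euclidean minimum principle and Hopf lemma apply as they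
  are. The obstacle is that a ball may leave \<Omega>, where \<open>u\<close> has no meaning, so
  \<open>u\<close> and \<open>V c\<close> cannot be compared on the whole ball from the start. The
  path supplies the missing edge of the compared part: \<open>u\<close> is strictly larger there,
  and contact remains possible only where the interior principle or the Hopf lemma applies. The
  bound \<open>f t \<ge> lam * t\<close> survives scaling of \<open>u\<close>, which allows an
  additive comparison during the sliding and a multiplicative one at the end. That \<open>p\<close>
  is a maximum of \<open>v\<close> has to be proved. Quotients of \<open>v\<close> and its rotations
  are 0/0 at the boundary; the constant normal derivative makes them tend to 1. The value 1/4 is the
  bottom of the spectrum of the hyperbolic plane, and first eigenvalues of balls lie above it.
  Strictness of the final bound costs an extra argument: at diameter exactly \<open>2 * R\<close>
  the path must leave the component a little.\<close>

text \<open>A pointwise flat Laplacian in relational form: a derivative near \<open>z\<close> and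
  the two pure second derivatives at \<open>z\<close>. This is what the second derivative test
  consumes, it is stable under linear combinations, and no derivative functions have to be carried
  along with \<open>w\<close>.\<close>

definition has_lap :: "(complex \<Rightarrow> real) \<Rightarrow> complex \<Rightarrow> real \<Rightarrow> bool" where
  "has_lap w z L \<longleftrightarrow> (\<exists>D A B. (\<forall>\<^sub>F x in nhds z. (w has_derivative D x) (at x))
     \<and> ((\<lambda>t. D (z + of_real t) 1) has_real_derivative A) (at 0)
     \<and> ((\<lambda>t. D (z + \<i> * of_real t) \<i>) has_real_derivative B) (at 0) \<and> L = A + B)"

lemma has_lap_lincomb:
  assumes "has_lap u z L" "has_lap v z M"
  shows "has_lap (\<lambda>x. a * u x + b * v x) z (a * L + b * M)"
proof -
  obtain D A B where 1: "\<forall>\<^sub>F x in nhds z. (u has_derivative D x) (at x)"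
    "((\<lambda>t. D (z + of_real t) 1) has_real_derivative A) (at 0)"
    "((\<lambda>t. D (z + \<i> * of_real t) \<i>) has_real_derivative B) (at 0)" "L = A + B"
    using assms(1) unfolding has_lap_def by auto
  obtain E F G where 2: "\<forall>\<^sub>F x in nhds z. (v has_derivative E x) (at x)"
    "((\<lambda>t. E (z + of_real t) 1) has_real_derivative F) (at 0)"
    "((\<lambda>t. E (z + \<i> * of_real t) \<i>) has_real_derivative G) (at 0)" "M = F + G"
    using assms(2) unfolding has_lap_def by auto
  have "\<forall>\<^sub>F x in nhds z. ((\<lambda>x. a * u x + b * v x) has_derivative (\<lambda>h. a * D x h + b * E x h)) (at x)"
    using 1(1) 2(1) by eventually_elim (auto intro!: derivative_eq_intros)
  moreover have "((\<lambda>t. a * D (z + of_real t) 1 + b * E (z + of_real t) 1)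
      has_real_derivative (a * A + b * F)) (at 0)"
    using 1(2) 2(2) by (auto intro!: derivative_eq_intros)
  moreover have "((\<lambda>t. a * D (z + \<i> * of_real t) \<i> + b * E (z + \<i> * of_real t) \<i>)
      has_real_derivative (a * B + b * G)) (at 0)"
    using 1(3) 2(3) by (auto intro!: derivative_eq_intros)
  moreover have "a * L + b * M = (a * A + b * F) + (a * B + b * G)"
    using 1(4) 2(4) by (simp add: algebra_simps)
  ultimately show ?thesis unfolding has_lap_def
    by (intro exI[of _ "\<lambda>x h. a * D x h + b * E x h"] exI conjI) auto
qed

lemma has_lap_differentiable:
  assumes "has_lap u z L"
  shows "\<exists>d. (u has_derivative d) (at z)"
  using assms eventually_nhds_x_imp_x unfolding has_lap_def by blast

lemma has_lap_continuous:
  assumes "\<And>z. z \<in> U \<Longrightarrow> \<exists>L. has_lap u z L"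
  shows "continuous_on U u"
proof (rule continuous_at_imp_continuous_on, rule ballI)
  fix z assume "z \<in> U"
  then obtain L where "has_lap u z L" using assms by blast
  then show "isCont u z" using has_lap_differentiable has_derivative_continuous by blast
qed

lemma has_lap_cong:
  assumes "has_lap u z L" "open U" "z \<in> U" "\<And>x. x \<in> U \<Longrightarrow> v x = u x"
  shows "has_lap v z L"
proof -
  obtain D A B where 1: "\<forall>\<^sub>F x in nhds z. (u has_derivative D x) (at x)"
    "((\<lambda>t. D (z + of_real t) 1) has_real_derivative A) (at 0)"
    "((\<lambda>t. D (z + \<i> * of_real t) \<i>) has_real_derivative B) (at 0)" "L = A + B"
    using assms(1) unfolding has_lap_def by auto
  have "\<forall>\<^sub>F x in nhds z. x \<in> U" using assms(2,3) eventually_nhds by blast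
  then have "\<forall>\<^sub>F x in nhds z. (v has_derivative D x) (at x)"
    using 1(1)
  proof eventually_elim
    case (elim x)
    then show ?case
      using has_derivative_transform_within_open[OF elim(2) assms(2) elim(1)] assms(4) by metis
  qed
  then show ?thesis unfolding has_lap_def using 1 by blast
qed

text \<open>A negative \<open>A\<close> would make \<open>g'\<close> negative just to the right of
  its zero at 0, and the mean value theorem would push \<open>g\<close> below
  \<open>g 0\<close>.\<close>

lemma second_derivative_local_min:
  fixes g g' :: "real \<Rightarrow> real"
  assumes d: "\<forall>\<^sub>F t in nhds 0. (g has_real_derivative g' t) (at t)"
    and dd: "(g' has_real_derivative A) (at 0)"
    and m: "\<forall>\<^sub>F t in nhds 0. g 0 \<le> g t"
  shows "A \<ge> 0"
proof (rule ccontr)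
  assume "\<not> A \<ge> 0" then have A: "A < 0" by simp
  obtain r where r: "r > 0" "\<And>t. \<bar>t\<bar> < r \<Longrightarrow> (g has_real_derivative g' t) (at t)"
    using d unfolding eventually_nhds_metric by (auto simp: dist_real_def)
  obtain s where s: "s > 0" "\<And>t. \<bar>t\<bar> < s \<Longrightarrow> g 0 \<le> g t"
    using m unfolding eventually_nhds_metric by (auto simp: dist_real_def)
  have "g' 0 = 0"
    by (rule DERIV_local_min[OF r(2), of 0 s]) (use r s in auto)
  moreover obtain k where k: "k > 0" "\<And>h. h > 0 \<Longrightarrow> h < k \<Longrightarrow> g' (0 + h) < g' 0"
    using DERIV_neg_dec_right[OF dd A] by auto
  define t where "t = min r (min s k) / 2"
  have t: "0 < t" "t < r" "t < s" "t < k" using r s k by (auto simp: t_def)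
  obtain x where x: "0 < x" "x < t" "g t - g 0 = (t - 0) * g' x"
    using MVT2[of 0 t g g'] r(2) t by auto
  have "g' x < 0" using k(2)[of x] x t calculation by auto
  then have "g t < g 0" using x t by (metis diff_0_right diff_less_0_iff_less mult_pos_neg)
  then show False using s(2)[of t] t by auto
qed

lemma has_lap_local_min:
  assumes L: "has_lap w z L" and m: "\<forall>\<^sub>F x in nhds z. w z \<le> w x"
  shows "L \<ge> 0"
proof -
  obtain D A B where 1: "\<forall>\<^sub>F x in nhds z. (w has_derivative D x) (at x)"
    "((\<lambda>t. D (z + of_real t) 1) has_real_derivative A) (at 0)"
    "((\<lambda>t. D (z + \<i> * of_real t) \<i>) has_real_derivative B) (at 0)" "L = A + B"
    using assms(1) unfolding has_lap_def by auto
  have *: "C \<ge> 0" if C: "((\<lambda>t. D (z + e * of_real t) e) has_real_derivative C) (at 0)" for C and e :: complex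
  proof (rule second_derivative_local_min[where g = "\<lambda>t. w (z + e * of_real t)", OF _ C])
    have lim: "filterlim (\<lambda>t. z + e * of_real t) (nhds z) (nhds (0::real))"
    proof -
      have "((\<lambda>t. z + e * of_real t) \<longlongrightarrow> z + e * of_real 0) (nhds (0::real))"
        by (intro tendsto_intros filterlim_ident)
      then show ?thesis by simp
    qed
    show "\<forall>\<^sub>F t in nhds 0. ((\<lambda>t. w (z + e * of_real t)) has_real_derivative D (z + e * of_real t) e) (at t)"
      using eventually_compose_filterlim[OF 1(1) lim]
    proof eventually_elim
      case (elim t)
      have "((\<lambda>t. w (z + e * of_real t)) has_derivative (\<lambda>h. D (z + e * of_real t) (e * of_real h))) (at t)"
        by (rule has_derivative_compose[where g=w and f="\<lambda>t. z + e * of_real t", OF _ elim])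
          (auto intro!: derivative_eq_intros)
      moreover have "D (z + e * of_real t) (e * of_real h) = D (z + e * of_real t) e * h" for h
      proof -
        have "linear (D (z + e * of_real t))" using elim has_derivative_linear by blast
        then have "D (z + e * of_real t) (h *\<^sub>R e) = h *\<^sub>R D (z + e * of_real t) e" by (rule linear_scale)
        then show ?thesis by (simp add: scaleR_conv_of_real mult.commute)
      qed
      ultimately show ?case by (simp add: has_field_derivative_def)
    qed
    show "\<forall>\<^sub>F t in nhds 0. w (z + e * of_real 0) \<le> w (z + e * of_real t)"
      using eventually_compose_filterlim[OF m lim] by simp
  qed
  show ?thesis using *[of 1 A] *[of \<i> B] 1 by simp
qed

text \<open>The Laplacian of \<open>|z - c|\<^sup>-\<^sup>2\<close> in the plane is \<open>4 |z - c|\<^sup>-\<^sup>4\<close>, so this barrier is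
  strictly subharmonic and no perturbation is needed in the comparison.\<close>
lemma has_lap_barrier:
  assumes "z \<noteq> c"
  shows "has_lap (\<lambda>x. inverse ((cmod (x - c))\<^sup>2) - K) z (4 * (inverse ((cmod (z - c))\<^sup>2))\<^sup>2)"
proof -
  define N where "N = (\<lambda>x::complex. (x - c) \<bullet> (x - c))"
  have N: "(cmod (x - c))\<^sup>2 = N x" for x by (simp add: N_def power2_norm_eq_inner)
  define D where "D = (\<lambda>x h. - 2 * ((x - c) \<bullet> h) * inverse (N x) ^ 2)"
  have Nz: "N z > 0" using assms by (simp add: N_def)
  have "\<forall>\<^sub>F x in nhds z. x \<in> - {c}" using assms eventually_nhds[of "\<lambda>x. x \<in> -{c}"] open_Compl[of "{c}"] by auto
  then have "\<forall>\<^sub>F x in nhds z. ((\<lambda>x. inverse (N x) - K) has_derivative D x) (at x)"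
  proof eventually_elim
    case (elim x)
    then have "N x \<noteq> 0" by (auto simp: N_def)
    then show ?case unfolding N_def D_def
      by (auto intro!: derivative_eq_intros simp: inner_commute power2_eq_square algebra_simps)
  qed
  moreover define x y where "x = Re (z - c)" and "y = Im (z - c)"
  have Nxy: "N z = x\<^sup>2 + y\<^sup>2" by (simp add: N_def x_def y_def inner_complex_def power2_eq_square)
  have D1: "D (z + of_real t) 1 = - 2 * (x + t) * inverse ((x + t)\<^sup>2 + y\<^sup>2) ^ 2" for t
    by (simp add: D_def N_def inner_complex_def x_def y_def power2_eq_square algebra_simps)
  have D2: "D (z + \<i> * of_real t) \<i> = - 2 * (y + t) * inverse (x\<^sup>2 + (y + t)\<^sup>2) ^ 2" for t
    by (simp add: D_def N_def inner_complex_def x_def y_def power2_eq_square algebra_simps)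
  have nz: "x\<^sup>2 + y\<^sup>2 \<noteq> 0" using Nz Nxy by linarith
  define q where "q = inverse (x\<^sup>2 + y\<^sup>2)"
  have "((\<lambda>t. D (z + of_real t) 1) has_real_derivative (- 2 * q^2 + 8 * x\<^sup>2 * q^3)) (at 0)"
    unfolding D1 by (rule derivative_eq_intros refl | (use nz in simp; fail))+
       (simp add: q_def power2_eq_square power3_eq_cube algebra_simps)
  moreover have "((\<lambda>t. D (z + \<i> * of_real t) \<i>) has_real_derivative (- 2 * q^2 + 8 * y\<^sup>2 * q^3)) (at 0)"
    unfolding D2 by (rule derivative_eq_intros refl | (use nz in simp; fail))+
       (simp add: q_def power2_eq_square power3_eq_cube algebra_simps)
  moreover have "4 * (inverse (N z))\<^sup>2 = (- 2 * q^2 + 8 * x\<^sup>2 * q^3) + (- 2 * q^2 + 8 * y\<^sup>2 * q^3)"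
  proof -
    have "(x\<^sup>2 + y\<^sup>2) * q = 1" using nz by (simp add: q_def)
    then have "8 * q^2 * ((x\<^sup>2 + y\<^sup>2) * q) = 8 * q^2" by simp
    then have "8 * x\<^sup>2 * q^3 + 8 * y\<^sup>2 * q^3 = 8 * q^2"
      by (simp add: power2_eq_square power3_eq_cube algebra_simps)
    then show ?thesis by (simp add: Nxy q_def)
  qed
  ultimately show ?thesis unfolding N has_lap_def by blast
qed

text \<open>On the annulus between the radii \<open>r/2\<close> and \<open>r\<close> the function
  \<open>w - \<delta> * \<psi>\<close> is nonnegative on both circles, and an interior minimum
  contradicts the second derivative test because \<psi> is strictly subharmonic. The growth of
  \<psi> along the radius passes to \<open>w\<close>. The conclusion is a linear lower bound instead
  of a derivative, since \<open>w\<close> is merely continuous at \<open>b\<close>.\<close>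

lemma hopf_lemma:
  assumes r: "r > 0" and cont: "continuous_on (cball c r) w"
    and pos: "\<And>z. z \<in> ball c r \<Longrightarrow> w z > 0"
    and lap: "\<And>z. z \<in> ball c r \<Longrightarrow> \<exists>L\<le>0. has_lap w z L"
    and b: "cmod (b - c) = r"
  shows "\<exists>\<epsilon>>0. \<forall>t. 0 < t \<and> t < 1/2 \<longrightarrow> w (b + of_real t * (c - b)) \<ge> \<epsilon> * t"
proof -
  define m where "m = (\<lambda>z. cmod (z - c))"
  have cm: "continuous_on S m" for S unfolding m_def by (intro continuous_intros)
  have wge: "w z \<ge> 0" if "z \<in> cball c r" for z
    using continuous_ge_on_closure[of "ball c r" w z 0] that cont pos r by (auto simp: closure_ball less_imp_le)
  define A where "A = {z. r/2 \<le> m z} \<inter> cball c r"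
  have A: "compact A" unfolding A_def
    by (intro closed_Int_compact compact_cball closed_Collect_le continuous_intros cm)
  have "compact (sphere c (r/2))" "sphere c (r/2) \<noteq> {}" using r by auto
  then obtain z1 where z1: "z1 \<in> sphere c (r/2)" "\<forall>z\<in>sphere c (r/2). w z1 \<le> w z"
    using continuous_attains_inf[of "sphere c (r/2)" w]
    using continuous_on_subset[OF cont, of "sphere c (r/2)"] r by (auto simp: subset_iff)
  have w1: "w z1 > 0" using z1 pos[of z1] r by auto
  \<comment> \<open>On the inner circle \<psi> equals \<open>4/r^2 - 1/r^2 = 3/r^2\<close>, so this
    choice makes \<open>\<delta> * \<psi>\<close> equal there to the minimum \<open>w z1\<close> of
    \<open>w\<close>.\<close>
  define \<delta> where "\<delta> = w z1 * r\<^sup>2 / 3"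
  have \<delta>: "\<delta> > 0" using w1 r by (simp add: \<delta>_def)
  define \<psi> where "\<psi> = (\<lambda>z. inverse ((m z)\<^sup>2) - inverse (r\<^sup>2))"
  have c\<psi>: "continuous_on A \<psi>" unfolding \<psi>_def
    by (intro continuous_intros cm) (use r in \<open>auto simp: A_def\<close>)
  define g where "g = (\<lambda>z. w z - \<delta> * \<psi> z)"
  have cg: "continuous_on A g" unfolding g_def
    by (intro continuous_intros c\<psi> continuous_on_subset[OF cont]) (auto simp: A_def)
  have bA: "b \<in> A" using b r by (auto simp: A_def m_def dist_norm norm_minus_commute)
  then obtain z0 where z0: "z0 \<in> A" "\<forall>z\<in>A. g z0 \<le> g z"
    using continuous_attains_inf[OF A _ cg] by blast
  have g0: "g z0 \<ge> 0"
  proof -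
    have "m z0 \<le> r" "m z0 \<ge> r/2" using z0 by (auto simp: A_def m_def dist_norm norm_minus_commute)
    then consider "m z0 = r" | "m z0 = r/2" | "r/2 < m z0" "m z0 < r" by linarith
    then show ?thesis
    proof cases
      case 1
      then have "\<psi> z0 = 0" by (simp add: \<psi>_def)
      then show ?thesis using wge z0 by (simp add: g_def A_def)
    next
      case 2
      then have "w z0 \<ge> w z1" using z1 by (auto simp: m_def dist_norm norm_minus_commute)
      moreover have "\<psi> z0 = 3 / r\<^sup>2" using r unfolding \<psi>_def 2 by (simp add: field_simps power2_eq_square)
      ultimately show ?thesis using r by (simp add: g_def \<delta>_def)
    next
      case 3
      then have zb: "z0 \<in> ball c r" by (auto simp: m_def dist_norm norm_minus_commute)
      obtain L where L: "L \<le> 0" "has_lap w z0 L" using lap[OF zb] by auto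
      have "z0 \<noteq> c" using 3 r by (auto simp: m_def)
      then have "has_lap \<psi> z0 (4 * (inverse ((m z0)\<^sup>2))\<^sup>2)" unfolding \<psi>_def m_def by (rule has_lap_barrier)
      from has_lap_lincomb[OF L(2) this, of 1 "-\<delta>"]
      have lg: "has_lap g z0 (L - \<delta> * (4 * (inverse ((m z0)\<^sup>2))\<^sup>2))" by (simp add: g_def[abs_def])
      have "open {z. r/2 < m z \<and> m z < r}"
        unfolding Collect_conj_eq by (intro open_Int open_Collect_less continuous_intros cm)
      then have "\<forall>\<^sub>F z in nhds z0. z \<in> {z. r/2 < m z \<and> m z < r}" using 3 eventually_nhds by blast
      then have "\<forall>\<^sub>F z in nhds z0. g z0 \<le> g z"
      proof eventually_elim
        case (elim z)
        then have "z \<in> A" by (auto simp: A_def m_def dist_norm norm_minus_commute)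
        then show ?case using z0 by auto
      qed
      then have "L - \<delta> * (4 * (inverse ((m z0)\<^sup>2))\<^sup>2) \<ge> 0" using has_lap_local_min lg by blast
      moreover have "\<delta> * (4 * (inverse ((m z0)\<^sup>2))\<^sup>2) > 0" using \<delta> 3 r by simp
      ultimately show ?thesis using L by linarith
    qed
  qed
  have "w (b + of_real t * (c - b)) \<ge> (\<delta> * 2 / r\<^sup>2) * t" if t: "0 < t" "t < 1/2" for t
  proof -
    define z where "z = b + of_real t * (c - b)"
    have "z - c = of_real (1 - t) * (b - c)" by (simp add: z_def algebra_simps)
    then have mz: "m z = (1 - t) * r" using t b by (simp add: m_def norm_mult flip: of_real_diff)
    have "r/2 \<le> m z" "m z \<le> r"
      using mult_right_mono[of "1/2" "1 - t" r] mult_right_mono[of "1 - t" 1 r] mz t r by auto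
    then have "z \<in> A" by (auto simp: A_def m_def dist_norm norm_minus_commute)
    then have "g z \<ge> 0" using z0 g0 by force
    then have "w z \<ge> \<delta> * \<psi> z" by (simp add: g_def)
    moreover have "\<psi> z \<ge> 2 / r\<^sup>2 * t"
    proof -
      \<comment> \<open>The tangent line bound \<open>1/(1 - t)^2 \<ge> 1 + 2 * t\<close>, cleared
        of denominators; it bounds \<psi> below by a linear function of \<open>t\<close>.\<close>
      have "(1 - t) * (1 - t) * (1 + 2 * t) = 1 - t\<^sup>2 * (3 - 2 * t)"
        by (simp add: power2_eq_square algebra_simps)
      also have "\<dots> \<le> 1" using t by simp
      finally have "1 + 2 * t \<le> 1 / (1 - t)\<^sup>2"
        using t by (subst pos_le_divide_eq) (auto simp: power2_eq_square mult.commute)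
      then have "inverse ((1 - t)\<^sup>2) \<ge> 1 + 2 * t" by (simp add: inverse_eq_divide)
      then have "inverse (r\<^sup>2) * (inverse ((1 - t)\<^sup>2) - 1) \<ge> inverse (r\<^sup>2) * (2 * t)"
        using r by (intro mult_left_mono) auto
      moreover have "\<psi> z = inverse (r\<^sup>2) * (inverse ((1 - t)\<^sup>2) - 1)"
        unfolding \<psi>_def mz power_mult_distrib inverse_mult_distrib by (simp add: right_diff_distrib)
      ultimately show ?thesis by (simp add: field_simps)
    qed
    ultimately show ?thesis using mult_left_mono[of "2 / r\<^sup>2 * t" "\<psi> z" \<delta>] \<delta> by (simp add: z_def)
  qed
  moreover have "\<delta> * 2 / r\<^sup>2 > 0" using \<delta> r by simp
  ultimately show ?thesis by blast
qed

text \<open>If \<open>w z1\<close> were nonzero, let \<open>b\<close> be a zero of \<open>w\<close>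
  nearest to \<open>z1\<close>. The Hopf lemma on the disc about \<open>z1\<close> through
  \<open>b\<close> makes \<open>w\<close> grow linearly from \<open>b\<close>, but \<open>b\<close>
  is an interior minimum, so the derivative vanishes there. The radius of this disc is at most
  \<open>dist z0 z1\<close>, and \<open>\<rho>/2\<close> keeps it inside
  \<open>ball z0 \<rho>\<close>.\<close>

lemma strong_minimum_principle_local:
  assumes lap: "\<And>z. z \<in> ball z0 \<rho> \<Longrightarrow> \<exists>L\<le>0. has_lap w z L"
    and nn: "\<And>z. z \<in> ball z0 \<rho> \<Longrightarrow> w z \<ge> 0" and z: "w z0 = 0"
    and z1: "z1 \<in> ball z0 (\<rho>/2)"
  shows "w z1 = 0"
proof (rule ccontr)
  assume nz: "w z1 \<noteq> 0"
  have r0: "\<rho> > 0" using z1 by (smt (verit) dist_not_less_zero half_gt_zero_iff mem_ball)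
  have cont: "continuous_on (ball z0 \<rho>) w" using has_lap_continuous lap by metis
  define d where "d = dist z0 z1"
  have d: "0 \<le> d" "d < \<rho>/2" using z1 by (auto simp: d_def)
  have sub: "cball z1 d \<subseteq> ball z0 \<rho>"
  proof
    fix x assume "x \<in> cball z1 d"
    then show "x \<in> ball z0 \<rho>" using dist_triangle[of z0 x z1] d by (auto simp: d_def)
  qed
  define Z where "Z = {x \<in> cball z1 d. w x = 0}"
  have "closed Z" unfolding Z_def
    using continuous_closed_preimage_constant[OF continuous_on_subset[OF cont sub]] by simp
  moreover have "z0 \<in> Z" using z by (simp add: Z_def d_def dist_commute)
  ultimately obtain b where b: "b \<in> Z" "\<forall>y\<in>Z. dist z1 b \<le> dist z1 y"
    by (metis distance_attains_inf empty_iff)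
  define r where "r = dist z1 b"
  have "w b = 0" "b \<in> cball z1 d" using b by (auto simp: Z_def)
  then have r: "r > 0" "r \<le> d" using nz by (auto simp: r_def)
  have sub2: "cball z1 r \<subseteq> cball z1 d" using r by auto
  have "\<exists>\<epsilon>>0. \<forall>t. 0 < t \<and> t < 1/2 \<longrightarrow> w (b + of_real t * (z1 - b)) \<ge> \<epsilon> * t"
  proof (rule hopf_lemma[OF r(1)])
    show "continuous_on (cball z1 r) w" using continuous_on_subset[OF cont] sub sub2 by blast
    show "w z > 0" if "z \<in> ball z1 r" for z
    proof -
      have "z \<in> cball z1 d" using that r by auto
      moreover have "w z \<noteq> 0"
      proof
        assume "w z = 0"
        then have "z \<in> Z" using calculation by (simp add: Z_def)
        then show False using b that by (auto simp: r_def)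
      qed
      ultimately show ?thesis using nn sub by (metis less_eq_real_def subsetD)
    qed
    show "\<exists>L\<le>0. has_lap w z L" if "z \<in> ball z1 r" for z
      using that lap sub sub2 ball_subset_cball by blast
    show "cmod (b - z1) = r" by (simp add: r_def dist_norm norm_minus_commute)
  qed
  then obtain \<epsilon> where \<epsilon>: "\<epsilon> > 0" "\<And>t. 0 < t \<Longrightarrow> t < 1/2 \<Longrightarrow> w (b + of_real t * (z1 - b)) \<ge> \<epsilon> * t" by blast
  have bb: "b \<in> ball z0 \<rho>" using \<open>b \<in> cball z1 d\<close> sub by blast
  then obtain D where D: "(w has_derivative D) (at b)" using lap has_lap_differentiable by blast
  have "D = (\<lambda>h. 0)"
    by (rule differential_zero_maxmin[OF bb open_ball D]) (use \<open>w b = 0\<close> nn in auto)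
  then have D0: "(w has_derivative (\<lambda>h. 0)) (at b)" using D by simp
  have "((\<lambda>t. w (b + of_real t * (z1 - b))) has_derivative (\<lambda>h. 0)) (at (0::real))"
    by (rule has_derivative_compose[where g=w and g'="\<lambda>_. 0" and f="\<lambda>t. b + of_real t * (z1 - b)"])
      (use D0 in \<open>auto intro!: derivative_eq_intros\<close>)
  then have "((\<lambda>t. w (b + of_real t * (z1 - b))) has_real_derivative 0) (at 0)"
    by (simp add: has_field_derivative_def lambda_zero)
  then have "((\<lambda>t. w (b + of_real t * (z1 - b)) / t) \<longlongrightarrow> 0) (at 0)"
    by (simp add: has_field_derivative_iff \<open>w b = 0\<close>)
  then have "((\<lambda>t. w (b + of_real t * (z1 - b)) / t) \<longlongrightarrow> 0) (at_right 0)"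
    using filterlim_at_split by blast
  moreover have "\<forall>\<^sub>F t in at_right (0::real). \<epsilon> \<le> w (b + of_real t * (z1 - b)) / t"
    unfolding eventually_at_right_field
    by (rule exI[of _ "1/2"]) (use \<epsilon> in \<open>auto simp: field_simps\<close>)
  ultimately have "\<epsilon> \<le> 0" using tendsto_lowerbound trivial_limit_at_right_real by blast
  then show False using \<epsilon> by simp
qed

lemma strong_minimum_principle:
  assumes U: "open U" "connected U"
    and lap: "\<And>z. z \<in> U \<Longrightarrow> \<exists>L\<le>0. has_lap w z L"
    and nn: "\<And>z. z \<in> U \<Longrightarrow> w z \<ge> 0" and z: "z0 \<in> U" "w z0 = 0"
    and z1: "z1 \<in> U"
  shows "w z1 = 0"
proof -
  define Z where "Z = {z \<in> U. w z = 0}"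
  have cont: "continuous_on U w" using has_lap_continuous lap by metis
  have "openin (top_of_set U) Z"
  proof -
    have "open Z"
      unfolding open_contains_ball
    proof
      fix x assume x: "x \<in> Z"
      then obtain \<rho> where \<rho>: "\<rho> > 0" "ball x \<rho> \<subseteq> U" using U(1) by (auto simp: Z_def open_contains_ball)
      have "ball x (\<rho>/2) \<subseteq> Z"
      proof
        fix y assume y: "y \<in> ball x (\<rho>/2)"
        have "w y = 0" by (rule strong_minimum_principle_local[OF _ _ _ y]) (use \<rho> lap nn x in \<open>auto simp: Z_def\<close>)
        moreover have "y \<in> U" using y \<rho> by auto
        ultimately show "y \<in> Z" by (simp add: Z_def)
      qed
      then show "\<exists>e>0. ball x e \<subseteq> Z" using \<rho> by (intro exI[of _ "\<rho>/2"]) auto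
    qed
    then show ?thesis by (auto simp: Z_def intro: open_subset)
  qed
  moreover have "closedin (top_of_set U) Z" unfolding Z_def
    using continuous_closedin_preimage_constant[OF cont] by simp
  moreover have "Z \<noteq> {}" using z by (auto simp: Z_def)
  ultimately have "Z = U" using U(2) by (metis connected_clopen)
  then show ?thesis using z1 by (auto simp: Z_def)
qed


section \<open>Isometries of the upper half-plane\<close>

definition moeb :: "real \<Rightarrow> real \<Rightarrow> real \<Rightarrow> real \<Rightarrow> complex \<Rightarrow> complex" where
  "moeb a b c d z = (of_real a * z + of_real b) / (of_real c * z + of_real d)"

lemma moeb_denom:
  assumes "z \<in> H2" "a * d - b * c = 1"
  shows "of_real c * z + of_real d \<noteq> 0"
proof
  assume 0: "of_real c * z + of_real d = 0"
  then have "c * Im z = 0" by (metis Im_complex_of_real add_cancel_right_right complex.sel(2) plus_complex.sel(2) scaleR_complex.simps(2) scaleR_conv_of_real zero_complex.sel(2))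
  then have "c = 0" using assms by (auto simp: H2_def)
  then show False using 0 assms by auto
qed

lemma moeb_Im:
  assumes "z \<in> H2" "a * d - b * c = 1"
  shows "Im (moeb a b c d z) = Im z / (cmod (of_real c * z + of_real d))\<^sup>2"
proof -
  have "a * Im z * (c * Re z + d) - (a * Re z + b) * (c * Im z) = (a * d - b * c) * Im z"
    by (simp add: algebra_simps)
  then show ?thesis using assms unfolding moeb_def Im_divide
    by (simp add: cmod_power2)
qed

lemma moeb_H2:
  assumes "z \<in> H2" "a * d - b * c = 1"
  shows "moeb a b c d z \<in> H2"
  using moeb_Im[OF assms] moeb_denom[OF assms] assms by (simp add: H2_def)

lemma moeb_diff:
  assumes "z \<in> H2" "w \<in> H2" "a * d - b * c = 1"
  shows "moeb a b c d z - moeb a b c d w =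
    (z - w) / ((of_real c * z + of_real d) * (of_real c * w + of_real d))"
proof -
  have "(of_real a * z + of_real b) * (of_real c * w + of_real d) - (of_real a * w + of_real b) * (of_real c * z + of_real d)
     = of_real (a * d - b * c) * (z - w)" by (simp add: algebra_simps)
  then show ?thesis using moeb_denom[OF assms(1,3)] moeb_denom[OF assms(2,3)] assms(3)
    unfolding moeb_def by (simp add: diff_frac_eq)
qed

lemma hdist_moeb:
  assumes "z \<in> H2" "w \<in> H2" "a * d - b * c = 1"
  shows "hdist (moeb a b c d z) (moeb a b c d w) = hdist z w"
proof -
  define m n where "m = (cmod (of_real c * z + of_real d))\<^sup>2" and "n = (cmod (of_real c * w + of_real d))\<^sup>2"
  have mn: "m > 0" "n > 0" using moeb_denom[OF assms(1,3)] moeb_denom[OF assms(2,3)] by (auto simp: m_def n_def)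
  have "(cmod (moeb a b c d z - moeb a b c d w))\<^sup>2 = (cmod (z - w))\<^sup>2 / (m * n)"
    unfolding moeb_diff[OF assms] by (simp add: norm_divide norm_mult power_divide power_mult_distrib m_def n_def)
  moreover have "Im (moeb a b c d z) = Im z / m" "Im (moeb a b c d w) = Im w / n"
    using moeb_Im assms by (auto simp: m_def n_def)
  ultimately have "(cmod (moeb a b c d z - moeb a b c d w))\<^sup>2 / (2 * Im (moeb a b c d z) * Im (moeb a b c d w))
     = (cmod (z - w))\<^sup>2 / (2 * Im z * Im w)" using mn by simp
  then show ?thesis by (simp add: hdist_def)
qed

lemma moeb_comp:
  assumes "z \<in> H2" "a * d - b * c = 1"
  shows "moeb a' b' c' d' (moeb a b c d z)
    = moeb (a' * a + b' * c) (a' * b + b' * d) (c' * a + d' * c) (c' * b + d' * d) z"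
proof -
  define A D where "A = of_real a * z + of_real b" and "D = of_real c * z + of_real d"
  have "D \<noteq> 0" using moeb_denom[OF assms] by (simp add: D_def)
  then have "of_real e * (A / D) + of_real f = (of_real e * A + of_real f * D) / D" for e f :: real
    by (simp add: field_simps)
  then have "moeb a' b' c' d' (A / D) = (of_real a' * A + of_real b' * D) / (of_real c' * A + of_real d' * D)"
    using \<open>D \<noteq> 0\<close> by (simp add: moeb_def)
  then show ?thesis by (simp add: moeb_def A_def D_def algebra_simps)
qed

text \<open>The orientation-preserving isometries. Agreement with a Moebius map is demanded on
  \<open>H2\<close> only, so composites and inverses qualify whatever value division gives at a
  pole.\<close>

definition hiso :: "(complex \<Rightarrow> complex) \<Rightarrow> bool" where
  "hiso M \<longleftrightarrow> (\<exists>a b c d. a * d - b * c = 1 \<and> (\<forall>z\<in>H2. M z = moeb a b c d z))"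

lemma hisoI: "a * d - b * c = 1 \<Longrightarrow> hiso (moeb a b c d)"
  unfolding hiso_def by blast

lemma hiso_H2: "hiso M \<Longrightarrow> z \<in> H2 \<Longrightarrow> M z \<in> H2"
  unfolding hiso_def using moeb_H2 by metis

lemma hiso_hdist: "hiso M \<Longrightarrow> z \<in> H2 \<Longrightarrow> w \<in> H2 \<Longrightarrow> hdist (M z) (M w) = hdist z w"
  unfolding hiso_def using hdist_moeb by metis

lemma hiso_comp:
  assumes "hiso M" "hiso N"
  shows "hiso (\<lambda>z. M (N z))"
proof -
  obtain a b c d where N: "a * d - b * c = 1" "\<forall>z\<in>H2. N z = moeb a b c d z"
    using assms(2) unfolding hiso_def by blast
  obtain a' b' c' d' where M: "a' * d' - b' * c' = 1" "\<forall>z\<in>H2. M z = moeb a' b' c' d' z"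
    using assms(1) unfolding hiso_def by blast
  have "M (N z) = moeb (a' * a + b' * c) (a' * b + b' * d) (c' * a + d' * c) (c' * b + d' * d) z"
    if z: "z \<in> H2" for z
    using M N moeb_comp[OF z N(1)] moeb_H2[OF z N(1)] z by simp
  moreover have "(a' * a + b' * c) * (c' * b + d' * d) - (a' * b + b' * d) * (c' * a + d' * c) = 1"
  proof -
    have "(a' * a + b' * c) * (c' * b + d' * d) - (a' * b + b' * d) * (c' * a + d' * c)
       = (a * d - b * c) * (a' * d' - b' * c')" by (simp add: algebra_simps)
    then show ?thesis using M N by simp
  qed
  ultimately show ?thesis unfolding hiso_def by blast
qed

lemma hiso_inverse:
  assumes "hiso M"
  obtains N where "hiso N" "\<And>z. z \<in> H2 \<Longrightarrow> N (M z) = z" "\<And>z. z \<in> H2 \<Longrightarrow> M (N z) = z"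
proof -
  obtain a b c d where M: "a * d - b * c = 1" "\<forall>z\<in>H2. M z = moeb a b c d z"
    using assms(1) unfolding hiso_def by blast
  have d': "d * a - (-b) * (-c) = 1" using M by (simp add: mult.commute)
  show ?thesis
  proof (rule that)
    show "hiso (moeb d (-b) (-c) a)" using d' by (rule hisoI)
    show "moeb d (-b) (-c) a (M z) = z" if z: "z \<in> H2" for z
      using M z moeb_comp[OF z M(1), of d "-b" "-c" a] by (simp add: moeb_def algebra_simps flip: of_real_mult of_real_diff)
    show "M (moeb d (-b) (-c) a z) = z" if z: "z \<in> H2" for z
      using M z moeb_H2[OF z d'] moeb_comp[OF z d', of a b c d] by (simp add: moeb_def algebra_simps flip: of_real_mult of_real_diff)
  qed
qed

lemma hiso_continuous:
  assumes "hiso M"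
  shows "continuous_on H2 M"
proof -
  obtain a b c d where M: "a * d - b * c = 1" "\<forall>z\<in>H2. M z = moeb a b c d z"
    using assms(1) unfolding hiso_def by blast
  have "continuous_on H2 (moeb a b c d)"
    unfolding moeb_def[abs_def] by (intro continuous_intros) (use moeb_denom M in auto)
  then show ?thesis using M continuous_on_cong by (metis (no_types, lifting))
qed

section \<open>Distance and balls in Euclidean coordinates\<close>

lemma hdist_cosh:
  assumes "z \<in> H2" "w \<in> H2"
  shows "cosh (hdist z w) = 1 + (cmod (z - w))\<^sup>2 / (2 * Im z * Im w)" "hdist z w \<ge> 0"
proof -
  have "(cmod (z - w))\<^sup>2 / (2 * Im z * Im w) \<ge> 0" using assms by (simp add: H2_def)
  then show "cosh (hdist z w) = 1 + (cmod (z - w))\<^sup>2 / (2 * Im z * Im w)" "hdist z w \<ge> 0"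
    unfolding hdist_def by (auto simp: cosh_arcosh_real)
qed

lemma cosh_le_iff: "0 \<le> x \<Longrightarrow> 0 \<le> y \<Longrightarrow> cosh x \<le> cosh y \<longleftrightarrow> x \<le> (y::real)"
  by (simp add: cosh_real_nonneg_le_iff)

lemma hdist_commute: "hdist z w = hdist w z"
  by (simp add: hdist_def norm_minus_commute mult.commute mult.left_commute)

lemma hdist_refl [simp]: "hdist z z = 0"
  by (simp add: hdist_def)

lemma hdist_eqI:
  assumes "z \<in> H2" "w \<in> H2" "0 \<le> r" "cosh r = 1 + (cmod (z - w))\<^sup>2 / (2 * Im z * Im w)"
  shows "hdist z w = r"
  unfolding hdist_def assms(4)[symmetric] using assms(3) by (rule arcosh_cosh_real)

text \<open>Both equivalences follow from one identity: \<open>|z - e|^2 - \<rho>^2\<close> equals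
  \<open>2 * Im p * Im z\<close> times \<open>cosh (hdist p z) - cosh r\<close>. A hyperbolic disc
  is a Euclidean disc with a higher centre.\<close>

lemma hdist_le_iff:
  assumes "p \<in> H2" "z \<in> H2" "r \<ge> 0"
  shows "hdist p z \<le> r \<longleftrightarrow> cmod (z - Complex (Re p) (Im p * cosh r)) \<le> Im p * sinh r"
    and "hdist p z < r \<longleftrightarrow> cmod (z - Complex (Re p) (Im p * cosh r)) < Im p * sinh r"
proof -
  define e where "e = Complex (Re p) (Im p * cosh r)"
  define \<rho> where "\<rho> = Im p * sinh r"
  have pz: "Im p > 0" "Im z > 0" using assms by (auto simp: H2_def)
  have r0: "\<rho> \<ge> 0" using pz assms by (simp add: \<rho>_def)
  have sc: "sinh r ^ 2 = cosh r ^ 2 - 1" by (simp add: sinh_square_eq)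
  have *: "(cmod (z - e))\<^sup>2 - \<rho>\<^sup>2 = 2 * Im p * Im z * (cosh (hdist p z) - cosh r)"
  proof -
    have "2 * Im p * Im z * (cosh (hdist p z) - cosh r) = (cmod (p - z))\<^sup>2 - 2 * Im p * Im z * (cosh r - 1)"
      unfolding hdist_cosh(1)[OF assms(1,2)] using pz by (simp add: field_simps)
    moreover have "\<rho>\<^sup>2 = Im p ^ 2 * (cosh r ^ 2 - 1)" by (simp add: \<rho>_def power_mult_distrib sc)
    ultimately show ?thesis
      unfolding cmod_power2 e_def by (simp add: power2_eq_square algebra_simps)
  qed
  have pos: "2 * Im p * Im z > 0" using pz by simp
  have "hdist p z \<le> r \<longleftrightarrow> cosh (hdist p z) - cosh r \<le> 0" using hdist_cosh(2) assms by (simp add: cosh_le_iff)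
  also have "\<dots> \<longleftrightarrow> (cmod (z - e))\<^sup>2 - \<rho>\<^sup>2 \<le> 0" unfolding * using mult_le_cancel_left_pos[OF pos, of _ 0] by (metis mult_zero_right)
  also have "\<dots> \<longleftrightarrow> cmod (z - e) \<le> \<rho>" using r0 power2_le_iff_abs_le by (metis abs_norm_cancel diff_le_0_iff_le)
  finally show "hdist p z \<le> r \<longleftrightarrow> cmod (z - e) \<le> \<rho>" .
  have "hdist p z < r \<longleftrightarrow> cosh (hdist p z) - cosh r < 0" using hdist_cosh(2) assms by (simp add: cosh_real_nonneg_less_iff)
  also have "\<dots> \<longleftrightarrow> (cmod (z - e))\<^sup>2 - \<rho>\<^sup>2 < 0" unfolding * using mult_less_cancel_left_pos[OF pos, of _ 0] by (metis mult_zero_right)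
  also have "\<dots> \<longleftrightarrow> cmod (z - e) < \<rho>" using r0 by (metis abs_le_square_iff abs_norm_cancel abs_of_nonneg diff_less_0_iff_less not_le)
  finally show "hdist p z < r \<longleftrightarrow> cmod (z - e) < \<rho>" .
qed

text \<open>Euclidean centre, and below it the Euclidean radius, of the hyperbolic disc of radius
  \<open>r\<close> about \<open>p\<close>. The flat minimum principle is applied on these
  discs.\<close>

definition hcen :: "complex \<Rightarrow> real \<Rightarrow> complex" where
  "hcen p r = Complex (Re p) (Im p * cosh r)"

definition hrad :: "complex \<Rightarrow> real \<Rightarrow> real" where
  "hrad p r = Im p * sinh r"

text \<open>The lowest point of the disc has height \<open>Im p * exp (- r)\<close>, which is
  positive.\<close>

lemma cball_hcen_subset:
  assumes "p \<in> H2" "r \<ge> 0"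
  shows "cball (hcen p r) (hrad p r) \<subseteq> H2"
proof
  fix z assume "z \<in> cball (hcen p r) (hrad p r)"
  then have "cmod (hcen p r - z) \<le> hrad p r" by (simp add: dist_norm)
  then have "\<bar>Im (hcen p r - z)\<bar> \<le> Im p * sinh r" using abs_Im_le_cmod order_trans by (fastforce simp: hrad_def)
  then have "Im p * (cosh r - sinh r) \<le> Im z" by (simp add: hcen_def algebra_simps)
  moreover have "Im p * (cosh r - sinh r) > 0" using assms by (simp add: H2_def cosh_minus_sinh)
  ultimately show "z \<in> H2" by (simp add: H2_def)
qed

lemma hball_eq_ball:
  assumes "p \<in> H2" "r \<ge> 0"
  shows "hball p r = ball (hcen p r) (hrad p r)"
  using hdist_le_iff(2)[OF assms(1) _ assms(2)] cball_hcen_subset[OF assms]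
  by (auto simp: hball_def dist_norm norm_minus_commute hcen_def[symmetric] hrad_def[symmetric] subset_iff)

lemma hcball_eq_cball:
  assumes "p \<in> H2" "r \<ge> 0"
  shows "{z \<in> H2. hdist p z \<le> r} = cball (hcen p r) (hrad p r)"
  using hdist_le_iff(1)[OF assms(1) _ assms(2)] cball_hcen_subset[OF assms]
  by (auto simp: dist_norm norm_minus_commute hcen_def[symmetric] hrad_def[symmetric] subset_iff)

lemma open_H2: "open H2"
  unfolding H2_def by (rule open_halfspace_Im_gt)

lemma hdist_continuous: "continuous_on (H2 \<times> H2) (\<lambda>x. hdist (fst x) (snd x))"
proof -
  have "continuous_on (H2 \<times> H2) (\<lambda>x. 1 + (cmod (fst x - snd x))\<^sup>2 / (2 * Im (fst x) * Im (snd x)))"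
    by (intro continuous_intros) (auto simp: H2_def)
  moreover have "1 + (cmod (fst x - snd x))\<^sup>2 / (2 * Im (fst x) * Im (snd x)) \<ge> 1" if "x \<in> H2 \<times> H2" for x
    using that by (auto simp: H2_def)
  ultimately show ?thesis unfolding hdist_def
    by (intro continuous_on_compose2[OF continuous_on_arcosh[of "{1..}"]]) auto
qed

section \<open>Normal forms for pairs of points\<close>

lemma hdist_i_is:
  assumes "Y \<ge> 1"
  shows "hdist \<i> (\<i> * of_real Y) = ln Y"
proof (rule hdist_eqI)
  have "cmod (\<i> - \<i> * of_real Y) = \<bar>1 - Y\<bar>"
    by (simp add: cmod_def)
  then have "(cmod (\<i> - \<i> * of_real Y))\<^sup>2 = (1 - Y)\<^sup>2" by simp
  then show "cosh (ln Y) = 1 + (cmod (\<i> - \<i> * of_real Y))\<^sup>2 / (2 * Im \<i> * Im (\<i> * of_real Y))"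
    using assms by (simp add: cosh_ln_real field_simps power2_eq_square)
qed (use assms in \<open>auto simp: H2_def\<close>)

text \<open>The logarithm of the height is 1-Lipschitz, stated for one point on the imaginary axis:
  dropping the horizontal displacement from the formula for \<open>cosh\<close> leaves
  \<open>cosh (ln (y / s))\<close>.\<close>

lemma hdist_i_ge_ln:
  assumes "z \<in> H2" "s > 0"
  shows "hdist (\<i> * of_real s) z \<ge> \<bar>ln (Im z) - ln s\<bar>"
proof -
  define y where "y = Im z"
  have y: "y > 0" using assms by (simp add: H2_def y_def)
  have isH: "\<i> * of_real s \<in> H2" using assms by (simp add: H2_def)
  have "\<bar>Im (\<i> * of_real s - z)\<bar> \<le> cmod (\<i> * of_real s - z)" by (rule abs_Im_le_cmod)
  then have "(s - y)\<^sup>2 \<le> (cmod (\<i> * of_real s - z))\<^sup>2"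
    using power_mono[of "\<bar>s - y\<bar>" _ 2] by (simp add: y_def)
  then have "1 + (s - y)\<^sup>2 / (2 * s * y) \<le> cosh (hdist (\<i> * of_real s) z)"
    unfolding hdist_cosh(1)[OF isH assms(1)] using assms y by (simp add: y_def[symmetric] divide_right_mono)
  moreover have "1 + (s - y)\<^sup>2 / (2 * s * y) = cosh (ln (y / s))"
    using assms y by (simp add: cosh_ln_real field_simps power2_eq_square)
  ultimately have "cosh \<bar>ln (y / s)\<bar> \<le> cosh (hdist (\<i> * of_real s) z)" by simp
  then have "\<bar>ln (y / s)\<bar> \<le> hdist (\<i> * of_real s) z" 
    using hdist_cosh(2)[OF isH assms(1)] cosh_le_iff[of "\<bar>ln (y / s)\<bar>"] by simp
  then show ?thesis using assms y by (simp add: ln_div y_def)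
qed

text \<open>The maps are the rotations about \<i>. \<open>F\<close> is the numerator of the real
  part of the image of \<open>b\<close>; it runs from \<open>Re b\<close> to \<open>- Re b\<close>,
  so the intermediate value theorem gives a zero.\<close>

lemma rotate_to_axis:
  assumes "b \<in> H2"
  obtains \<phi> where "Re (moeb (cos \<phi>) (sin \<phi>) (- sin \<phi>) (cos \<phi>) b) = 0"
proof -
  define F where "F = (\<lambda>\<phi>. (cos \<phi> * Re b + sin \<phi>) * (cos \<phi> - sin \<phi> * Re b) - cos \<phi> * sin \<phi> * (Im b)\<^sup>2)"
  have "continuous_on {0..pi/2} F" unfolding F_def by (intro continuous_intros)
  moreover have F0: "F 0 = Re b" "F (pi/2) = - Re b" by (auto simp: F_def)
  have "\<exists>\<phi>. F \<phi> = 0"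
  proof (cases "Re b \<le> 0")
    case True
    then show ?thesis using IVT'[of F 0 0 "pi/2"] calculation F0 by auto
  next
    case False
    then show ?thesis using IVT2'[of F "pi/2" 0 0] calculation F0 by auto
  qed
  then obtain \<phi> where "F \<phi> = 0" by blast
  then have "Re (moeb (cos \<phi>) (sin \<phi>) (- sin \<phi>) (cos \<phi>) b) = 0"
    by (simp add: moeb_def Re_divide F_def power2_eq_square algebra_simps)
  then show ?thesis using that by blast
qed

text \<open>An affine map takes \<open>a\<close> to \<i>, a rotation about \<i> brings
  \<open>b\<close> to the axis, and \<open>-1/z\<close>, which fixes \<i>, lifts the image of
  \<open>b\<close> above \<i> if it lies below. The height of that image is then forced by the
  distance.\<close>

lemma hiso_normal_form:
  assumes "a \<in> H2" "b \<in> H2"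
  shows "\<exists>M. hiso M \<and> M a = \<i> \<and> M b = \<i> * of_real (exp (hdist a b))"
proof -
  define x y where "x = Re a" and "y = Im a"
  have y: "y > 0" using assms by (simp add: H2_def y_def)
  define A where "A = moeb (1 / sqrt y) (- x / sqrt y) 0 (sqrt y)"
  have A: "hiso A" unfolding A_def by (rule hisoI) (use y in simp)
  have sy: "complex_of_real (sqrt y) * of_real (sqrt y) = of_real y" using y by (simp flip: of_real_mult)
  have "A a = (a - of_real x) / of_real y"
    unfolding A_def moeb_def sy[symmetric] using y by (simp add: field_simps)
  also have "a - of_real x = \<i> * of_real y" by (simp add: x_def y_def complex_eq_iff)
  finally have Aa: "A a = \<i>" using y by simp
  obtain \<phi> where \<phi>: "Re (moeb (cos \<phi>) (sin \<phi>) (- sin \<phi>) (cos \<phi>) (A b)) = 0"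
    using rotate_to_axis hiso_H2[OF A assms(2)] by blast
  define B where "B = moeb (cos \<phi>) (sin \<phi>) (- sin \<phi>) (cos \<phi>)"
  have B: "hiso B" unfolding B_def by (rule hisoI) (simp flip: power2_eq_square)
  have Bi: "B \<i> = \<i>"
  proof -
    have "(of_real (cos \<phi>) * \<i> + of_real (sin \<phi>)) = \<i> * (of_real (- sin \<phi>) * \<i> + of_real (cos \<phi>))"
      by (simp add: algebra_simps)
    moreover have "\<i> \<in> H2" by (simp add: H2_def)
    ultimately show ?thesis unfolding B_def moeb_def
      using moeb_denom[of \<i> "cos \<phi>" "cos \<phi>" "sin \<phi>" "- sin \<phi>"] by (simp flip: power2_eq_square)
  qed
  define Y where "Y = Im (B (A b))"
  have Y: "Y > 0" using hiso_H2[OF B hiso_H2[OF A assms(2)]] by (simp add: Y_def H2_def)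
  have BA: "B (A b) = \<i> * of_real Y" using \<phi> by (simp add: B_def[symmetric] Y_def complex_eq_iff)
  have main: ?thesis if M: "hiso M" "M a = \<i>" "M b = \<i> * of_real Z" "Z \<ge> 1" for M Z
  proof -
    have "hdist a b = ln Z" using hiso_hdist[OF M(1) assms] hdist_i_is[OF M(4)] M by simp
    then show ?thesis using M by auto
  qed
  show ?thesis
  proof (cases "Y \<ge> 1")
    case True
    show ?thesis by (rule main[of "\<lambda>z. B (A z)", OF hiso_comp[OF B A] _ _ True]) (use Aa Bi BA in auto)
  next
    case False
    define C where "C = moeb 0 (-1) 1 0"
    have C: "hiso C" unfolding C_def by (rule hisoI) simp
    have "C \<i> = \<i>" "C (\<i> * of_real Y) = \<i> * of_real (1 / Y)"
      using Y by (auto simp: C_def moeb_def complex_eq_iff Re_divide Im_divide power2_eq_square)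
    then show ?thesis
      by (intro main[of "\<lambda>z. C (B (A z))" "1/Y", OF hiso_comp[OF C hiso_comp[OF B A]]])
        (use Aa Bi BA False Y in auto)
  qed
qed

text \<open>With \<open>x\<close> and \<open>z\<close> moved onto the imaginary axis, the two
  distances to \<open>y\<close> are bounded below by differences of logarithmic heights, which
  together amount to at least \<open>hdist x z\<close>.\<close>

lemma hdist_triangle:
  assumes "x \<in> H2" "y \<in> H2" "z \<in> H2"
  shows "hdist x z \<le> hdist x y + hdist y z"
proof -
  obtain M where M: "hiso M" "M x = \<i>" "M z = \<i> * of_real (exp (hdist x z))"
    using hiso_normal_form assms by blast
  have My: "M y \<in> H2" using hiso_H2 M assms by blast
  have "hdist x y \<ge> \<bar>ln (Im (M y))\<bar>"
    using hdist_i_ge_ln[OF My, of 1] hiso_hdist[OF M(1) assms(1,2)] M(2) by simp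
  moreover have "hdist y z \<ge> \<bar>ln (Im (M y)) - hdist x z\<bar>"
    using hdist_i_ge_ln[OF My, of "exp (hdist x z)"] hiso_hdist[OF M(1) assms(3,2)] M(3)
    by (simp add: hdist_commute)
  ultimately show ?thesis by linarith
qed

text \<open>\<open>b\<close> is moved on along the geodesic from \<open>a\<close> through
  \<open>b\<close>. This turns a pair at distance exactly \<open>2 * R\<close> into one that is
  farther apart.\<close>

lemma hdist_no_local_max:
  assumes "a \<in> H2" "b \<in> H2" "\<epsilon> > 0"
  obtains b' where "b' \<in> H2" "dist b b' < \<epsilon>" "hdist a b' > hdist a b"
proof -
  obtain M where M: "hiso M" "M a = \<i>" "M b = \<i> * of_real (exp (hdist a b))"
    using hiso_normal_form assms by blast
  obtain N where N: "hiso N" "\<And>z. z \<in> H2 \<Longrightarrow> N (M z) = z" "\<And>z. z \<in> H2 \<Longrightarrow> M (N z) = z"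
    using hiso_inverse[OF M(1)] by blast
  define g where "g = (\<lambda>s. N (\<i> * of_real s))"
  define s0 where "s0 = exp (hdist a b)"
  have s0: "s0 \<ge> 1" using hdist_cosh(2)[OF assms(1,2)] by (simp add: s0_def)
  have "continuous_on {0<..} g" unfolding g_def
    by (rule continuous_on_compose2[OF hiso_continuous[OF N(1)]]) (auto intro!: continuous_intros simp: H2_def)
  then have "isCont g s0" using s0 continuous_on_eq_continuous_at[of "{0<..}" g] by auto
  then obtain d where d: "d > 0" "\<And>s. \<bar>s - s0\<bar> < d \<Longrightarrow> dist (g s) (g s0) < \<epsilon>"
    using assms(3) unfolding continuous_at_eps_delta by (auto simp: dist_real_def)
  define s where "s = s0 + d/2"
  have s: "s > s0" "\<bar>s - s0\<bar> < d" using d by (auto simp: s_def)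
  have sH: "\<i> * of_real s \<in> H2" using s s0 by (simp add: H2_def)
  have gs: "g s \<in> H2" unfolding g_def using hiso_H2[OF N(1) sH] .
  have "g s0 = b" using N(2)[OF assms(2)] M(3) by (simp add: g_def s0_def)
  moreover have "hdist a (g s) = ln s"
    using hiso_hdist[OF M(1) assms(1) gs] M(2) N(3)[OF sH] hdist_i_is[of s] s s0 by (simp add: g_def)
  moreover have "ln s > hdist a b" using s s0 by (metis exp_gt_zero exp_less_cancel_iff exp_ln less_trans s0_def)
  ultimately show ?thesis using that[OF gs] d(2)[OF s(2)] by (simp add: dist_commute)
qed

text \<open>An isometry that moves the perpendicular bisector of \<open>a\<close>, \<open>b\<close> to the imaginary axis.\<close>
lemma hiso_bisector:
  assumes "a \<in> H2" "b \<in> H2"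
  obtains M where "hiso M" "Re (M a) / Im (M a) = - sinh (hdist a b / 2)"
    "Re (M b) / Im (M b) = sinh (hdist a b / 2)"
proof -
  obtain M where M: "hiso M" "M a = \<i>" "M b = \<i> * of_real (exp (hdist a b))"
    using hiso_normal_form assms by blast
  define D where "D = hdist a b"
  \<comment> \<open>Scaling by \<open>exp (- D / 2)\<close> brings the midpoint of the two images to
    \<i>; their bisector is then the unit semicircle.\<close>
  define A where "A = moeb (exp (- D / 4)) 0 0 (exp (D / 4))"
  have A: "hiso A" unfolding A_def by (rule hisoI) (simp flip: exp_add)
  \<comment> \<open>The quarter turn \<open>(z - 1) / (z + 1)\<close> about \<i>. It takes the unit
    semicircle to the imaginary axis and the imaginary axis to the unit semicircle, where the ratio
    of real to imaginary part is \<open>sinh\<close> of the signed distance to the imaginary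
    axis.\<close>
  define B where "B = moeb (1 / sqrt 2) (- 1 / sqrt 2) (1 / sqrt 2) (1 / sqrt 2)"
  have B: "hiso B" unfolding B_def by (rule hisoI) (simp add: field_simps)
  have Az: "A z = of_real (exp (- D / 2)) * z" for z
  proof -
    have "exp (- D / 4) / exp (D / 4) = exp (- D / 2)" by (simp flip: exp_diff)
    then show ?thesis unfolding A_def moeb_def
      by (metis add.right_neutral mult_zero_left of_real_0 of_real_divide times_divide_eq_left add.left_neutral)
  qed
  have Bz: "B z = (z - 1) / (z + 1)" for z
  proof -
    have "B z = (of_real (1 / sqrt 2) * (z - 1)) / (of_real (1 / sqrt 2) * (z + 1))"
      unfolding B_def moeb_def by (simp add: diff_divide_distrib add_divide_distrib)
    then show ?thesis by (simp only: mult_divide_mult_cancel_left_if) simp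
  qed
  have q: "Re (B (\<i> * of_real Y)) / Im (B (\<i> * of_real Y)) = (Y - inverse Y) / 2" if "Y > 0" for Y
  proof -
    have p: "1 + Y\<^sup>2 > 0" by (smt (verit) zero_le_power2)
    have "Re (B (\<i> * of_real Y)) = (Y\<^sup>2 - 1) / (1 + Y\<^sup>2)" "Im (B (\<i> * of_real Y)) = 2 * Y / (1 + Y\<^sup>2)"
      by (simp_all add: Bz Re_divide Im_divide power2_eq_square)
    then have "Re (B (\<i> * of_real Y)) / Im (B (\<i> * of_real Y)) = (Y\<^sup>2 - 1) / (2 * Y)"
      using p by (simp del: of_real_power)
    then show ?thesis using that by (simp add: field_simps power2_eq_square)
  qed
  have Ma: "A (M a) = \<i> * of_real (exp (- D / 2))" using M by (simp add: Az mult.commute)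
  have "exp (- D / 2) * exp D = exp (D / 2)" by (simp flip: exp_add)
  then have Mb: "A (M b) = \<i> * of_real (exp (D / 2))" using M
    by (simp add: Az D_def[symmetric] mult.commute mult.left_commute flip: of_real_mult)
  show ?thesis
  proof (rule that[of "\<lambda>z. B (A (M z))"])
    show "hiso (\<lambda>z. B (A (M z)))" using hiso_comp[OF B hiso_comp[OF A M(1)]] .
    show "Re (B (A (M a))) / Im (B (A (M a))) = - sinh (hdist a b / 2)"
      unfolding Ma using q[of "exp (- D / 2)"] by (simp add: sinh_field_def exp_minus D_def field_simps)
    show "Re (B (A (M b))) / Im (B (A (M b))) = sinh (hdist a b / 2)"
      unfolding Mb using q[of "exp (D / 2)"] by (simp add: sinh_field_def exp_minus D_def)
  qed
qed

text \<open>Written out, the distance bound becomes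
  \<open>x^2 + (s - y * cosh R)^2 \<le> (y * sinh R)^2\<close>. The first summand alone gives the
  tube \<open>|x / y| \<le> sinh R\<close>, which is the same for all \<open>s\<close>; the heights
  come from the Lipschitz bound for the logarithm.\<close>

lemma hball_imaginary_axis:
  assumes "z \<in> H2" "s > 0" "R \<ge> 0" "hdist (\<i> * of_real s) z \<le> R"
  shows "\<bar>Re z / Im z\<bar> \<le> sinh R" "s * exp (- R) \<le> Im z" "Im z \<le> s * exp R"
proof -
  define x y where "x = Re z" and "y = Im z"
  have y: "y > 0" using assms by (simp add: H2_def y_def)
  have isH: "\<i> * of_real s \<in> H2" using assms by (simp add: H2_def)
  have "cosh (hdist (\<i> * of_real s) z) \<le> cosh R" using assms hdist_cosh(2)[OF isH assms(1)] cosh_le_iff by blast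
  then have "1 + (x\<^sup>2 + (s - y)\<^sup>2) / (2 * s * y) \<le> cosh R"
    unfolding hdist_cosh(1)[OF isH assms(1)] cmod_power2 by (simp add: x_def y_def)
  then have "2 * s * y + (x\<^sup>2 + (s - y)\<^sup>2) \<le> cosh R * (2 * s * y)"
    using assms y by (simp add: field_simps)
  then have "x\<^sup>2 + (s - y * cosh R)\<^sup>2 \<le> y\<^sup>2 * (cosh R ^ 2 - 1)"
    by (simp add: power2_eq_square algebra_simps)
  then have "x\<^sup>2 \<le> (y * sinh R)\<^sup>2"
    by (smt (verit) power_mult_distrib sinh_square_eq zero_le_power2)
  then have "\<bar>x\<bar> \<le> y * sinh R" using y assms by (metis abs_le_square_iff abs_of_nonneg mult_nonneg_nonneg less_imp_le sinh_real_nonneg_iff)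
  then show "\<bar>Re z / Im z\<bar> \<le> sinh R" using y by (simp add: x_def[symmetric] y_def[symmetric] abs_divide field_simps)
  have l: "\<bar>ln y - ln s\<bar> \<le> R" using hdist_i_ge_ln[OF assms(1,2)] assms by (simp add: y_def)
  have "exp (ln s - R) \<le> exp (ln y)" "exp (ln y) \<le> exp (ln s + R)" using l by simp_all
  then show "s * exp (- R) \<le> Im z" "Im z \<le> s * exp R" using assms y
    by (auto simp: exp_add exp_diff exp_minus y_def[symmetric] divide_inverse)
qed

text \<open>\<open>m\<close> and \<open>m * \<i>\<close> are orthogonal and equally long, so the
  left side is the trace in a rotated frame scaled by \<open>|m|^2\<close>; the mixed terms
  cancel.\<close>

lemma hlap_bilinear:
  fixes B :: "complex \<Rightarrow>\<^sub>L (complex \<Rightarrow>\<^sub>L real)"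
  shows "B m m + B (m * \<i>) (m * \<i>) = (cmod m)\<^sup>2 * (B 1 1 + B \<i> \<i>)"
proof -
  define x y where "x = Re m" and "y = Im m"
  have m: "m = x *\<^sub>R 1 + y *\<^sub>R \<i>" "m * \<i> = (- y) *\<^sub>R 1 + x *\<^sub>R \<i>" by (auto simp: x_def y_def complex_eq_iff)
  have c: "(cmod m)\<^sup>2 = x\<^sup>2 + y\<^sup>2" by (simp add: x_def y_def cmod_power2)
  show ?thesis unfolding c m(2) unfolding m(1)
    by (simp only: blinfun.add_right blinfun.scaleR_right blinfun.add_left blinfun.scaleR_left real_scaleR_def)
      (simp add: power2_eq_square algebra_simps)
qed

text \<open>The first-order terms, which involve \<open>M''\<close>, cancel because \<open>M\<close> is holomorphic.\<close>
lemma has_lap_hiso: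
  assumes S: "open S" "\<And>x. x \<in> S \<Longrightarrow> (v has_derivative blinfun_apply (Dv x)) (at x)"
    "\<And>x. x \<in> S \<Longrightarrow> (Dv has_derivative blinfun_apply (D2v x)) (at x)"
    and M: "hiso M" and z: "z \<in> H2" "M z \<in> S"
  shows "has_lap (\<lambda>x. v (M x)) z (hlap D2v (M z) / (Im z)\<^sup>2)"
proof -
  obtain a b c d where det: "a * d - b * c = 1" and Mm: "\<forall>z\<in>H2. M z = moeb a b c d z"
    using M unfolding hiso_def by blast
  define N where "N = moeb a b c d"
  have den: "of_real c * x + of_real d \<noteq> 0" if "x \<in> H2" for x using moeb_denom[OF that det] .
  \<comment> \<open>The first derivative of the Moebius map and, in the next line, the second, both
    simplified by determinant 1.\<close>
  define m where "m = (\<lambda>x::complex. 1 / (of_real c * x + of_real d)^2)"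
  define m2 where "m2 = (\<lambda>x::complex. - 2 * of_real c / (of_real c * x + of_real d)^3)"
  have N: "(N has_field_derivative m x) (at x)" if "x \<in> H2" for x
  proof -
    have "complex_of_real a * (of_real c * x + of_real d) - (of_real a * x + of_real b) * of_real c = of_real (a * d - b * c)"
      by (simp add: algebra_simps)
    then have "complex_of_real a * (of_real c * x + of_real d) - (of_real a * x + of_real b) * of_real c = 1" using det by simp
    then show ?thesis unfolding N_def moeb_def[abs_def] m_def
      by - (rule derivative_eq_intros refl | (use den[OF that] in simp; fail) | simp add: power2_eq_square)+
  qed
  have m: "(m has_field_derivative m2 x) (at x)" if "x \<in> H2" for x
  proof -
    define k where "k = of_real c * x + of_real d"
    have k: "k \<noteq> 0" using den[OF that] by (simp add: k_def)
    have "(m has_field_derivative (- (2 * k * of_real c) / (k^2 * k^2))) (at x)"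
      unfolding m_def k_def
      by (rule derivative_eq_intros refl | (use den[OF that] in simp; fail))+
    moreover have "- (2 * k * of_real c) / (k^2 * k^2) = - 2 * of_real c / k^3"
      using k by (simp add: field_simps power2_eq_square power3_eq_cube)
    ultimately show ?thesis by (simp add: m2_def k_def)
  qed
  define U where "U = H2 \<inter> N -` S"
  have cN: "continuous_on H2 N" using N DERIV_isCont continuous_at_imp_continuous_on by blast
  have U: "open U" unfolding U_def using continuous_open_preimage[OF cN open_H2 S(1)] .
  have zU: "z \<in> U" using z Mm by (simp add: U_def N_def)
  define D where "D = (\<lambda>x h. Dv (N x) (m x * h))"
  have "(v \<circ> N has_derivative D x) (at x)" if "x \<in> U" for x
  proof -
    have "(N has_derivative (\<lambda>h. m x * h)) (at x)" using N that by (simp add: U_def has_field_derivative_def)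
    from diff_chain_at[OF this S(2)] show ?thesis using that unfolding D_def U_def comp_def by simp
  qed
  then have ev: "\<forall>\<^sub>F x in nhds z. ((\<lambda>x. v (N x)) has_derivative D x) (at x)"
    using U zU unfolding comp_def eventually_nhds by blast
  have der: "((\<lambda>t. D (z + e * of_real t) e) has_real_derivative
       (D2v (N z) (m z * e) (m z * e) + Dv (N z) (m2 z * e * e))) (at 0)" for e
  proof -
    have l: "((\<lambda>t. z + e * of_real t) has_derivative (\<lambda>h. e * of_real h)) (at (0::real))"
      by (auto intro!: derivative_eq_intros)
    have "(N has_derivative (\<lambda>h. m z * h)) (at (z + e * of_real 0))" using N z by (simp add: has_field_derivative_def)
    from has_derivative_compose[OF l this]
    have 1: "((\<lambda>t. N (z + e * of_real t)) has_derivative (\<lambda>h. m z * (e * of_real h))) (at (0::real))" .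
    have "(Dv has_derivative blinfun_apply (D2v (N z))) (at (N (z + e * of_real 0)))"
      using S(3) zU by (simp add: U_def)
    from has_derivative_compose[OF 1 this]
    have 2: "((\<lambda>t. Dv (N (z + e * of_real t))) has_derivative (\<lambda>h. D2v (N z) (m z * (e * of_real h)))) (at (0::real))" .
    have "(m has_derivative (\<lambda>h. m2 z * h)) (at (z + e * of_real 0))" using m z by (simp add: has_field_derivative_def)
    from has_derivative_compose[OF l this]
    have 3: "((\<lambda>t. m (z + e * of_real t)) has_derivative (\<lambda>h. m2 z * (e * of_real h))) (at (0::real))" .
    have 4: "((\<lambda>t. m (z + e * of_real t) * e) has_derivative (\<lambda>h. m2 z * (e * of_real h) * e)) (at (0::real))"
      by (rule has_derivative_mult_left[OF 3])
    from bounded_bilinear.FDERIV[OF bounded_bilinear_blinfun_apply 2 4]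
    have 5: "((\<lambda>t. D (z + e * of_real t) e) has_derivative
        (\<lambda>h. Dv (N z) (m2 z * (e * of_real h) * e) + D2v (N z) (m z * (e * of_real h)) (m z * e))) (at (0::real))"
      by (simp add: D_def)
    have "Dv (N z) (m2 z * (e * of_real h) * e) + D2v (N z) (m z * (e * of_real h)) (m z * e)
       = (D2v (N z) (m z * e) (m z * e) + Dv (N z) (m2 z * e * e)) * h" for h
    proof -
      have "m2 z * (e * of_real h) * e = h *\<^sub>R (m2 z * e * e)" "m z * (e * of_real h) = h *\<^sub>R (m z * e)"
        by (auto simp: scaleR_conv_of_real)
      then show ?thesis by (simp add: blinfun.scaleR_right blinfun.scaleR_left algebra_simps)
    qed
    then show ?thesis using 5 by (simp add: has_field_derivative_def)
  qed
  have "has_lap (\<lambda>x. v (N x)) z ((D2v (N z) (m z) (m z) + Dv (N z) (m2 z)) +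
      (D2v (N z) (m z * \<i>) (m z * \<i>) + Dv (N z) (m2 z * \<i> * \<i>)))"
    unfolding has_lap_def using ev der[of 1] der[of \<i>] by (intro exI[of _ D] exI conjI) auto
  moreover have "Dv (N z) (m2 z * \<i> * \<i>) = - Dv (N z) (m2 z)"
    by (simp add: mult.assoc blinfun.minus_right)
  \<comment> \<open>For an isometry \<open>Im (N z) = Im z * |m z|\<close>, so the weight inside
    \<open>hlap\<close> at \<open>N z\<close> absorbs the conformal factor, and only the weight at
    \<open>z\<close> remains.\<close>
  moreover have "(cmod (m z))\<^sup>2 * (D2v (N z) 1 1 + D2v (N z) \<i> \<i>) = hlap D2v (N z) / (Im z)\<^sup>2"
  proof -
    have "Im (N z) = Im z * cmod (m z)" unfolding N_def moeb_Im[OF z(1) det] m_def by (simp add: norm_divide norm_power)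
    moreover have "Im z \<noteq> 0" using z by (simp add: H2_def)
    ultimately show ?thesis by (simp add: hlap_def power_mult_distrib)
  qed
  ultimately have "has_lap (\<lambda>x. v (N x)) z (hlap D2v (N z) / (Im z)\<^sup>2)"
    using hlap_bilinear[of "D2v (N z)" "m z"] by (simp add: algebra_simps)
  then have "has_lap (\<lambda>x. v (M x)) z (hlap D2v (N z) / (Im z)\<^sup>2)"
    by (rule has_lap_cong[OF _ open_H2 z(1)]) (use Mm in \<open>simp add: N_def\<close>)
  then show ?thesis using Mm z by (simp add: N_def)
qed

lemma hiso_id: "hiso (\<lambda>z. z)"
  unfolding hiso_def by (rule exI[of _ 1], rule exI[of _ 0], rule exI[of _ 0], rule exI[of _ 1]) (simp add: moeb_def)

text \<open>The similarity that fixes infinity and takes \<open>c\<close> to \<open>p\<close>. This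
  isometry depends continuously on \<open>c\<close> and scales Euclidean discs by the plain factor
  \<open>Im p / Im c\<close>.\<close>

definition hshift :: "complex \<Rightarrow> complex \<Rightarrow> complex \<Rightarrow> complex" where
  "hshift p c z = of_real (Re p) + of_real (Im p / Im c) * (z - of_real (Re c))"

lemma hiso_hshift:
  assumes "p \<in> H2" "c \<in> H2"
  shows "hiso (hshift p c)" and "hshift p c c = p"
proof -
  define k \<beta> where "k = Im p / Im c" and "\<beta> = Re p - k * Re c"
  have k: "k > 0" using assms by (simp add: H2_def k_def)
  have sk: "complex_of_real (sqrt k) * of_real (sqrt k) = of_real k" using k by (simp flip: of_real_mult)
  have "hshift p c z = moeb (sqrt k) (\<beta> / sqrt k) 0 (1 / sqrt k) z" for z
    unfolding hshift_def moeb_def k_def[symmetric] sk[symmetric] using k sk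
    by (simp add: \<beta>_def field_simps)
  then show "hiso (hshift p c)" unfolding hiso_def using k
    by (intro exI[of _ "sqrt k"] exI[of _ "\<beta> / sqrt k"] exI[of _ 0] exI[of _ "1 / sqrt k"]) auto
  show "hshift p c c = p" using assms by (simp add: hshift_def H2_def complex_eq_iff)
qed


section \<open>Separation of a strip by a path\<close>

text \<open>The crossing theorem for paths in \<open>real^2\<close>, carried over by the coordinate
  map \<open>e\<close>, which is continuous and injective.\<close>

lemma fashoda_complex:
  fixes f g :: "real \<Rightarrow> complex"
  assumes f: "path f" "Re (pathstart f) = a\<^sub>1" "Re (pathfinish f) = b\<^sub>1"
    and g: "path g" "Im (pathstart g) = a\<^sub>2" "Im (pathfinish g) = b\<^sub>2"
    and box: "\<And>z. z \<in> path_image f \<union> path_image g \<Longrightarrow> a\<^sub>1 \<le> Re z \<and> Re z \<le> b\<^sub>1 \<and> a\<^sub>2 \<le> Im z \<and> Im z \<le> b\<^sub>2"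
  obtains z where "z \<in> path_image f" "z \<in> path_image g"
proof -
  define e :: "complex \<Rightarrow> real^2" where "e = (\<lambda>z. \<chi> i. if i = 1 then Re z else Im z)"
  have e: "e z $ 1 = Re z" "e z $ 2 = Im z" for z by (auto simp: e_def)
  have inj: "e z = e w \<Longrightarrow> z = w" for z w by (metis complex_eqI e)
  have "continuous_on UNIV e"
    unfolding e_def
  proof (rule continuous_on_vec_lambda)
    fix i :: 2
    show "continuous_on UNIV (\<lambda>z. if i = 1 then Re z else Im z)"
      by (cases "i = 1") (auto intro!: continuous_intros)
  qed
  then have ce: "continuous_on S e" for S using continuous_on_subset by blast
  have box': "e ` S \<subseteq> cbox (vector [a\<^sub>1, a\<^sub>2]) (vector [b\<^sub>1, b\<^sub>2])"
    if "S \<subseteq> path_image f \<union> path_image g" for S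
    using box that by (auto simp: mem_box_cart forall_2 e)
  obtain w where "w \<in> path_image (e \<circ> f)" "w \<in> path_image (e \<circ> g)"
  proof (rule fashoda[of "e \<circ> f" "e \<circ> g" "vector [a\<^sub>1, a\<^sub>2]" "vector [b\<^sub>1, b\<^sub>2]"])
    show "path (e \<circ> f)" "path (e \<circ> g)" using f(1) g(1) ce path_continuous_image by blast+
    show "path_image (e \<circ> f) \<subseteq> cbox (vector [a\<^sub>1, a\<^sub>2]) (vector [b\<^sub>1, b\<^sub>2])"
      unfolding path_image_compose by (rule box') auto
    show "path_image (e \<circ> g) \<subseteq> cbox (vector [a\<^sub>1, a\<^sub>2]) (vector [b\<^sub>1, b\<^sub>2])"
      unfolding path_image_compose by (rule box') auto
  qed (use f g in \<open>auto simp: pathstart_compose pathfinish_compose e\<close>)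
  then show ?thesis using that inj unfolding path_image_compose by blast
qed

text \<open>\<open>K\<close> is the complement of \<open>L\<close>, the component of the strip minus
  the path that contains the points below \<gamma>. If \<open>L\<close> reached a point above
  \<gamma>, a path in \<open>L\<close>, prolonged vertically at both ends, would join bottom and top
  of a box without meeting \<gamma>. Outside the strip \<open>K\<close> carries no information,
  hence the restrictions on \<open>Re z\<close>.\<close>

lemma strip_separation:
  fixes \<gamma> :: "real \<Rightarrow> complex"
  assumes \<gamma>: "path \<gamma>" "Re (pathstart \<gamma>) \<le> - X" "Re (pathfinish \<gamma>) \<ge> X" and X: "X > 0"
    and Y: "\<And>z. z \<in> path_image \<gamma> \<Longrightarrow> Y\<^sub>1 \<le> Im z \<and> Im z \<le> Y\<^sub>2"
  shows "\<exists>K. closed K \<and> (\<forall>z\<in>K. \<bar>Re z\<bar> < X \<longrightarrow> Im z \<ge> Y\<^sub>1) \<and>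
    (\<forall>z. \<bar>Re z\<bar> < X \<longrightarrow> Im z > Y\<^sub>2 \<longrightarrow> z \<in> K) \<and>
    (\<forall>z\<in>K. \<bar>Re z\<bar> < X \<longrightarrow> z \<notin> path_image \<gamma> \<longrightarrow> (\<exists>e>0. ball z e \<subseteq> K))"
proof -
  have abs: "{z. \<bar>Re z\<bar> < X \<and> Q z} = {z. - X < Re z} \<inter> {z. Re z < X} \<inter> {z. Q z}" for Q by auto
  define U where "U = {z. \<bar>Re z\<bar> < X \<and> z \<notin> path_image \<gamma>}"
  have "open {z. z \<notin> path_image \<gamma>}"
    using closed_path_image[OF \<gamma>(1)] by (simp add: closed_def Compl_eq)
  then have U: "open U" unfolding U_def abs
    by (intro open_Int open_halfspace_Re_lt open_halfspace_Re_gt)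
  define z\<^sub>b where "z\<^sub>b = Complex 0 (Y\<^sub>1 - 1)"
  define L where "L = connected_component_set U z\<^sub>b"
  have L: "open L" "connected L" "L \<subseteq> U"
    using U by (auto simp: L_def open_connected_component connected_component_subset)
  have pL: "path_connected L" using L connected_open_path_connected by blast
  have low: "{z. \<bar>Re z\<bar> < X \<and> Im z < Y\<^sub>1} \<subseteq> L" unfolding L_def
  proof (rule connected_component_maximal)
    show "connected {z. \<bar>Re z\<bar> < X \<and> Im z < Y\<^sub>1}" unfolding abs
      by (intro convex_connected convex_Int convex_halfspace_Re_lt convex_halfspace_Re_gt convex_halfspace_Im_lt)
    show "{z. \<bar>Re z\<bar> < X \<and> Im z < Y\<^sub>1} \<subseteq> U" using Y by (force simp: U_def)
  qed (use X in \<open>auto simp: z\<^sub>b_def\<close>)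
  have zbL: "z\<^sub>b \<in> L" using low X by (auto simp: z\<^sub>b_def)
  have high: "z \<notin> L" if z: "\<bar>Re z\<bar> < X" "Im z > Y\<^sub>2" for z
  proof
    assume "z \<in> L"
    then obtain g\<^sub>0 where g0: "path g\<^sub>0" "path_image g\<^sub>0 \<subseteq> L" "pathstart g\<^sub>0 = z\<^sub>b" "pathfinish g\<^sub>0 = z"
      using pL zbL unfolding path_connected_def by blast
    have "compact (path_image g\<^sub>0 \<union> path_image \<gamma>)" using g0 \<gamma> by (intro compact_Un compact_path_image)
    then obtain B where B: "\<And>x. x \<in> path_image g\<^sub>0 \<union> path_image \<gamma> \<Longrightarrow> norm x \<le> B"
      using compact_imp_bounded bounded_iff by metis
    have BI: "- B \<le> Im x \<and> Im x \<le> B" if "x \<in> path_image g\<^sub>0 \<union> path_image \<gamma>" for x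
      using B[OF that] abs_Im_le_cmod[of x] by linarith
    define g where "g = linepath (Complex 0 (- B)) z\<^sub>b +++ g\<^sub>0 +++ linepath z (Complex (Re z) B)"
    have zb: "- B \<le> Im z\<^sub>b" "Im z \<le> B" "-B \<le> Im z" using BI[of z\<^sub>b] BI[of z] g0 by (metis UnI1 pathstart_in_path_image pathfinish_in_path_image)+
    have seg1: "Re x = 0 \<and> Im x < Y\<^sub>1 \<and> - B \<le> Im x \<and> Im x \<le> B" if "x \<in> closed_segment (Complex 0 (- B)) z\<^sub>b" for x
    proof -
      have "x \<in> {x. 0 \<le> Re x} \<inter> {x. Re x \<le> 0} \<inter> {x. - B \<le> Im x} \<inter> {x. Im x \<le> Im z\<^sub>b}"
        by (rule subsetD[OF closed_segment_subset that]) (use zb in \<open>auto simp: z\<^sub>b_def intro!: convex_Int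
          convex_halfspace_Re_le convex_halfspace_Re_ge convex_halfspace_Im_le convex_halfspace_Im_ge\<close>)
      moreover have "Im z\<^sub>b \<le> B" using BI[of z\<^sub>b] g0 by (metis UnI1 pathstart_in_path_image)
      ultimately show ?thesis by (auto simp: z\<^sub>b_def)
    qed
    have seg2: "Re x = Re z \<and> Im x > Y\<^sub>2 \<and> - B \<le> Im x \<and> Im x \<le> B" if "x \<in> closed_segment z (Complex (Re z) B)" for x
    proof -
      have "x \<in> {x. Re z \<le> Re x} \<inter> {x. Re x \<le> Re z} \<inter> {x. Im z \<le> Im x} \<inter> {x. Im x \<le> B}"
        by (rule subsetD[OF closed_segment_subset that]) (use zb in \<open>auto intro!: convex_Int
          convex_halfspace_Re_le convex_halfspace_Re_ge convex_halfspace_Im_le convex_halfspace_Im_ge\<close>)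
      then show ?thesis using z zb by auto
    qed
    have gi: "path_image g = closed_segment (Complex 0 (- B)) z\<^sub>b \<union> (path_image g\<^sub>0 \<union> closed_segment z (Complex (Re z) B))"
      unfolding g_def using g0 by (simp add: path_image_join)
    \<comment> \<open>\<gamma> may leave the strip; clamping its real part puts it into the box with
      its ends on the vertical sides. A crossing point lies on \<open>g\<close>, hence strictly
      inside the strip, and there clamping has moved nothing.\<close>
    define cl where "cl = (\<lambda>x. Complex (max (- X) (min X (Re x))) (Im x))"
    have ccl: "continuous_on UNIV cl" unfolding cl_def
      by (intro continuous_intros continuous_on_Complex)
    obtain x where x: "x \<in> path_image (cl \<circ> \<gamma>)" "x \<in> path_image g"
    proof (rule fashoda_complex)
      show "path (cl \<circ> \<gamma>)" using \<gamma>(1) ccl path_continuous_image continuous_on_subset by blast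
      show "path g" unfolding g_def using g0 by simp
      show "Re (pathstart (cl \<circ> \<gamma>)) = - X" "Re (pathfinish (cl \<circ> \<gamma>)) = X"
        using \<gamma> X by (auto simp: pathstart_compose pathfinish_compose cl_def)
      show "Im (pathstart g) = - B" "Im (pathfinish g) = B" by (auto simp: g_def)
      show "- X \<le> Re x \<and> Re x \<le> X \<and> - B \<le> Im x \<and> Im x \<le> B" if "x \<in> path_image (cl \<circ> \<gamma>) \<union> path_image g" for x
      proof -
        consider "x \<in> path_image (cl \<circ> \<gamma>)" | "x \<in> path_image g\<^sub>0" | "x \<in> closed_segment (Complex 0 (- B)) z\<^sub>b"
          | "x \<in> closed_segment z (Complex (Re z) B)" using \<open>x \<in> _\<close> gi by blast
        then show ?thesis
        proof cases
          case 1
          then obtain y where "y \<in> path_image \<gamma>" "x = cl y" by (auto simp: path_image_compose)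
          then show ?thesis using BI[of y] X by (auto simp: cl_def)
        next
          case 2
          then have "x \<in> U" using g0 L by blast
          then have "\<bar>Re x\<bar> < X" by (simp add: U_def)
          then show ?thesis using 2 BI[of x] by auto
        next
          case 3
          then show ?thesis using seg1[of x] X by auto
        next
          case 4
          then show ?thesis using seg2[of x] z by auto
        qed
      qed
    qed
    obtain y where y: "y \<in> path_image \<gamma>" "x = cl y" using x by (auto simp: path_image_compose)
    have "\<bar>Re x\<bar> < X"
    proof -
      consider "x \<in> path_image g\<^sub>0" | "x \<in> closed_segment (Complex 0 (- B)) z\<^sub>b"
        | "x \<in> closed_segment z (Complex (Re z) B)" using x(2) gi by blast
      then show ?thesis
      proof cases
        case 1
        then have "x \<in> U" using g0 L by blast
        then show ?thesis by (simp add: U_def)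
      next
        case 2
        then show ?thesis using seg1[of x] X by auto
      next
        case 3
        then show ?thesis using seg2[of x] z by auto
      qed
    qed
    then have "x = y" using y X by (auto simp: cl_def complex_eq_iff split: if_splits)
    then have xg: "x \<in> path_image \<gamma>" using y by simp
    then have "x \<notin> path_image g\<^sub>0" using g0 L by (auto simp: U_def)
    then show False using x(2) gi seg1[of x] seg2[of x] Y[OF xg] by (metis Un_iff not_le)
  qed
  show ?thesis
  proof (intro exI[of _ "- L"] conjI ballI allI impI)
    show "closed (- L)" using L(1) by blast
    show "Im z \<ge> Y\<^sub>1" if "z \<in> - L" "\<bar>Re z\<bar> < X" for z using low that by force
    show "z \<in> - L" if "\<bar>Re z\<bar> < X" "Im z > Y\<^sub>2" for z using high that by blast
    \<comment> \<open>Off the path, \<open>z\<close> lies in a component of the open set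
      \<open>U\<close> other than \<open>L\<close>; this component is an open neighbourhood of
      \<open>z\<close> that misses \<open>L\<close>.\<close>
    show "\<exists>e>0. ball z e \<subseteq> - L" if "z \<in> - L" "\<bar>Re z\<bar> < X" "z \<notin> path_image \<gamma>" for z
    proof -
      have "z \<in> U" using that by (simp add: U_def)
      then have "z \<in> connected_component_set U z" by simp
      then obtain e where e: "e > 0" "ball z e \<subseteq> connected_component_set U z"
        using open_connected_component[OF U, of z] unfolding open_contains_ball by blast
      have "connected_component_set U z \<inter> L = {}" unfolding L_def
        using that(1) by (metis L_def ComplD connected_component_disjoint Int_commute connected_component_eq_empty)
      then show ?thesis using e by blast
    qed
  qed
qed


section \<open>Derivatives at the boundary\<close>

lemma blinfun_eq_inner_egrad: "blinfun_apply L h = egrad L \<bullet> h" for L :: "complex \<Rightarrow>\<^sub>L real"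
proof -
  have "h = Re h *\<^sub>R 1 + Im h *\<^sub>R \<i>" by (simp add: complex_eq_iff)
  then have "blinfun_apply L h = Re h * L 1 + Im h * L \<i>"
    by (metis blinfun.add_right blinfun.scaleR_right real_scaleR_def)
  then show ?thesis by (simp add: egrad_def inner_complex_def mult.commute)
qed

text \<open>A disc inside \<open>S\<close> touching the boundary at \<open>b\<close> has the same outward normal there as \<open>S\<close>.\<close>
lemma normal_deriv_at_tangent_ball:
  assumes loc: "local_defining S b r phi Dphi" and nd: "normal_deriv_eq S Du \<alpha>"
    and b: "b \<in> hbdry S" "b \<notin> S"
    and sub: "ball e \<rho> \<subseteq> S" and \<rho>: "cmod (b - e) = \<rho>" "\<rho> > 0"
  shows "Im b * Du b (b - e) = \<alpha> * \<rho>"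
proof -
  define G where "G = egrad (Dphi b)"
  define n where "n = (b - e) /\<^sub>R \<rho>"
  have nn: "n \<bullet> n = 1" using \<rho> by (simp add: n_def dot_square_norm power2_eq_square)
  have L: "r > 0" "(phi has_derivative blinfun_apply (Dphi b)) (at b)" "Dphi b \<noteq> 0"
     "S \<inter> ball b r = {z \<in> ball b r. phi z < 0}"
    using loc unfolding local_defining_def by auto
  have phib: "phi b \<ge> 0" using L(1,4) b(2) by (metis (mono_tags, lifting) IntI centre_in_ball linorder_not_less mem_Collect_eq IntD1)
  have G0: "G \<noteq> 0"
  proof
    assume "G = 0"
    then have "Dphi b = 0" using blinfun_eq_inner_egrad[of "Dphi b"] by (intro blinfun_eqI) (simp add: G_def)
    then show False using L by blast
  qed
  \<comment> \<open>If \<open>h\<close> points into the disc, then \<open>b + t h\<close> lies in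
    \<open>S\<close> for small positive \<open>t\<close>, so \<open>phi\<close> is negative there
    although \<open>phi b \<ge> 0\<close>. Taken over the whole open half-plane of such
    \<open>h\<close>, this forces \<open>G\<close> onto the ray of \<open>n\<close>.\<close>
  have key: "G \<bullet> h \<le> 0" if h: "h \<bullet> n < 0" for h
  proof (rule ccontr)
    assume "\<not> G \<bullet> h \<le> 0"
    then have pos: "Dphi b h > 0" using blinfun_eq_inner_egrad by (simp add: G_def)
    have "((\<lambda>t. phi (b + t *\<^sub>R h)) has_derivative (\<lambda>t. Dphi b (t *\<^sub>R h))) (at 0)"
      by (rule has_derivative_compose[where f="\<lambda>t. b + t *\<^sub>R h" and g=phi])
        (use L(2) in \<open>auto intro!: derivative_eq_intros\<close>)
    then have "((\<lambda>t. phi (b + t *\<^sub>R h)) has_real_derivative Dphi b h) (at 0)"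
      by (simp add: has_field_derivative_def blinfun.scaleR_right mult.commute[of _ "Dphi b h"])
    then obtain d where d: "d > 0" "\<And>t. 0 < t \<Longrightarrow> t < d \<Longrightarrow> phi (b + t *\<^sub>R h) > phi b"
      using DERIV_pos_inc_right[OF _ pos] by force
    have hn: "h \<noteq> 0" using h by auto
    \<comment> \<open>The three bounds serve the increase of \<open>phi\<close>, the domain
      \<open>ball b r\<close> and membership in the disc: the last one keeps the quadratic term of
      the squared distance at most half of the linear gain.\<close>
    define t where "t = min (d/2) (min (r / (2 * norm h)) (- (h \<bullet> n) * \<rho> / (norm h)\<^sup>2))"
    have t: "0 < t" "t < d" "t * norm h < r" "t * (norm h)\<^sup>2 \<le> - (h \<bullet> n) * \<rho>"
    proof -
      show "0 < t" using d L(1) hn h \<rho> by (simp add: t_def mult_neg_pos divide_neg_pos)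
      have "t \<le> d / 2" unfolding t_def by (rule min.cobounded1)
      then show "t < d" using d by linarith
      have "t \<le> r / (2 * norm h)" by (simp add: t_def)
      then have "t * (2 * norm h) \<le> r" using hn by (simp add: pos_le_divide_eq)
      then show "t * norm h < r" using L(1) \<open>0 < t\<close> mult_nonneg_nonneg[of t "norm h"] by (simp add: mult.left_commute)
      have "t \<le> - (h \<bullet> n) * \<rho> / (norm h)\<^sup>2" by (simp add: t_def)
      then show "t * (norm h)\<^sup>2 \<le> - (h \<bullet> n) * \<rho>" using hn by (subst (asm) pos_le_divide_eq) auto
    qed
    have "(norm (b + t *\<^sub>R h - e))\<^sup>2 = \<rho>\<^sup>2 + 2 * t * (h \<bullet> n) * \<rho> + t * (t * (norm h)\<^sup>2)"
    proof -
      have "b + t *\<^sub>R h - e = \<rho> *\<^sub>R n + t *\<^sub>R h" using \<rho> by (simp add: n_def)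
      then show ?thesis using nn unfolding power2_norm_eq_inner
        by (simp add: inner_add_left inner_add_right inner_commute power2_eq_square algebra_simps)
    qed
    also have "\<dots> \<le> \<rho>\<^sup>2 + 2 * t * (h \<bullet> n) * \<rho> + t * (- (h \<bullet> n) * \<rho>)"
      using t by (intro add_left_mono mult_left_mono) auto
    also have "\<dots> = \<rho>\<^sup>2 + t * (h \<bullet> n) * \<rho>" by (simp add: algebra_simps)
    also have "\<dots> < \<rho>\<^sup>2" using t h \<rho> by (simp add: mult_pos_neg mult_neg_pos)
    finally have "norm (b + t *\<^sub>R h - e) < \<rho>" using \<rho> by (simp add: power_less_imp_less_base)
    then have "b + t *\<^sub>R h \<in> ball e \<rho>" by (simp add: dist_norm norm_minus_commute)
    moreover have "b + t *\<^sub>R h \<in> ball b r" using t by (simp add: dist_norm)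
    ultimately have "phi (b + t *\<^sub>R h) < 0" using sub L(4) by blast
    then show False using d(2)[of t] t phib by linarith
  qed
  \<comment> \<open>The tangential part of \<open>G\<close>. Testing \<open>key\<close> with
    \<open>w - \<epsilon> n\<close> bounds its squared length by \<epsilon> times the normal
    component, for every positive \<epsilon>.\<close>
  define w where "w = G - (G \<bullet> n) *\<^sub>R n"
  have wn: "w \<bullet> n = 0" using nn by (simp add: w_def inner_diff_left)
  have Gw: "G \<bullet> w = w \<bullet> w" using wn by (simp add: w_def inner_diff_right inner_diff_left inner_commute)
  have eps: "w \<bullet> w \<le> \<epsilon> * (G \<bullet> n)" if "\<epsilon> > 0" for \<epsilon>
    using key[of "w - \<epsilon> *\<^sub>R n"] wn nn Gw that by (simp add: inner_diff_left inner_diff_right)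
  have Gn: "G \<bullet> n \<ge> 0" using key[of "- n"] nn by simp
  have "w \<bullet> w \<le> 0"
  proof (rule ccontr)
    assume a: "\<not> w \<bullet> w \<le> 0"
    then have pos: "G \<bullet> n > 0" using eps[of 1] by linarith
    have "w \<bullet> w \<le> (w \<bullet> w / (2 * (G \<bullet> n))) * (G \<bullet> n)" using pos a by (intro eps divide_pos_pos) linarith+
    then show False using pos a by simp
  qed
  then have "w = 0" by (metis inner_gt_zero_iff not_le)
  then have Gn2: "G = (G \<bullet> n) *\<^sub>R n" by (simp add: w_def)
  have "norm n = 1" using nn by (simp add: norm_eq_1)
  then have "norm G = G \<bullet> n" using Gn Gn2 by (metis abs_of_nonneg mult.right_neutral norm_scaleR)
  then have "G / of_real (cmod G) = n" using Gn2 G0 by (metis divideR_right norm_eq_zero scaleR_conv_of_real divide_inverse inverse_eq_divide mult.commute of_real_inverse)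
  moreover have "Im b * Du b (G / of_real (cmod G)) = \<alpha>"
    using nd loc b unfolding normal_deriv_eq_def G_def by blast
  ultimately have "Im b * (Du b (b - e) / \<rho>) = \<alpha>"
    by (simp add: n_def blinfun.scaleR_right divide_inverse mult.commute)
  then show ?thesis using \<rho> by (simp add: field_simps)
qed

text \<open>\<open>normal_deriv_eq\<close> quantifies over local defining functions, so it says
  something about a disc only once such a function is exhibited.\<close>

lemma local_defining_ball:
  assumes "b \<in> H2" "cmod (b - e) = \<rho>" "\<rho> > 0"
  obtains r phi Dphi where "local_defining (ball e \<rho>) b r phi Dphi"
proof -
  obtain r where r: "r > 0" "ball b r \<subseteq> H2" using open_H2 assms(1) open_contains_ball by blast
  define phi where "phi = (\<lambda>z::complex. (z - e) \<bullet> (z - e) - \<rho>\<^sup>2)"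
  define Dphi where "Dphi = (\<lambda>z. 2 *\<^sub>R blinfun_inner_right (z - e))"
  have "local_defining (ball e \<rho>) b r phi Dphi"
    unfolding local_defining_def
  proof (intro conjI ballI)
    show "(phi has_derivative blinfun_apply (Dphi z)) (at z)" for z
      unfolding phi_def Dphi_def
      by (auto intro!: derivative_eq_intros simp: blinfun.scaleR_left inner_commute)
    show "continuous_on (ball b r) Dphi" unfolding Dphi_def
      by (intro continuous_intros bounded_linear.continuous_on[OF bounded_linear_blinfun_inner_right])
    show "Dphi b \<noteq> 0"
    proof
      assume "Dphi b = 0"
      then have "Dphi b (b - e) = 0" by simp
      then show False using assms by (auto simp: Dphi_def blinfun.scaleR_left)
    qed
    have "z \<in> ball e \<rho> \<longleftrightarrow> phi z < 0" for z
    proof -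
      have "phi z = (cmod (z - e))\<^sup>2 - \<rho>\<^sup>2" by (simp add: phi_def power2_norm_eq_inner)
      then show ?thesis using assms(3) power_strict_mono[of "cmod (z - e)" \<rho> 2] power_mono[of \<rho> "cmod (z - e)" 2]
        power_less_imp_less_base[of "cmod (e - z)" 2 \<rho>]
        by (auto simp: dist_norm norm_minus_commute not_less)
    qed
    then show "ball e \<rho> \<inter> ball b r = {z \<in> ball b r. phi z < 0}" by blast
  qed (use r in auto)
  then show ?thesis using that by blast
qed

text \<open>At \<open>b\<close> the value of \<open>Du\<close> is only a continuous extension. The
  mean value theorem asks for mere continuity at the end of the segment, so \<open>u\<close> near
  \<open>b\<close> is still controlled by \<open>Du\<close> inside \<open>S\<close>.\<close>

lemma boundary_mean_value:
  assumes C2: "C2_upto S u Du D2u" and b: "b \<in> hclosure S" "u b = 0" and t: "t > 0"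
    and seg: "\<And>s. 0 < s \<Longrightarrow> s \<le> t \<Longrightarrow> b + of_real s * d \<in> S \<inter> H2"
  obtains \<xi> where "0 < \<xi>" "\<xi> < t" "u (b + of_real t * d) = t * Du (b + of_real \<xi> * d) d"
proof -
  define g where "g = (\<lambda>s. u (b + of_real s * d))"
  have img: "(\<lambda>s. b + of_real s * d) ` {0..t} \<subseteq> hclosure S"
  proof (rule image_subsetI)
    fix s assume "s \<in> {0..t}"
    then show "b + of_real s * d \<in> hclosure S" using seg[of s] b closure_subset[of S] by (cases "s = 0") (auto simp: hclosure_def)
  qed
  have "continuous_on {0..t} g" unfolding g_def
    by (rule continuous_on_compose2[OF _ _ img]) (use C2 in \<open>auto simp: C2_upto_def intro!: continuous_intros\<close>)
  moreover have "(g has_derivative (\<lambda>h. Du (b + of_real s * d) (of_real h * d))) (at s)" if "0 < s" "s < t" for s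
    unfolding g_def
    by (rule has_derivative_compose[where f="\<lambda>s. b + of_real s * d" and g=u])
      (use C2 seg[of s] that in \<open>auto simp: C2_upto_def intro!: derivative_eq_intros\<close>)
  ultimately obtain \<xi> where \<xi>: "0 < \<xi>" "\<xi> < t" "g t - g 0 = Du (b + of_real \<xi> * d) (of_real (t - 0) * d)"
    using mvt[of 0 t g "\<lambda>s h. Du (b + of_real s * d) (of_real h * d)"] t by blast
  have "Du (b + of_real \<xi> * d) (of_real t * d) = t * Du (b + of_real \<xi> * d) d"
    by (metis blinfun.scaleR_right real_scaleR_def scaleR_conv_of_real)
  then show ?thesis using that \<xi> b by (simp add: g_def)
qed

text \<open>As the mean value point tends to \<open>b\<close>, continuity of \<open>Du\<close>
  identifies its extended value with the one-sided derivative of \<open>u\<close> along an entering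
  segment.\<close>

lemma boundary_derivative:
  assumes C2: "C2_upto S u Du D2u" and b: "b \<in> hclosure S" "u b = 0" and t0: "t0 > 0"
    and seg: "\<And>s. 0 < s \<Longrightarrow> s \<le> t0 \<Longrightarrow> b + of_real s * d \<in> S \<inter> H2"
  shows "((\<lambda>t. u (b + of_real t * d) / t) \<longlongrightarrow> Du b d) (at_right 0)"
proof -
  define k where "k = (\<lambda>s. Du (b + of_real s * d) d)"
  have img: "(\<lambda>s. b + of_real s * d) ` {0..t0} \<subseteq> hclosure S"
  proof (rule image_subsetI)
    fix s assume "s \<in> {0..t0}"
    then show "b + of_real s * d \<in> hclosure S" using seg[of s] b closure_subset[of S] by (cases "s = 0") (auto simp: hclosure_def)
  qed
  have "continuous_on {0..t0} (\<lambda>s. Du (b + of_real s * d))"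
    by (rule continuous_on_compose2[OF _ _ img]) (use C2 in \<open>auto simp: C2_upto_def intro!: continuous_intros\<close>)
  then have ck: "continuous_on {0..t0} k" unfolding k_def
    by (intro bounded_bilinear.continuous_on[OF bounded_bilinear_blinfun_apply] continuous_intros)
  show ?thesis
  proof (rule tendstoI)
    fix \<epsilon> :: real assume "\<epsilon> > 0"
    moreover have "0 \<in> {0..t0}" using t0 by simp
    ultimately obtain \<delta> where \<delta>: "\<delta> > 0" "\<And>s. s \<in> {0..t0} \<Longrightarrow> dist s 0 < \<delta> \<Longrightarrow> dist (k s) (k 0) < \<epsilon>"
      using ck unfolding continuous_on_iff by meson
    have "dist (u (b + of_real t * d) / t) (Du b d) < \<epsilon>" if t: "0 < t" "t < min t0 \<delta>" for t
    proof -
      obtain \<xi> where \<xi>: "0 < \<xi>" "\<xi> < t" "u (b + of_real t * d) = t * Du (b + of_real \<xi> * d) d"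
        by (rule boundary_mean_value[OF C2 b t(1), of d]) (use seg t in auto)
      then show ?thesis using \<delta>(2)[of \<xi>] t by (simp add: k_def dist_real_def)
    qed
    then show "\<forall>\<^sub>F t in at_right 0. dist (u (b + of_real t * d) / t) (Du b d) < \<epsilon>"
      unfolding eventually_at_right_field using t0 \<delta> by (intro exI[of _ "min t0 \<delta>"]) auto
  qed
qed


section \<open>Radial symmetry of the eigenfunction\<close>

locale eigenball =
  fixes p :: complex and R lam \<alpha> :: real and v :: "complex \<Rightarrow> real"
    and Dv :: "complex \<Rightarrow> complex \<Rightarrow>\<^sub>L real"
    and D2v :: "complex \<Rightarrow> complex \<Rightarrow>\<^sub>L (complex \<Rightarrow>\<^sub>L real)"
  assumes p: "p \<in> H2" and R: "R > 0" and lam: "lam > 0" and \<alpha>: "\<alpha> < 0"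
    and eig: "dirichlet_eigenfunction (hball p R) lam v Dv D2v"
    and pos: "\<And>z. z \<in> hball p R \<Longrightarrow> v z > 0"
    and nd: "normal_deriv_eq (hball p R) Dv \<alpha>"
begin

abbreviation e0 where "e0 \<equiv> hcen p R"
abbreviation r0 where "r0 \<equiv> hrad p R"

lemma r0: "r0 > 0" using p R by (simp add: hrad_def H2_def)

lemma B_eq: "hball p R = ball e0 r0" using hball_eq_ball p R by simp

lemma cB_sub: "cball e0 r0 \<subseteq> H2" using cball_hcen_subset p R by simp

lemma hclosure_B: "hclosure (hball p R) = cball e0 r0"
  using r0 cB_sub by (auto simp: hclosure_def B_eq)

lemma hbdry_B: "hbdry (hball p R) = sphere e0 r0"
  using r0 cB_sub by (auto simp: hbdry_def B_eq frontier_ball subset_iff)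

lemma C2v: "C2_upto (hball p R) v Dv D2v" using eig by (simp add: dirichlet_eigenfunction_def)

lemma v_cont: "continuous_on (cball e0 r0) v" and Dv_cont: "continuous_on (cball e0 r0) Dv"
  using C2v by (auto simp: C2_upto_def hclosure_B)

lemma v_bdry: "z \<in> sphere e0 r0 \<Longrightarrow> v z = 0"
  using eig by (simp add: dirichlet_eigenfunction_def hbdry_B)

lemma v_pos: "z \<in> ball e0 r0 \<Longrightarrow> v z > 0" using pos by (simp add: B_eq)

lemma lap_v_hiso:
  assumes "hiso M" "z \<in> H2" "M z \<in> ball e0 r0"
  shows "has_lap (\<lambda>x. v (M x)) z (- lam * v (M z) / (Im z)\<^sup>2)"
proof -
  have "has_lap (\<lambda>x. v (M x)) z (hlap D2v (M z) / (Im z)\<^sup>2)"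
    by (rule has_lap_hiso[OF open_ball _ _ assms]) (use C2v in \<open>auto simp: C2_upto_def B_eq\<close>)
  moreover have "hlap D2v (M z) = - lam * v (M z)"
    using eig assms(3) by (force simp: dirichlet_eigenfunction_def B_eq)
  ultimately show ?thesis by simp
qed

lemma lap_v:
  assumes "z \<in> ball e0 r0"
  shows "has_lap v z (- lam * v z / (Im z)\<^sup>2)"
  using lap_v_hiso[OF hiso_id _ assms] assms cB_sub ball_subset_cball by blast

lemma v_normal:
  assumes b: "b \<in> sphere e0 r0" and s: "ball e \<rho> \<subseteq> ball e0 r0" "cmod (b - e) = \<rho>" "\<rho> > 0"
  shows "Im b * Dv b (b - e) = \<alpha> * \<rho>"
proof -
  have "b \<in> H2" "cmod (b - e0) = r0" using b cB_sub by (auto simp: dist_norm norm_minus_commute)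
  then obtain r phi Dphi where "local_defining (ball e0 r0) b r phi Dphi"
    using local_defining_ball r0 by metis
  then have "local_defining (hball p R) b r phi Dphi" by (simp add: B_eq)
  moreover have "b \<in> hbdry (hball p R)" "b \<notin> hball p R" "ball e \<rho> \<subseteq> hball p R"
    using b s(1) by (auto simp: hbdry_B) (auto simp: B_eq)
  ultimately show ?thesis using normal_deriv_at_tangent_ball nd s(2,3) by blast
qed

text \<open>A model for \<open>v\<close> that is rotationally invariant by construction, positive in
  the ball, with a simple zero on the sphere.\<close>

definition \<delta> where "\<delta> z = cosh R - cosh (hdist p z)"

lemma \<delta>_eq:
  assumes "z \<in> H2"
  shows "\<delta> z = (r0\<^sup>2 - (cmod (z - e0))\<^sup>2) / (2 * Im p * Im z)"
proof -
  have pz: "Im p > 0" "Im z > 0" using p assms by (auto simp: H2_def)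
  have "2 * Im p * Im z * \<delta> z = 2 * Im p * Im z * (cosh R - 1) - (cmod (p - z))\<^sup>2"
    unfolding \<delta>_def hdist_cosh(1)[OF p assms] using pz by (simp add: field_simps)
  also have "\<dots> = r0\<^sup>2 - (cmod (z - e0))\<^sup>2"
  proof -
    have "r0\<^sup>2 = Im p ^ 2 * (cosh R ^ 2 - 1)" by (simp add: hrad_def power_mult_distrib sinh_square_eq)
    then show ?thesis unfolding cmod_power2 by (simp add: hcen_def power2_eq_square algebra_simps)
  qed
  finally show ?thesis using pz by (simp add: field_simps)
qed

text \<open>The boundary value is the quotient of the normal derivatives, \<alpha> for
  \<open>v\<close> and \<open>- sinh R\<close> for the model \<delta>. As a default it also covers
  points outside the ball, so \<open>q\<close> is positive everywhere.\<close>

definition q where "q z = (if z \<in> ball e0 r0 then v z / \<delta> z else - \<alpha> / sinh R)"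

lemma \<delta>_pos: "z \<in> ball e0 r0 \<Longrightarrow> \<delta> z > 0"
proof -
  assume z: "z \<in> ball e0 r0"
  then have "z \<in> H2" using cB_sub ball_subset_cball by blast
  moreover have "r0\<^sup>2 - (cmod (z - e0))\<^sup>2 > 0"
    using z power_strict_mono[of "cmod (z - e0)" r0 2] by (simp add: dist_norm norm_minus_commute)
  ultimately show ?thesis using p by (simp add: \<delta>_eq H2_def)
qed

lemma q_pos: "q z > 0"
proof -
  have "- \<alpha> / sinh R > 0" using \<alpha> R by (intro divide_pos_pos) auto
  then show ?thesis using v_pos \<delta>_pos by (simp add: q_def)
qed

text \<open>Since the normal derivative is constant, \<open>v\<close> vanishes at the boundary at the same rate as
  the rotationally invariant function \<open>\<delta>\<close>.\<close>
lemma q_continuous: "continuous_on (cball e0 r0) q"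
proof -
  define n where "n = (\<lambda>z. (z - e0) /\<^sub>R cmod (z - e0))"
  \<comment> \<open>On the radius through \<open>z\<close> the mean value theorem gives
    \<open>v z = t * Dv \<zeta> d\<close> with \<open>t = 1 - |z - e0| / r0\<close>, and
    \<open>\<delta> z\<close> contains the same factor \<open>t\<close>. \<open>H\<close> is the
    quotient after cancelling it, which is continuous up to the sphere.\<close>
  define H where "H = (\<lambda>x. Dv (snd x) (- r0 *\<^sub>R n (fst x)) * (2 * Im (fst x) * Im p) / (r0 * (r0 + cmod (fst x - e0))))"
  have H: "continuous_on ((cball e0 r0 - {e0}) \<times> cball e0 r0) H" unfolding H_def n_def
    by (intro continuous_intros bounded_bilinear.continuous_on[OF bounded_bilinear_blinfun_apply]
        continuous_on_compose2[OF Dv_cont])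
      (use r0 in \<open>auto simp: add_pos_nonneg less_imp_neq[THEN not_sym] simp del: mem_cball\<close>)
  \<comment> \<open>The bound on \<open>dist z \<zeta>\<close> makes \<zeta> follow \<open>z\<close>
    to the boundary; on the sphere it forces \<open>\<zeta> = z\<close>.\<close>
  have ex: "\<exists>\<zeta>\<in>cball e0 r0. dist z \<zeta> \<le> r0 - cmod (z - e0) \<and> q z = H (z, \<zeta>)"
    if z: "z \<in> cball e0 r0" "z \<noteq> e0" for z
  proof (cases "z \<in> ball e0 r0")
    case True
    define \<nu> where "\<nu> = n z"
    define b where "b = e0 + r0 *\<^sub>R \<nu>"
    define c where "c = cmod (z - e0)"
    have c: "0 < c" "c < r0" using z True by (auto simp: c_def dist_norm norm_minus_commute)
    have nn: "norm (\<nu>) = 1" using z by (simp add: \<nu>_def n_def)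
    have zc: "z = e0 + c *\<^sub>R \<nu>" using c by (simp add: \<nu>_def n_def c_def)
    define t where "t = 1 - c / r0"
    have t: "t > 0" "t < 1" using c by (auto simp: t_def)
    define d where "d = e0 - b"
    have d: "d = - r0 *\<^sub>R \<nu>" by (simp add: d_def b_def)
    have seg: "b + of_real s * d = e0 + ((1 - s) * r0) *\<^sub>R \<nu>" for s
      unfolding d b_def by (simp add: scaleR_conv_of_real algebra_simps)
    have bz: "b + of_real t * d = z" unfolding seg using zc r0 by (simp add: t_def)
    have bs: "b \<in> sphere e0 r0" using nn r0 by (simp add: b_def dist_norm)
    have inb: "b + of_real s * d \<in> ball e0 r0" if "0 < s" "s \<le> t" for s
      unfolding seg using nn r0 t that by (simp add: dist_norm abs_mult)
    obtain \<xi> where \<xi>: "0 < \<xi>" "\<xi> < t" "v (b + of_real t * d) = t * Dv (b + of_real \<xi> * d) d"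
    proof (rule boundary_mean_value[OF C2v _ v_bdry[OF bs] t(1), of d])
      show "b \<in> hclosure (hball p R)" using bs by (simp add: hclosure_B)
      show "b + of_real s * d \<in> hball p R \<inter> H2" if "0 < s" "s \<le> t" for s
        using inb[OF that] cB_sub ball_subset_cball unfolding B_eq by blast
    qed
    define \<zeta> where "\<zeta> = b + of_real \<xi> * d"
    have "dist z \<zeta> = norm ((((1 - t) * r0) - ((1 - \<xi>) * r0)) *\<^sub>R \<nu>)"
      unfolding bz[symmetric] \<zeta>_def seg by (simp add: dist_norm flip: scaleR_diff_left)
    also have "\<dots> = \<bar>((1 - t) * r0) - ((1 - \<xi>) * r0)\<bar>" using nn by (simp only: norm_scaleR) simp
    also have "\<dots> = \<bar>(\<xi> - t) * r0\<bar>" by (simp add: left_diff_distrib)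
    also have "\<dots> = (t - \<xi>) * r0" using \<xi> r0 by (simp add: abs_mult)
    also have "\<dots> \<le> t * r0" using \<xi> r0 by simp
    also have "\<dots> = r0 - c" using r0 by (simp add: t_def algebra_simps)
    finally have 1: "dist z \<zeta> \<le> r0 - cmod (z - e0)" by (simp add: c_def)
    have zH: "z \<in> H2" using z cB_sub by blast
    have "q z = t * Dv \<zeta> d / \<delta> z" using True \<xi> bz by (simp add: q_def \<zeta>_def)
    also have "\<dots> = H (z, \<zeta>)"
    proof -
      have pz: "Im p > 0" "Im z > 0" using zH p by (auto simp: H2_def)
      have "r0\<^sup>2 - c\<^sup>2 = t * r0 * (r0 + c)" using r0 by (simp add: t_def power2_eq_square field_simps)
      then have "\<delta> z = t * r0 * (r0 + c) / (2 * Im p * Im z)" unfolding \<delta>_eq[OF zH] c_def by simp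
      then show ?thesis using t r0 c pz by (simp add: H_def d c_def[symmetric] \<nu>_def[symmetric] mult.commute mult.left_commute)
    qed
    finally have "q z = H (z, \<zeta>)" .
    moreover have "\<zeta> \<in> cball e0 r0" using inb[of \<xi>] \<xi> by (simp add: \<zeta>_def less_imp_le)
    ultimately show ?thesis using 1 by blast
  next
    case False
    then have zs: "z \<in> sphere e0 r0" using z by auto
    then have cz: "cmod (z - e0) = r0" by (simp add: dist_norm norm_minus_commute)
    have zI: "Im z > 0" "Im p > 0" using z cB_sub p by (auto simp: H2_def)
    have "Im z * Dv z (z - e0) = \<alpha> * r0" by (rule v_normal[OF zs subset_refl cz r0])
    moreover have "- r0 *\<^sub>R n z = - (z - e0)" using r0 by (simp add: n_def cz)
    then have "Dv z (- r0 *\<^sub>R n z) = - Dv z (z - e0)" by (metis blinfun.minus_right)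
    then have "H (z, z) = - (Im z * Dv z (z - e0)) * (2 * Im p) / (r0 * (r0 + r0))"
      unfolding H_def fst_conv snd_conv cz by simp
    ultimately have "H (z, z) = - (\<alpha> * r0) * (2 * Im p) / (r0 * (r0 + r0))" by simp
    also have "\<dots> = - \<alpha> * Im p / r0" using r0 by (simp add: field_simps)
    also have "\<dots> = - \<alpha> / sinh R" using zI by (simp add: hrad_def)
    finally show ?thesis using z False cz by (intro bexI[of _ z]) (auto simp: q_def)
  qed
  have \<delta>c: "continuous_on (ball e0 r0) (\<lambda>z. v z / ((r0\<^sup>2 - (cmod (z - e0))\<^sup>2) / (2 * Im p * Im z)))"
  proof (intro continuous_intros continuous_on_subset[OF v_cont])
    show "ball e0 r0 \<subseteq> cball e0 r0" by (rule ball_subset_cball)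
    have H2: "z \<in> H2" if "z \<in> ball e0 r0" for z using that cB_sub ball_subset_cball by blast
    show "\<forall>z\<in>ball e0 r0. 2 * Im p * Im z \<noteq> 0" using H2 p by (force simp: H2_def)
    show "\<forall>z\<in>ball e0 r0. (r0\<^sup>2 - (cmod (z - e0))\<^sup>2) / (2 * Im p * Im z) \<noteq> 0"
      using \<delta>_pos \<delta>_eq H2 by (metis less_irrefl)
  qed
  have "continuous_on (ball e0 r0) q"
    by (rule continuous_on_eq[OF \<delta>c]) (use \<delta>_eq cB_sub in \<open>auto simp: q_def subset_iff\<close>)
  then have int: "isCont q z" if "z \<in> ball e0 r0" for z using that continuous_on_eq_continuous_at by blast
  show ?thesis unfolding continuous_on_eq_continuous_within
  proof
    fix b assume b: "b \<in> cball e0 r0"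
    show "continuous (at b within cball e0 r0) q"
    proof (cases "b \<in> ball e0 r0")
      case True
      then show ?thesis using int continuous_at_imp_continuous_at_within by blast
    next
      case False
      then have bs: "cmod (b - e0) = r0" using b by (auto simp: dist_norm norm_minus_commute)
      have be: "b \<noteq> e0" using bs r0 by auto
      obtain \<zeta> where "dist b \<zeta> \<le> r0 - cmod (b - e0)" "q b = H (b, \<zeta>)" using ex[OF b be] by blast
      then have qb: "q b = H (b, b)" using bs by simp
      show ?thesis unfolding continuous_within_eps_delta
      proof (intro allI impI)
        fix \<epsilon> :: real assume \<epsilon>: "\<epsilon> > 0"
        have "(b, b) \<in> (cball e0 r0 - {e0}) \<times> cball e0 r0" using b be by simp
        then obtain \<eta> where \<eta>: "\<eta> > 0" "\<And>x. x \<in> (cball e0 r0 - {e0}) \<times> cball e0 r0 \<Longrightarrow> dist x (b, b) < \<eta> \<Longrightarrow> dist (H x) (H (b, b)) < \<epsilon>"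
          using H \<epsilon> unfolding continuous_on_iff by meson
        \<comment> \<open>The bound \<open>r0\<close> keeps \<open>z\<close> off the centre, where
          there is no radial direction. \<zeta> is within twice \<open>dist z b\<close> of
          \<open>b\<close>, so the pair is within three times that distance, which is below
          \<eta>.\<close>
        have "dist (q z) (q b) < \<epsilon>" if z: "z \<in> cball e0 r0" "dist z b < min r0 (\<eta> / 4)" for z
        proof -
          have ze: "z \<noteq> e0" using z bs by (auto simp: dist_norm norm_minus_commute)
          obtain \<zeta> where \<zeta>: "\<zeta> \<in> cball e0 r0" "dist z \<zeta> \<le> r0 - cmod (z - e0)" "q z = H (z, \<zeta>)"
            using ex[OF z(1) ze] by blast
          have "r0 \<le> dist z b + cmod (z - e0)" using bs dist_triangle[of b e0 z] by (simp add: dist_norm norm_minus_commute)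
          then have "dist z \<zeta> \<le> dist z b" using \<zeta> by linarith
          then have "dist \<zeta> b \<le> dist z b + dist z b" using dist_triangle[of \<zeta> b z] by (simp add: dist_commute)
          moreover have "dist (z, \<zeta>) (b, b) \<le> dist z b + dist \<zeta> b"
            unfolding dist_Pair_Pair by (rule sqrt_sum_squares_le_sum) auto
          ultimately have "dist (z, \<zeta>) (b, b) < \<eta>" using z(2) \<eta>(1) by simp
          then show ?thesis using \<eta>(2)[of "(z, \<zeta>)"] z ze \<zeta> qb by simp
        qed
        then show "\<exists>d>0. \<forall>x'\<in>cball e0 r0. dist x' b < d \<longrightarrow> dist (q x') (q b) < \<epsilon>"
          using r0 \<eta>(1) by (intro exI[of _ "min r0 (\<eta>/4)"]) auto
      qed
    qed
  qed
qed

lemma cball_hdist: "z \<in> cball e0 r0 \<longleftrightarrow> z \<in> H2 \<and> hdist p z \<le> R"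
  and ball_hdist: "z \<in> ball e0 r0 \<longleftrightarrow> z \<in> H2 \<and> hdist p z < R"
proof -
  have "{z \<in> H2. hdist p z \<le> R} = cball e0 r0" using hcball_eq_cball[OF p] R by simp
  then show "z \<in> cball e0 r0 \<longleftrightarrow> z \<in> H2 \<and> hdist p z \<le> R" by blast
  show "z \<in> ball e0 r0 \<longleftrightarrow> z \<in> H2 \<and> hdist p z < R" unfolding B_eq[symmetric] by (simp add: hball_def)
qed

text \<open>\<open>M\<close> preserves \<delta>, so \<open>q (M x) / q x\<close> is the quotient of
  \<open>v (M x)\<close> and \<open>v x\<close> inside and 1 on the sphere. If its maximum
  \<open>S\<close> exceeded 1, it would be attained inside; there \<open>S * v x - v (M x)\<close>
  is nonnegative and superharmonic with a zero, hence the quotient would be constantly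
  \<open>S\<close>, by continuity also on the sphere.\<close>

lemma v_rotation_le:
  assumes M: "hiso M" "M p = p" and z: "z \<in> ball e0 r0"
  shows "v (M z) \<le> v z"
proof -
  have dM: "hdist p (M x) = hdist p x" if "x \<in> H2" for x
    using hiso_hdist[OF M(1) p that] M(2) by simp
  have Mb: "M x \<in> ball e0 r0 \<longleftrightarrow> x \<in> ball e0 r0" if "x \<in> H2" for x
    using that dM hiso_H2[OF M(1)] unfolding ball_hdist by simp
  have Mc: "M ` cball e0 r0 \<subseteq> cball e0 r0"
    using dM hiso_H2[OF M(1)] unfolding image_subset_iff Ball_def cball_hdist by simp
  define g where "g = (\<lambda>x. q (M x) / q x)"
  have cM: "continuous_on (cball e0 r0) M" using hiso_continuous[OF M(1)] cB_sub continuous_on_subset by blast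
  have "continuous_on (cball e0 r0) (\<lambda>x. q (M x))"
    by (rule continuous_on_compose2[OF q_continuous cM Mc])
  then have cg: "continuous_on (cball e0 r0) g" unfolding g_def
    by (intro continuous_intros q_continuous) (use q_pos in \<open>auto simp: less_imp_neq[THEN not_sym]\<close>)
  obtain m where m: "m \<in> cball e0 r0" "\<And>x. x \<in> cball e0 r0 \<Longrightarrow> g x \<le> g m"
    using continuous_attains_sup[OF compact_cball _ cg] r0 by (metis cball_eq_empty linorder_not_less less_imp_le)
  have gv: "v (M x) = g x * v x" if "x \<in> ball e0 r0" for x
  proof -
    have xH: "x \<in> H2" using that ball_hdist by blast
    then have "M x \<in> ball e0 r0" using Mb that by blast
    moreover have "\<delta> (M x) = \<delta> x" using dM[OF xH] by (simp add: \<delta>_def)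
    ultimately show ?thesis using that \<delta>_pos[OF that] v_pos[OF that] by (simp add: g_def q_def)
  qed
  have gb: "g x = 1" if "x \<in> sphere e0 r0" for x
  proof -
    have "x \<in> H2" "x \<notin> ball e0 r0" using that cB_sub by auto
    then have "M x \<notin> ball e0 r0" "x \<notin> ball e0 r0" using Mb by auto
    then show ?thesis using \<alpha> R by (simp add: g_def q_def)
  qed
  define S where "S = g m"
  have "S \<le> 1"
  proof (rule ccontr)
    assume S: "\<not> S \<le> 1"
    then have mb: "m \<in> ball e0 r0" using m(1) gb S_def by (metis less_eq_real_def mem_ball mem_cball mem_sphere)
    define w where "w = (\<lambda>x. S * v x - v (M x))"
    have wz: "w x = 0" if "x \<in> ball e0 r0" for x
    proof (rule strong_minimum_principle[where U="ball e0 r0" and ?z0.0=m])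
      show nn: "w y \<ge> 0" if "y \<in> ball e0 r0" for y
        using m(2)[of y] v_pos[OF that] gv[OF that] that by (simp add: w_def S_def mult_right_mono)
      show "\<exists>L\<le>0. has_lap w y L" if y: "y \<in> ball e0 r0" for y
      proof -
        have yH: "y \<in> H2" using y ball_hdist by blast
        have "has_lap w y (S * (- lam * v y / (Im y)\<^sup>2) + (-1) * (- lam * v (M y) / (Im y)\<^sup>2))"
          using has_lap_lincomb[OF lap_v[OF y] lap_v_hiso[OF M(1) yH], of S "-1"] Mb[OF yH] y
          by (simp add: w_def[abs_def])
        moreover have "S * (- lam * v y / (Im y)\<^sup>2) + (-1) * (- lam * v (M y) / (Im y)\<^sup>2) = - (lam * w y / (Im y)\<^sup>2)"
          by (simp add: w_def right_diff_distrib diff_divide_distrib mult.left_commute)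
        ultimately show ?thesis using nn[OF y] lam by (metis divide_nonneg_nonneg less_imp_le mult_nonneg_nonneg neg_le_0_iff_le zero_le_power2)
      qed
      show "w m = 0" using gv[OF mb] by (simp add: w_def S_def)
    qed (use mb that in auto)
    have gS: "g x = S" if "x \<in> ball e0 r0" for x
      using wz[OF that] gv[OF that] v_pos[OF that] by (simp add: w_def)
    obtain b where b: "b \<in> sphere e0 r0" using r0 by (metis less_imp_le ex_in_conv sphere_eq_empty not_less)
    have "b \<in> closure (ball e0 r0)" using b r0 by simp
    then have "g b = S"
      using continuous_constant_on_closure[of "ball e0 r0" g S b] cg gS r0 by simp
    then show False using gb[OF b] S by simp
  qed
  have "z \<in> cball e0 r0" using z by simp
  then have "g z \<le> 1" using m(2)[of z] \<open>S \<le> 1\<close> by (simp add: S_def)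
  then show ?thesis using gv[OF z] v_pos[OF z] by (simp add: mult_left_le_one_le)
qed

text \<open>Joining the normal forms of the pairs \<open>p\<close>, \<open>w\<close> and
  \<open>p\<close>, \<open>z\<close> yields an isometry that fixes \<open>p\<close> and takes
  \<open>w\<close> to \<open>z\<close>. Exchanging \<open>z\<close> and \<open>w\<close> gives
  equality.\<close>

lemma v_radial:
  assumes "z \<in> ball e0 r0" "w \<in> ball e0 r0" "hdist p z = hdist p w"
  shows "v z \<le> v w"
proof -
  have H: "z \<in> H2" "w \<in> H2" using assms ball_hdist by blast+
  obtain M1 where M1: "hiso M1" "M1 p = \<i>" "M1 w = \<i> * of_real (exp (hdist p w))"
    using hiso_normal_form[OF p H(2)] by blast
  obtain M2 where M2: "hiso M2" "M2 p = \<i>" "M2 z = \<i> * of_real (exp (hdist p z))"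
    using hiso_normal_form[OF p H(1)] by blast
  obtain N where N: "hiso N" "\<And>z. z \<in> H2 \<Longrightarrow> N (M2 z) = z" by (rule hiso_inverse[OF M2(1)]) simp
  have "N (M1 p) = p" "N (M1 w) = z" using M1 M2 N(2)[OF p] N(2)[OF H(1)] assms(3) by simp_all
  then show ?thesis using v_rotation_le[OF hiso_comp[OF N(1) M1(1)] _ assms(2)] by simp
qed

text \<open>Suppose \<open>v z > v p\<close> and minimize \<open>v\<close> over the closed disc
  about \<open>p\<close> through \<open>z\<close>. By radial symmetry the minimum is not on the
  bounding circle, and in the interior it contradicts the negative Laplacian.\<close>

lemma v_le_center:
  assumes z: "z \<in> ball e0 r0"
  shows "v z \<le> v p"
proof (rule ccontr)
  assume less: "\<not> v z \<le> v p"
  define r where "r = hdist p z"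
  have zH: "z \<in> H2" "r < R" using z ball_hdist by (auto simp: r_def)
  have r: "r \<ge> 0" using hdist_cosh(2)[OF p zH(1)] by (simp add: r_def)
  have C: "x \<in> cball (hcen p r) (hrad p r) \<longleftrightarrow> x \<in> H2 \<and> hdist p x \<le> r" for x
    using hcball_eq_cball[OF p r] by blast
  have sub: "cball (hcen p r) (hrad p r) \<subseteq> ball e0 r0" 
  proof
    fix x assume "x \<in> cball (hcen p r) (hrad p r)"
    then have "x \<in> H2" "hdist p x < R" using C[of x] zH by auto
    then show "x \<in> ball e0 r0" using ball_hdist by blast
  qed
  have pC: "p \<in> cball (hcen p r) (hrad p r)" using C p r by simp
  have "continuous_on (cball (hcen p r) (hrad p r)) v"
    using continuous_on_subset[OF v_cont] sub ball_subset_cball by blast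
  then obtain m where m: "m \<in> cball (hcen p r) (hrad p r)" "\<And>x. x \<in> cball (hcen p r) (hrad p r) \<Longrightarrow> v m \<le> v x"
    using continuous_attains_inf[OF compact_cball[of "hcen p r" "hrad p r"]] pC by blast
  have mb: "m \<in> ball e0 r0" using m sub by blast
  have "v m < v z" using m(2)[OF pC] less by linarith
  then have "hdist p m \<noteq> r" using v_radial[OF z mb] by (metis linorder_not_less r_def)
  then have "m \<in> hball p r" using m(1) C[of m] by (auto simp: hball_def)
  then have "m \<in> ball (hcen p r) (hrad p r)" using hball_eq_ball[OF p r] by simp
  then have "\<forall>\<^sub>F x in nhds m. x \<in> ball (hcen p r) (hrad p r)" using eventually_nhds open_ball by blast
  then have "\<forall>\<^sub>F x in nhds m. v m \<le> v x" by eventually_elim (use m(2) in auto)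
  then have "- lam * v m / (Im m)\<^sup>2 \<ge> 0" using has_lap_local_min lap_v[OF mb] by blast
  moreover have "lam * v m / (Im m)\<^sup>2 > 0" using lam v_pos[OF mb] mb ball_hdist by (simp add: H2_def)
  ultimately show False by simp
qed

end


section \<open>Translates of the eigenfunction, extended by zero\<close>

context eigenball
begin

definition vhat where "vhat z = (if z \<in> ball e0 r0 then v z else 0)"

text \<open>Extension by zero makes \<open>V c z\<close> jointly continuous in \<open>c\<close> and
  \<open>z\<close> on all of \<open>H2\<close>, as the compactness argument of the sweep
  requires.\<close>

definition V where "V c z = vhat (hshift p c z)"

lemma vhat_continuous: "continuous_on H2 vhat"
proof -
  have "continuous_on (cball e0 r0 \<union> (H2 - ball e0 r0)) (\<lambda>z. if z \<in> cball e0 r0 then v z else 0)"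
  proof (rule continuous_on_cases_local)
    show "closedin (top_of_set (cball e0 r0 \<union> (H2 - ball e0 r0))) (cball e0 r0)"
      by (rule closed_subset) auto
    have "H2 - ball e0 r0 = (cball e0 r0 \<union> (H2 - ball e0 r0)) \<inter> (H2 - ball e0 r0)" by blast
    moreover have "H2 - ball e0 r0 = (cball e0 r0 \<union> (H2 - ball e0 r0)) \<inter> - ball e0 r0" using cB_sub by auto
    ultimately show "closedin (top_of_set (cball e0 r0 \<union> (H2 - ball e0 r0))) (H2 - ball e0 r0)"
      by (metis closed_Compl closedin_closed_Int open_ball)
    show "v z = 0" if "z \<in> cball e0 r0 \<and> z \<notin> cball e0 r0 \<or> z \<in> H2 - ball e0 r0 \<and> z \<in> cball e0 r0" for z
      using that v_bdry[of z] by auto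
  qed (use v_cont in auto)
  moreover have "cball e0 r0 \<union> (H2 - ball e0 r0) = H2" using cB_sub by auto
  moreover have "(if z \<in> cball e0 r0 then v z else 0) = vhat z" for z
    using v_bdry[of z] by (auto simp: vhat_def)
  ultimately show ?thesis by simp
qed

lemma hshift_hdist:
  assumes "c \<in> H2" "z \<in> H2"
  shows "hshift p c z \<in> H2" "hdist p (hshift p c z) = hdist c z"
    "hshift p c z \<in> ball e0 r0 \<longleftrightarrow> hdist c z < R" "hshift p c z \<in> cball e0 r0 \<longleftrightarrow> hdist c z \<le> R"
proof -
  show 1: "hshift p c z \<in> H2" using hiso_H2 hiso_hshift[OF p] assms by blast
  show 2: "hdist p (hshift p c z) = hdist c z"
    using hiso_hdist[OF hiso_hshift(1)[OF p assms(1)] assms] hiso_hshift(2)[OF p assms(1)] by simp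
  show "hshift p c z \<in> ball e0 r0 \<longleftrightarrow> hdist c z < R" "hshift p c z \<in> cball e0 r0 \<longleftrightarrow> hdist c z \<le> R"
    unfolding ball_hdist cball_hdist using 1 2 by auto
qed

lemma V_continuous: "continuous_on (H2 \<times> H2) (\<lambda>x. V (fst x) (snd x))"
proof -
  have "continuous_on (H2 \<times> H2) (\<lambda>x. hshift p (fst x) (snd x))" unfolding hshift_def
    by (intro continuous_intros) (auto simp: H2_def)
  then show ?thesis unfolding V_def
    by (rule continuous_on_compose2[OF vhat_continuous]) (use hshift_hdist(1) in auto)
qed

lemma V_outside: "c \<in> H2 \<Longrightarrow> z \<in> H2 \<Longrightarrow> hdist c z \<ge> R \<Longrightarrow> V c z = 0"
  and V_inside: "c \<in> H2 \<Longrightarrow> z \<in> H2 \<Longrightarrow> hdist c z < R \<Longrightarrow> V c z > 0"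
proof -
  assume a: "c \<in> H2" "z \<in> H2"
  show "V c z = 0" if "hdist c z \<ge> R"
    using hshift_hdist(3)[OF a] that unfolding V_def vhat_def by (meson linorder_not_less)
  show "V c z > 0" if "hdist c z < R"
    using hshift_hdist(3)[OF a] that v_pos unfolding V_def vhat_def by simp
qed

lemma vp_pos: "v p > 0" using v_pos ball_hdist p R by force

lemma V_le: "V c z \<le> v p"
  using v_le_center[of "hshift p c z"] vp_pos by (simp add: V_def vhat_def)

lemma V_lap:
  assumes "c \<in> H2" "z \<in> H2" "hdist c z < R"
  shows "has_lap (V c) z (- lam * V c z / (Im z)\<^sup>2)"
proof -
  define M where "M = hshift p c"
  have M: "hiso M" using hiso_hshift[OF p assms(1)] by (simp add: M_def)
  have Mz: "M z \<in> ball e0 r0" using hshift_hdist(3)[OF assms(1,2)] assms(3) by (simp add: M_def)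
  have "open (H2 \<inter> M -` ball e0 r0)"
    using continuous_open_preimage[OF hiso_continuous[OF M] open_H2 open_ball] .
  moreover have "V c x = v (M x)" if "x \<in> H2 \<inter> M -` ball e0 r0" for x
    using that by (simp add: V_def vhat_def M_def)
  moreover have "z \<in> H2 \<inter> M -` ball e0 r0" using assms Mz by simp
  ultimately show ?thesis using has_lap_cong[OF lap_v_hiso[OF M assms(2) Mz]] by metis
qed

text \<open>\<eta> is the largest distance from \<open>p\<close> in the compact set where
  \<open>v \<ge> v p / 2\<close>. It works for all \<open>c\<close> at once because
  \<open>V c\<close> is a translate.\<close>

lemma V_small_near_boundary:
  obtains \<eta> where "\<eta> < R" "\<And>c z. c \<in> H2 \<Longrightarrow> z \<in> H2 \<Longrightarrow> hdist c z > \<eta> \<Longrightarrow> V c z < v p / 2"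
proof -
  define C where "C = {z \<in> cball e0 r0. v z \<in> {v p / 2..}}"
  have "C = cball e0 r0 \<inter> v -` {v p / 2..}" by (auto simp: C_def)
  then have "closed C" using continuous_closed_preimage[OF v_cont closed_cball closed_atLeast] by simp
  then have C: "compact C" using compact_Int_closed[OF compact_cball, of C e0 r0]
    by (simp add: C_def Int_def)
  have pC: "p \<in> C" using vp_pos p R cball_hdist unfolding C_def by auto
  have "C \<subseteq> H2" using cB_sub by (auto simp: C_def)
  then have "continuous_on C (\<lambda>z. hdist p z)"
    using continuous_on_compose2[OF hdist_continuous, of C "\<lambda>z. (p, z)"] p by (force intro!: continuous_intros)
  then obtain m where m: "m \<in> C" "\<And>z. z \<in> C \<Longrightarrow> hdist p z \<le> hdist p m"
    using continuous_attains_sup[OF C] pC by blast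
  have "hdist p m < R"
  proof -
    have "v m \<noteq> 0" "m \<in> cball e0 r0" using m(1) vp_pos by (auto simp: C_def)
    then have "m \<in> ball e0 r0" using v_bdry[of m] by force
    then show ?thesis using ball_hdist by blast
  qed
  moreover have "V c z < v p / 2" if "c \<in> H2" "z \<in> H2" "hdist c z > hdist p m" for c z
  proof (rule ccontr)
    assume a: "\<not> V c z < v p / 2"
    then have "hshift p c z \<in> ball e0 r0" "v (hshift p c z) \<ge> v p / 2"
      using vp_pos by (auto simp: V_def vhat_def split: if_splits)
    then have "hshift p c z \<in> C" by (simp add: C_def)
    then show False using m(2) hshift_hdist(2)[OF that(1,2)] that(3) by fastforce
  qed
  ultimately show ?thesis using that by blast
qed

text \<open>\<open>V c\<close> has a kink on its sphere, so only a one-sided limit \<open>L\<close>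
  along an inward direction is asserted. The shift to \<open>p\<close> scales lengths by
  \<open>k\<close>, and the weight \<open>Im b\<close> compensates this factor.\<close>

lemma V_boundary_derivative:
  assumes c: "c \<in> H2" and b: "b \<in> H2" "hdist c b = R" and \<tau>: "0 < \<tau>" "\<tau> \<le> 1"
    and d: "d = of_real \<tau> * (hcen c R - b)"
  obtains L where "((\<lambda>t. V c (b + of_real t * d) / t) \<longlongrightarrow> L) (at_right 0)"
    "Im b * L = - \<alpha> * (\<tau> * hrad c R)"
proof -
  define k where "k = Im p / Im c"
  have k: "k > 0" using p c by (simp add: k_def H2_def)
  have kc: "k * Im c = Im p" using c by (simp add: k_def H2_def)
  define B where "B = hshift p c b"
  have T: "hshift p c (x + y) = hshift p c x + of_real k * y" for x y
    by (simp only: hshift_def k_def[symmetric]) (simp add: algebra_simps)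
  have cen: "hshift p c (hcen c R) = e0"
    using c by (simp add: hshift_def hcen_def complex_eq_iff H2_def)
  have rad: "k * hrad c R = r0" by (simp add: hrad_def kc[symmetric])
  have ImB: "Im B = k * Im b" by (simp add: B_def hshift_def k_def)
  have BH: "B \<in> H2" "hdist p B = R" using hshift_hdist[OF c b(1)] b by (auto simp: B_def)
  have Bc: "B \<in> cball e0 r0" "B \<notin> ball e0 r0" using BH cball_hdist ball_hdist by auto
  then have Bs: "B \<in> sphere e0 r0" by auto
  have Bn: "cmod (B - e0) = r0" using Bs by (simp add: dist_norm norm_minus_commute)
  have e0B: "e0 - B = of_real k * (hcen c R - b)"
    using T[of b "hcen c R - b"] cen by (simp add: B_def)
  define d' where "d' = of_real \<tau> * (e0 - B)"
  have d': "of_real k * d = d'" unfolding d'_def e0B d by simp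
  have inb: "B + of_real s * d' \<in> ball e0 r0" if "0 < s" "s \<le> 1" for s
  proof -
    have "B + of_real s * d' - e0 = of_real (1 - s * \<tau>) * (B - e0)" by (simp add: d'_def algebra_simps)
    moreover have "s * \<tau> > 0" "s * \<tau> \<le> 1" using that \<tau> by (auto intro: mult_le_one)
    ultimately have "cmod (B + of_real s * d' - e0) = (1 - s * \<tau>) * r0"
      by (metis Bn abs_of_nonneg diff_ge_0_iff_ge norm_mult norm_of_real)
    also have "\<dots> < r0" using \<open>s * \<tau> > 0\<close> r0 mult_strict_right_mono[of "1 - s * \<tau>" 1 r0] by simp
    finally show ?thesis by (simp add: dist_norm norm_minus_commute)
  qed
  have "((\<lambda>t. v (B + of_real t * d') / t) \<longlongrightarrow> Dv B d') (at_right 0)"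
  proof (rule boundary_derivative[OF C2v _ v_bdry[OF Bs], of 1])
    show "B \<in> hclosure (hball p R)" using Bc by (simp add: hclosure_B)
    show "B + of_real s * d' \<in> hball p R \<inter> H2" if "0 < s" "s \<le> 1" for s
      using inb[OF that] cB_sub ball_subset_cball unfolding B_eq by blast
  qed simp
  moreover have "\<forall>\<^sub>F t in at_right (0::real). v (B + of_real t * d') / t = V c (b + of_real t * d) / t"
    unfolding eventually_at_right_field
  proof (intro exI[of _ 1] conjI allI impI)
    fix t :: real assume t: "0 < t" "t < 1"
    have "hshift p c (b + of_real t * d) = B + of_real t * d'"
      unfolding T d'[symmetric] B_def by simp
    then show "v (B + of_real t * d') / t = V c (b + of_real t * d) / t"
      using inb[of t] t by (simp add: V_def vhat_def)
  qed simp
  ultimately have "((\<lambda>t. V c (b + of_real t * d) / t) \<longlongrightarrow> Dv B d') (at_right 0)"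
    by (rule Lim_transform_eventually)
  moreover have "Im b * Dv B d' = - \<alpha> * (\<tau> * hrad c R)"
  proof -
    have "Im B * Dv B (B - e0) = \<alpha> * r0" by (rule v_normal[OF Bs subset_refl Bn r0])
    then have "k * (Im b * Dv B (B - e0)) = k * (\<alpha> * hrad c R)" unfolding ImB rad[symmetric] by (simp add: mult_ac)
    then have 1: "Im b * Dv B (B - e0) = \<alpha> * hrad c R" using k by simp
    have "d' = (- \<tau>) *\<^sub>R (B - e0)" by (simp add: d'_def scaleR_conv_of_real algebra_simps)
    then have "Dv B d' = - \<tau> * Dv B (B - e0)" by (simp only: blinfun.scaleR_right real_scaleR_def)
    then have "Im b * Dv B d' = - \<tau> * (Im b * Dv B (B - e0))" by simp
    then show ?thesis unfolding 1 by simp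
  qed
  ultimately show ?thesis using that by blast
qed

end


section \<open>Sliding the ball\<close>

locale extremal = eigenball +
  fixes \<Omega> :: "complex set" and u :: "complex \<Rightarrow> real"
    and Du :: "complex \<Rightarrow> complex \<Rightarrow>\<^sub>L real"
    and D2u :: "complex \<Rightarrow> complex \<Rightarrow>\<^sub>L (complex \<Rightarrow>\<^sub>L real)"
    and f :: "real \<Rightarrow> real"
  assumes \<Omega>: "\<Omega> \<subseteq> H2" "open \<Omega>" "connected \<Omega>" "C2_boundary \<Omega>"
    and f: "\<And>t. t > 0 \<Longrightarrow> f t \<ge> lam * t"
    and C2u: "C2_upto \<Omega> u Du D2u"
    and eq: "\<And>z. z \<in> \<Omega> \<Longrightarrow> hlap D2u z + f (u z) = 0"
    and u_pos: "\<And>z. z \<in> \<Omega> \<Longrightarrow> u z > 0"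
    and u_bdry: "\<And>z. z \<in> hbdry \<Omega> \<Longrightarrow> u z = 0"
    and u_nd: "normal_deriv_eq \<Omega> Du \<alpha>"
begin

lemma u_cont: "continuous_on (hclosure \<Omega>) u" using C2u by (simp add: C2_upto_def)

lemma \<Omega>_hclosure: "\<Omega> \<subseteq> hclosure \<Omega>" using \<Omega>(1) closure_subset by (auto simp: hclosure_def)

lemma u_cont': "continuous_on \<Omega> u" using continuous_on_subset[OF u_cont \<Omega>_hclosure] .

lemma hbdry_\<Omega>: "z \<in> hclosure \<Omega> \<Longrightarrow> z \<notin> \<Omega> \<Longrightarrow> z \<in> hbdry \<Omega>"
  using \<Omega>(2) by (auto simp: hbdry_def hclosure_def frontier_def interior_open)

lemma u_lap:
  assumes "z \<in> \<Omega>"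
  shows "has_lap u z (- f (u z) / (Im z)\<^sup>2)"
proof -
  have "has_lap u z (hlap D2u z / (Im z)\<^sup>2)"
    by (rule has_lap_hiso[OF \<Omega>(2) _ _ hiso_id]) (use C2u assms \<Omega> in \<open>auto simp: C2_upto_def\<close>)
  moreover have "hlap D2u z = - f (u z)" using eq[OF assms] by linarith
  ultimately show ?thesis by simp
qed

text \<open>At \<open>z\<close> there is the chain
  \<open>lam * V c z \<le> S * (lam * u z) \<le> S * f (u z)\<close>. The factor \<open>S\<close> is
  1 in the sweep and a maximal quotient in the final contradiction.\<close>

lemma superharmonic_difference:
  assumes z: "z \<in> \<Omega>" "c \<in> H2" "hdist c z < R" and S: "S > 0" "S * u z \<ge> V c z"
  shows "\<exists>L\<le>0. has_lap (\<lambda>x. S * u x - V c x) z L"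
proof -
  have zH: "z \<in> H2" using z \<Omega> by blast
  have "has_lap (\<lambda>x. S * u x - V c x) z (S * (- f (u z) / (Im z)\<^sup>2) + (-1) * (- lam * V c z / (Im z)\<^sup>2))"
    using has_lap_lincomb[OF u_lap[OF z(1)] V_lap[OF z(2) zH z(3)], of S "-1"] by simp
  moreover have "S * (- f (u z) / (Im z)\<^sup>2) + (-1) * (- lam * V c z / (Im z)\<^sup>2) \<le> 0"
  proof -
    have "lam * V c z \<le> lam * (S * u z)" using S lam by simp
    also have "\<dots> = S * (lam * u z)" by simp
    also have "\<dots> \<le> S * f (u z)" using f[OF u_pos[OF z(1)]] S by simp
    finally have "(lam * V c z - S * f (u z)) / (Im z)\<^sup>2 \<le> 0" by (simp add: divide_nonpos_nonneg)
    then show ?thesis by (simp add: diff_divide_distrib)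
  qed
  ultimately show ?thesis by blast
qed

lemma ball_R: "c \<in> H2 \<Longrightarrow> z \<in> ball (hcen c R) (hrad c R) \<longleftrightarrow> z \<in> H2 \<and> hdist c z < R"
  and cball_R: "c \<in> H2 \<Longrightarrow> z \<in> cball (hcen c R) (hrad c R) \<longleftrightarrow> z \<in> H2 \<and> hdist c z \<le> R"
proof -
  assume c: "c \<in> H2"
  have "hball c R = ball (hcen c R) (hrad c R)" using hball_eq_ball[OF c] R by simp
  then show "z \<in> ball (hcen c R) (hrad c R) \<longleftrightarrow> z \<in> H2 \<and> hdist c z < R" unfolding hball_def by blast
  have "{z \<in> H2. hdist c z \<le> R} = cball (hcen c R) (hrad c R)" using hcball_eq_cball[OF c] R by simp
  then show "z \<in> cball (hcen c R) (hrad c R) \<longleftrightarrow> z \<in> H2 \<and> hdist c z \<le> R" by blast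
qed

lemma hrad_R: "c \<in> H2 \<Longrightarrow> hrad c R > 0" using R by (simp add: hrad_def H2_def)

lemma V_cont1: "c \<in> H2 \<Longrightarrow> continuous_on H2 (V c)"
  using continuous_on_compose2[OF V_continuous, of H2 "\<lambda>z. (c, z)"] by (force intro!: continuous_intros)

text \<open>Let \<open>S\<close> be the maximum of \<open>V c / u\<close> on the closed ball,
  attained inside because \<open>V c\<close> vanishes on the sphere. Then \<open>S * u - V c\<close>
  is superharmonic and nonnegative with an interior zero, hence zero up to the sphere, where
  \<open>u\<close> would vanish at points of \<Omega>.\<close>

lemma no_closed_ball:
  assumes c: "c \<in> H2" and sub: "cball (hcen c R) (hrad c R) \<subseteq> \<Omega>"
  shows False
proof -
  define e \<rho> where "e = hcen c R" and "\<rho> = hrad c R"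
  note D = e_def[symmetric] \<rho>_def[symmetric]
  have \<rho>: "\<rho> > 0" using hrad_R[OF c] by (simp add: D)
  have sub: "cball e \<rho> \<subseteq> \<Omega>" using sub by (simp add: D)
  define g where "g = (\<lambda>z. V c z / u z)"
  have cu: "continuous_on (cball e \<rho>) u" using continuous_on_subset[OF u_cont' sub] .
  have cV: "continuous_on (cball e \<rho>) (V c)" using continuous_on_subset[OF V_cont1[OF c]] sub \<Omega>(1) by blast
  have cg: "continuous_on (cball e \<rho>) g" unfolding g_def
  proof (intro continuous_intros cu cV ballI)
    fix z assume "z \<in> cball e \<rho>"
    then have "u z > 0" using u_pos sub by blast
    then show "u z \<noteq> 0" by simp
  qed
  have cc: "c \<in> ball e \<rho>" using ball_R[OF c, of c] c R by (simp add: D)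
  then have "c \<in> cball e \<rho>" by auto
  then obtain m where m: "m \<in> cball e \<rho>" "\<And>x. x \<in> cball e \<rho> \<Longrightarrow> g x \<le> g m"
    using continuous_attains_sup[OF compact_cball _ cg] by blast
  define S where "S = g m"
  have "g c > 0" using V_inside[OF c c] u_pos sub \<open>c \<in> cball e \<rho>\<close> R by (auto simp: g_def simp del: mem_cball)
  then have S: "S > 0" using m(2)[OF \<open>c \<in> cball e \<rho>\<close>] by (simp add: S_def)
  have bd: "V c x = 0" if "x \<in> sphere e \<rho>" for x
  proof -
    have "x \<in> cball e \<rho>" "x \<notin> ball e \<rho>" using that by auto
    then show ?thesis using V_outside[OF c] ball_R[OF c, of x] cball_R[OF c, of x] by (simp add: D)
  qed
  have mb: "m \<in> ball e \<rho>"
  proof (rule ccontr)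
    assume "m \<notin> ball e \<rho>"
    then have "m \<in> sphere e \<rho>" using m(1) by auto
    then show False using bd[of m] S by (simp add: S_def g_def)
  qed
  define w where "w = (\<lambda>x. S * u x - V c x)"
  have nn: "w x \<ge> 0" if "x \<in> cball e \<rho>" for x
  proof -
    have "u x > 0" using u_pos that sub by blast
    then show ?thesis using m(2)[OF that] by (simp add: w_def S_def g_def[of ] field_simps)
  qed
  have wz: "w x = 0" if "x \<in> ball e \<rho>" for x
  proof (rule strong_minimum_principle[where U="ball e \<rho>" and ?z0.0=m])
    show "\<exists>L\<le>0. has_lap w y L" if y: "y \<in> ball e \<rho>" for y
    proof -
      have yc: "y \<in> cball e \<rho>" using y by auto
      have "hdist c y < R" using y ball_R[OF c, of y] by (simp add: D)
      then show ?thesis using superharmonic_difference[of y c S] sub yc c S nn[OF yc] unfolding w_def by auto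
    qed
    have "u m > 0" using u_pos m(1) sub by blast
    then show "w m = 0" by (simp add: w_def S_def g_def)
    show "w y \<ge> 0" if "y \<in> ball e \<rho>" for y using nn that by simp
  qed (use mb that in auto)
  obtain b where b: "b \<in> sphere e \<rho>" using \<rho> by (metis less_imp_le ex_in_conv sphere_eq_empty not_less)
  have "continuous_on (closure (ball e \<rho>)) w" unfolding w_def using \<rho> by (simp add: continuous_intros cu cV)
  then have "w b = 0" using continuous_constant_on_closure[of "ball e \<rho>" w 0 b] wz b \<rho> by simp
  then have "u b = 0" using bd[OF b] S by (simp add: w_def)
  moreover have "b \<in> \<Omega>" using b sub by auto
  ultimately show False using u_pos by force
qed

text \<open>Sweeping with the balls centred at \<open>c s\<close>: the part of \<open>V (c s)\<close> over \<open>K\<close> stays below \<open>u\<close>,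
  since a first contact is excluded in the interior by the strong minimum principle and at the
  boundary by the Hopf lemma, the two normal derivatives being equal.\<close>
lemma sweep:
  fixes c :: "real \<Rightarrow> complex"
  assumes c: "continuous_on {s\<^sub>1..s\<^sub>2} c" "\<And>s. s \<in> {s\<^sub>1..s\<^sub>2} \<Longrightarrow> c s \<in> H2" and s: "s\<^sub>1 \<le> s\<^sub>2"
    and K: "closedin (top_of_set H2) K" and \<Gamma>: "\<Gamma> \<subseteq> \<Omega>" "\<Gamma> \<noteq> {}"
    and \<Gamma>V: "\<And>s z. s \<in> {s\<^sub>1..s\<^sub>2} \<Longrightarrow> z \<in> \<Gamma> \<Longrightarrow> V (c s) z < u z"
    and Kop: "\<And>s z. s \<in> {s\<^sub>1..s\<^sub>2} \<Longrightarrow> z \<in> K \<Longrightarrow> hdist (c s) z \<le> R \<Longrightarrow> z \<notin> \<Gamma> \<Longrightarrow> \<exists>\<epsilon>>0. ball z \<epsilon> \<subseteq> K"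
    and start: "\<And>z. z \<in> K \<Longrightarrow> \<not> hdist (c s\<^sub>1) z \<le> R"
    and finish: "\<And>z. z \<in> H2 \<Longrightarrow> hdist (c s\<^sub>2) z \<le> R \<Longrightarrow> z \<in> K"
  shows False
proof -
  have KH: "K \<subseteq> H2" using K closedin_subset by fastforce
  \<comment> \<open>All closed balls of the family, stacked over the parameter; compact as the image
    of the interval times the closed unit disc.\<close>
  define E where "E = {x. fst x \<in> {s\<^sub>1..s\<^sub>2} \<and> snd x \<in> H2 \<and> hdist (c (fst x)) (snd x) \<le> R}"
  have EH: "(c (fst x), snd x) \<in> H2 \<times> H2" if "x \<in> E" for x using that c by (auto simp: E_def)
  have "compact E"
  proof -
    define h where "h = (\<lambda>x. (fst x, hcen (c (fst x)) R + of_real (hrad (c (fst x)) R) * snd x))"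
    have cc: "continuous_on ({s\<^sub>1..s\<^sub>2} \<times> cball 0 1) (\<lambda>x. c (fst x))"
      by (rule continuous_on_compose2[OF c(1)]) (auto intro!: continuous_intros)
    have "continuous_on ({s\<^sub>1..s\<^sub>2} \<times> cball 0 1) h" unfolding h_def hcen_def hrad_def
      by (intro continuous_intros cc)
    then have "compact (h ` ({s\<^sub>1..s\<^sub>2} \<times> cball (0::complex) 1))"
      by (intro compact_continuous_image compact_Times) auto
    moreover have "h ` ({s\<^sub>1..s\<^sub>2} \<times> cball (0::complex) 1) = E"
    proof (intro equalityI subsetI)
      fix x assume "x \<in> h ` ({s\<^sub>1..s\<^sub>2} \<times> cball (0::complex) 1)"
      then obtain s y where y: "s \<in> {s\<^sub>1..s\<^sub>2}" "cmod y \<le> 1" "x = h (s, y)" by auto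
      have r: "hrad (c s) R > 0" using hrad_R c y by blast
      have "snd x \<in> cball (hcen (c s) R) (hrad (c s) R)" using y r by (simp add: h_def dist_norm norm_mult mult_left_le)
      then show "x \<in> E" using y cball_R[OF c(2)[OF y(1)], of "snd x"] by (simp add: E_def h_def)
    next
      fix x assume x: "x \<in> E"
      then have s: "fst x \<in> {s\<^sub>1..s\<^sub>2}" by (simp add: E_def)
      define r e where "r = hrad (c (fst x)) R" and "e = hcen (c (fst x)) R"
      have r: "r > 0" using hrad_R c s by (simp add: r_def)
      have "snd x \<in> cball e r" using x cball_R[OF c(2)[OF s], of "snd x"] by (simp add: E_def r_def e_def)
      then have "cmod ((snd x - e) / of_real r) \<le> 1"
        using r by (simp add: dist_norm norm_minus_commute norm_divide)
      moreover have "x = h (fst x, (snd x - e) / of_real r)"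
        using r by (simp add: h_def r_def[symmetric] e_def[symmetric] prod_eq_iff)
      ultimately show "x \<in> h ` ({s\<^sub>1..s\<^sub>2} \<times> cball 0 1)" using s by (intro image_eqI) auto
    qed
    ultimately show ?thesis by simp
  qed
  have cE: "continuous_on E (\<lambda>x. (c (fst x), snd x))"
    by (intro continuous_intros continuous_on_compose2[OF c(1)]) (auto simp: E_def)
  have VE: "continuous_on E (\<lambda>x. V (c (fst x)) (snd x))"
    using continuous_on_compose2[OF V_continuous cE] EH by fastforce
  \<comment> \<open>\<open>Good\<close> is relatively open in \<open>E\<close>, so
    \<open>Bad\<close>, the failures over \<open>K\<close>, is compact. If it is not empty there is
    a first bad parameter \<open>s0\<close>.\<close>
  define Good where "Good = {x \<in> E. snd x \<in> \<Omega> \<and> u (snd x) - V (c (fst x)) (snd x) \<in> {0<..}}"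
  define Bad where "Bad = {x \<in> E. snd x \<in> K} - Good"
  have Good: "openin (top_of_set E) Good"
  proof -
    define E' where "E' = {x \<in> E. snd x \<in> \<Omega>}"
    have E': "openin (top_of_set E) E'" unfolding E'_def
      using continuous_openin_preimage_gen[OF _ \<Omega>(2), of E snd]
      by (simp add: continuous_on_snd continuous_on_id vimage_def Int_def)
    have "continuous_on E' (\<lambda>x. u (snd x))"
      by (rule continuous_on_compose2[OF u_cont']) (auto simp: E'_def intro!: continuous_intros)
    then have "continuous_on E' (\<lambda>x. u (snd x) - V (c (fst x)) (snd x))"
      by (intro continuous_intros continuous_on_subset[OF VE]) (auto simp: E'_def)
    then have "openin (top_of_set E') (E' \<inter> (\<lambda>x. u (snd x) - V (c (fst x)) (snd x)) -` {0<..})"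
      by (rule continuous_openin_preimage_gen) simp
    moreover have "E' \<inter> (\<lambda>x. u (snd x) - V (c (fst x)) (snd x)) -` {0<..} = Good"
      by (auto simp: E'_def Good_def)
    ultimately show ?thesis using openin_trans E' by metis
  qed
  have "closedin (top_of_set E) Bad"
  proof -
    have "closedin (top_of_set E) (E \<inter> snd -` K)"
      by (rule continuous_closedin_preimage_gen[OF _ _ K]) (auto simp: E_def intro!: continuous_intros)
    moreover have "Bad = (E \<inter> snd -` K) - Good" by (auto simp: Bad_def)
    ultimately show ?thesis using closedin_diff Good by metis
  qed
  then have "compact Bad" using \<open>compact E\<close> closedin_compact by blast
  then have cT: "compact (fst ` Bad)" by (intro compact_continuous_image continuous_intros)
  show False
  proof (cases "Bad = {}")
    case True
    have c2: "c s\<^sub>2 \<in> H2" using c s by auto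
    have "cball (hcen (c s\<^sub>2) R) (hrad (c s\<^sub>2) R) \<subseteq> \<Omega>"
    proof
      fix z assume "z \<in> cball (hcen (c s\<^sub>2) R) (hrad (c s\<^sub>2) R)"
      then have z: "z \<in> H2" "hdist (c s\<^sub>2) z \<le> R" using cball_R[OF c2] by auto
      then have "(s\<^sub>2, z) \<in> E" "z \<in> K" using s finish by (auto simp: E_def)
      then have "(s\<^sub>2, z) \<in> Good" using True by (auto simp: Bad_def)
      then show "z \<in> \<Omega>" by (simp add: Good_def)
    qed
    then show False using no_closed_ball c2 by blast
  next
    case False
    then obtain s0 where s0: "s0 \<in> fst ` Bad" "\<And>s. s \<in> fst ` Bad \<Longrightarrow> s0 \<le> s"
      using compact_attains_inf[OF cT] by auto
    then obtain z0 where z0: "(s0, z0) \<in> Bad" by auto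
    then have z0E: "s0 \<in> {s\<^sub>1..s\<^sub>2}" "z0 \<in> H2" "hdist (c s0) z0 \<le> R" "z0 \<in> K" "(s0, z0) \<notin> Good"
      by (auto simp: Bad_def E_def)
    have "s0 \<noteq> s\<^sub>1" using start z0E by blast
    then have s01: "s\<^sub>1 < s0" using z0E by auto
    define c0 where "c0 = c s0"
    have c0: "c0 \<in> H2" using c z0E by (simp add: c0_def)
    define e \<rho> where "e = hcen c0 R" and "\<rho> = hrad c0 R"
    have \<rho>: "\<rho> > 0" using hrad_R[OF c0] by (simp add: \<rho>_def)
    have inball: "z \<in> ball e \<rho> \<longleftrightarrow> z \<in> H2 \<and> hdist c0 z < R" for z unfolding e_def \<rho>_def by (rule ball_R[OF c0])
    have incball: "z \<in> cball e \<rho> \<longleftrightarrow> z \<in> H2 \<and> hdist c0 z \<le> R" for z unfolding e_def \<rho>_def by (rule cball_R[OF c0])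
    \<comment> \<open>A point of the open ball at \<open>s0\<close> also lies in the balls for
      \<open>s\<close> slightly below \<open>s0\<close>, where nothing is bad yet. Letting
      \<open>s\<close> increase to \<open>s0\<close> keeps only the weak inequality.\<close>
    have below: "z \<in> \<Omega> \<and> V c0 z \<le> u z" if z: "z \<in> K" "z \<in> ball e \<rho>" for z
    proof -
      define F where "F = at_left s0"
      have F: "F \<noteq> bot" unfolding F_def by (rule trivial_limit_at_left_real)
      have zH: "z \<in> H2" "hdist c0 z < R" using z inball by auto
      have "(c \<longlongrightarrow> c0) (at s0 within {s\<^sub>1..s\<^sub>2})" using c(1) z0E(1) by (simp add: continuous_on_def c0_def)
      then have "(c \<longlongrightarrow> c0) (at s0 within {s\<^sub>1..s0})" by (rule tendsto_within_subset) (use z0E in auto)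
      then have cF: "(c \<longlongrightarrow> c0) F" unfolding F_def using s01 by (simp add: at_within_Icc_at_left)
      have inH: "\<forall>\<^sub>F s in F. s \<in> {s\<^sub>1..<s0}" 
        unfolding F_def using eventually_at_left_real[OF s01] by (rule eventually_mono) auto
      have pt: "((\<lambda>s. (c s, z)) \<longlongrightarrow> (c0, z)) F" using cF by (intro tendsto_intros)
      have inHH: "\<forall>\<^sub>F s in F. (c s, z) \<in> H2 \<times> H2" using inH by eventually_elim (use c(2) z0E zH in auto)
      have "((\<lambda>s. hdist (c s) z) \<longlongrightarrow> hdist c0 z) F"
        using continuous_on_tendsto_compose[OF hdist_continuous pt _ inHH] c0 zH by simp
      then have "\<forall>\<^sub>F s in F. hdist (c s) z < R" using zH by (auto dest: order_tendstoD)
      then have ev: "\<forall>\<^sub>F s in F. z \<in> \<Omega> \<and> V (c s) z \<le> u z" using inH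
      proof eventually_elim
        case (elim s)
        then have "(s, z) \<in> E" using z0E zH by (auto simp: E_def)
        moreover have "(s, z) \<notin> Bad" using s0(2)[of s] elim by force
        ultimately show ?case using z by (auto simp: Bad_def Good_def)
      qed
      have "((\<lambda>s. V (c s) z) \<longlongrightarrow> V c0 z) F"
        using continuous_on_tendsto_compose[OF V_continuous pt _ inHH] c0 zH by simp
      then have "V c0 z \<le> u z" by (rule tendsto_upperbound[OF _ _ F]) (use ev in \<open>auto elim: eventually_mono\<close>)
      moreover have "z \<in> \<Omega>" using eventually_happens[OF ev] F by blast
      ultimately show ?thesis by blast
    qed
    define w where "w = (\<lambda>z. u z - V c0 z)"
    have wlap: "\<exists>L\<le>0. has_lap w z L" if "z \<in> K" "z \<in> ball e \<rho>" for z
      using superharmonic_difference[of z c0 1] below[OF that] inball[of z] that c0 by (simp add: w_def del: mem_ball)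
    \<comment> \<open>The zero set \<open>Z\<close> is closed in the ball; it is open because zeros
      avoid \<Gamma> and \<open>K\<close> contains a neighbourhood of each of them. So a single zero
      forces \<open>Z\<close> to be the whole ball.\<close>
    have contact: "w z \<noteq> 0" if zK: "z \<in> K" "z \<in> ball e \<rho>" for z
    proof
      assume wz: "w z = 0"
      define Z where "Z = {x \<in> K \<inter> ball e \<rho>. w x = 0}"
      have Kb: "closedin (top_of_set (ball e \<rho>)) (K \<inter> ball e \<rho>)"
      proof -
        obtain T where T: "closed T" "K = H2 \<inter> T" using K unfolding closedin_closed by blast
        then have "K \<inter> ball e \<rho> = ball e \<rho> \<inter> T" using inball by blast
        then show ?thesis using T(1) closedin_closed_Int by metis
      qed
      have sub\<Omega>: "K \<inter> ball e \<rho> \<subseteq> \<Omega>" using below by blast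
      have "continuous_on (K \<inter> ball e \<rho>) w" unfolding w_def
        by (intro continuous_intros continuous_on_subset[OF u_cont' sub\<Omega>] continuous_on_subset[OF V_cont1[OF c0]])
          (use KH in auto)
      then have "closedin (top_of_set (K \<inter> ball e \<rho>)) Z" unfolding Z_def
        by (rule continuous_closedin_preimage_constant)
      then have "closedin (top_of_set (ball e \<rho>)) Z" using Kb closedin_trans by blast
      moreover have "openin (top_of_set (ball e \<rho>)) Z"
      proof -
        have "open Z" unfolding open_contains_ball
        proof
          fix x assume x: "x \<in> Z"
          then have xx: "x \<in> K" "x \<in> ball e \<rho>" "w x = 0" by (auto simp: Z_def)
          have "x \<notin> \<Gamma>" using \<Gamma>V[OF z0E(1), of x] xx(3) by (auto simp: w_def c0_def)
          then obtain \<epsilon>1 where \<epsilon>1: "\<epsilon>1 > 0" "ball x \<epsilon>1 \<subseteq> K"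
            using Kop[OF z0E(1) xx(1)] xx(2) inball[of x] by (auto simp: c0_def)
          obtain \<epsilon>2 where \<epsilon>2: "\<epsilon>2 > 0" "ball x \<epsilon>2 \<subseteq> ball e \<rho>" using xx(2) open_ball open_contains_ball by blast
          define \<epsilon> where "\<epsilon> = min \<epsilon>1 \<epsilon>2"
          have \<epsilon>: "\<epsilon> > 0" "ball x \<epsilon> \<subseteq> K \<inter> ball e \<rho>" using \<epsilon>1 \<epsilon>2 by (auto simp: \<epsilon>_def)
          have "ball x (\<epsilon>/2) \<subseteq> Z"
          proof
            fix y assume y: "y \<in> ball x (\<epsilon>/2)"
            have "w y = 0"
            proof (rule strong_minimum_principle_local[where w=w, OF _ _ xx(3) y])
              show "\<exists>L\<le>0. has_lap w z L" if "z \<in> ball x \<epsilon>" for z using wlap that \<epsilon>(2) by blast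
              show "w z \<ge> 0" if "z \<in> ball x \<epsilon>" for z 
              proof -
                have "z \<in> K" "z \<in> ball e \<rho>" using that \<epsilon>(2) by blast+
                then show ?thesis using below[of z] by (simp add: w_def)
              qed
            qed
            moreover have "y \<in> ball x \<epsilon>" using y \<epsilon>(1) by auto
            then have "y \<in> K \<inter> ball e \<rho>" using \<epsilon>(2) by blast
            ultimately show "y \<in> Z" by (simp add: Z_def)
          qed
          then show "\<exists>e>0. ball x e \<subseteq> Z" using \<epsilon>(1) by (intro exI[of _ "\<epsilon>/2"]) auto
        qed
        then show ?thesis by (rule open_subset[rotated]) (auto simp: Z_def)
      qed
      moreover have "Z \<noteq> {}" using zK wz by (auto simp: Z_def)
      ultimately have Zb: "Z = ball e \<rho>" by (metis connected_ball connected_clopen)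
      have b\<Omega>: "ball e \<rho> \<subseteq> \<Omega>" using sub\<Omega> Zb by (auto simp: Z_def)
      have cH: "cball e \<rho> \<subseteq> hclosure \<Omega>"
      proof
        fix x assume x: "x \<in> cball e \<rho>"
        then have "x \<in> closure (ball e \<rho>)" using \<rho> by simp
        then show "x \<in> hclosure \<Omega>" using closure_mono[OF b\<Omega>] incball[of x] x unfolding hclosure_def by blast
      qed
      have cb: "closure (ball e \<rho>) = cball e \<rho>" using \<rho> by simp
      have cbH: "cball e \<rho> \<subseteq> H2" using incball by blast
      have cw: "continuous_on (closure (ball e \<rho>)) w" unfolding w_def cb
        by (intro continuous_intros continuous_on_subset[OF u_cont cH] continuous_on_subset[OF V_cont1[OF c0] cbH])
      have wc: "w x = 0" if "x \<in> cball e \<rho>" for x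
      proof (rule continuous_constant_on_closure[OF cw])
        show "w y = 0" if "y \<in> ball e \<rho>" for y 
        proof -
          have "y \<in> Z" using that Zb by blast
          then show ?thesis by (simp add: Z_def)
        qed
        show "x \<in> closure (ball e \<rho>)" using that unfolding cb .
      qed
      \<comment> \<open>Now \<open>u = V c0\<close> vanishes on the sphere, so the sphere misses
        \<Omega> and the ball is clopen in the connected set \<Omega>. Then \<Gamma> would consist
        of zeros, although \<open>V\<close> is strictly below \<open>u\<close> there.\<close>
      have "cball e \<rho> \<inter> \<Omega> \<subseteq> ball e \<rho>"
      proof
        fix x assume x: "x \<in> cball e \<rho> \<inter> \<Omega>"
        show "x \<in> ball e \<rho>"
        proof (rule ccontr)
          assume "x \<notin> ball e \<rho>"
          then have "V c0 x = 0" using V_outside[OF c0, of x] inball[of x] x \<Omega>(1) by (meson IntD2 linorder_not_less subsetD)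
          then show False using wc[of x] u_pos[of x] x by (auto simp: w_def)
        qed
      qed
      then have "ball e \<rho> = \<Omega> \<inter> cball e \<rho>" using b\<Omega> by auto
      then have "closedin (top_of_set \<Omega>) (ball e \<rho>)" using closedin_closed_Int[OF closed_cball] by metis
      moreover have "openin (top_of_set \<Omega>) (ball e \<rho>)" using b\<Omega> by (intro open_subset) auto
      moreover have "ball e \<rho> \<noteq> {}" using \<rho> by simp
      ultimately have "ball e \<rho> = \<Omega>" using \<Omega>(3) by (metis connected_clopen)
      moreover obtain x where x: "x \<in> \<Gamma>" using \<Gamma>(2) by blast
      ultimately have "x \<in> Z" using Zb \<Gamma>(1) by blast
      then show False using \<Gamma>V[OF z0E(1) x] by (auto simp: Z_def w_def c0_def)
    qed
    have z0b: "z0 \<notin> ball e \<rho>"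
    proof
      assume b: "z0 \<in> ball e \<rho>"
      have "w z0 > 0" using below[OF z0E(4) b] contact[OF z0E(4) b] by (auto simp: w_def)
      then have "(s0, z0) \<in> Good" using below[OF z0E(4) b] z0E by (simp add: Good_def E_def w_def c0_def)
      then show False using z0E by blast
    qed
    have dR: "hdist c0 z0 = R" using z0b z0E inball[of z0] by (auto simp: c0_def)
    have V0: "V c0 z0 = 0" using V_outside[OF c0 z0E(2)] dR by simp
    have z0\<Omega>: "z0 \<notin> \<Omega>"
    proof
      assume "z0 \<in> \<Omega>"
      then have "(s0, z0) \<in> Good" using z0E V0 u_pos by (simp add: Good_def E_def c0_def)
      then show False using z0E by blast
    qed
    then have "z0 \<notin> \<Gamma>" using \<Gamma> by blast
    then obtain \<epsilon> where \<epsilon>: "\<epsilon> > 0" "ball z0 \<epsilon> \<subseteq> K" using Kop[OF z0E(1,4,3)] by blast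
    have z0r: "cmod (z0 - e) = \<rho>" using z0b incball[of z0] z0E by (auto simp: dist_norm norm_minus_commute c0_def)
    \<comment> \<open>A smaller disc of radius \<open>\<tau> * \<rho>\<close>, internally tangent to
      the ball at \<open>z0\<close>. Its diameter is at most \<open>\<epsilon>/2\<close>, so it
      stays in \<open>K\<close>, hence in \<Omega>, and serves for the Hopf lemma as well as for
      locating the normal of \<Omega>.\<close>
    define \<tau> where "\<tau> = min (1/2) (\<epsilon> / (4 * \<rho>))"
    have \<tau>: "0 < \<tau>" "\<tau> \<le> 1" using \<epsilon> \<rho> by (auto simp: \<tau>_def)
    have "\<tau> \<le> \<epsilon> / (4 * \<rho>)" by (simp add: \<tau>_def)
    then have \<tau>\<rho>: "4 * (\<tau> * \<rho>) \<le> \<epsilon>" using \<rho> by (simp add: field_simps)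
    define d where "d = of_real \<tau> * (e - z0)"
    define e' where "e' = z0 + d"
    have nd: "cmod d = \<tau> * \<rho>" using \<tau> z0r by (simp add: d_def norm_mult norm_minus_commute)
    have tr: "\<tau> * \<rho> > 0" using \<tau> \<rho> by simp
    have sub1: "ball e' (\<tau> * \<rho>) \<subseteq> ball z0 \<epsilon>"
    proof
      fix x assume "x \<in> ball e' (\<tau> * \<rho>)"
      moreover have "dist z0 e' = \<tau> * \<rho>" using nd by (simp add: e'_def dist_norm)
      ultimately have "dist z0 x < \<tau> * \<rho> + \<tau> * \<rho>" using dist_triangle[of z0 x e'] unfolding mem_ball by linarith
      then show "x \<in> ball z0 \<epsilon>" using \<tau>\<rho> tr unfolding mem_ball by linarith
    qed
    have sub2: "ball e' (\<tau> * \<rho>) \<subseteq> ball e \<rho>"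
    proof
      fix x assume x: "x \<in> ball e' (\<tau> * \<rho>)"
      have "e - e' = of_real (1 - \<tau>) * (e - z0)" by (simp add: e'_def d_def algebra_simps)
      then have "dist e e' = (1 - \<tau>) * \<rho>" using \<tau> z0r by (metis abs_of_nonneg diff_ge_0_iff_ge dist_norm norm_minus_commute norm_mult norm_of_real)
      then have "dist e x < (1 - \<tau>) * \<rho> + \<tau> * \<rho>" using dist_triangle[of e x e'] x unfolding mem_ball by linarith
      then show "x \<in> ball e \<rho>" by (simp add: algebra_simps)
    qed
    have subK: "ball e' (\<tau> * \<rho>) \<subseteq> K" using sub1 \<epsilon> by blast
    have sub\<Omega>: "ball e' (\<tau> * \<rho>) \<subseteq> \<Omega>" using below subK sub2 by blast
    have ce: "cball e' (\<tau> * \<rho>) \<subseteq> cball e \<rho>" using closure_mono[OF sub2] tr \<rho> by simp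
    have ch: "cball e' (\<tau> * \<rho>) \<subseteq> hclosure \<Omega>"
      
    proof
      fix x assume x: "x \<in> cball e' (\<tau> * \<rho>)"
      then have "x \<in> closure (ball e' (\<tau> * \<rho>))" using tr by simp
      moreover have "x \<in> H2" using x ce incball by blast
      ultimately show "x \<in> hclosure \<Omega>" using closure_mono[OF sub\<Omega>] unfolding hclosure_def by blast
    qed
    have z0c: "z0 \<in> cball e' (\<tau> * \<rho>)" using nd by (simp add: e'_def dist_norm)
    have z0bd: "z0 \<in> hbdry \<Omega>" using hbdry_\<Omega> ch z0c z0\<Omega> by blast
    have "\<exists>\<epsilon>'>0. \<forall>t. 0 < t \<and> t < 1/2 \<longrightarrow> w (z0 + of_real t * (e' - z0)) \<ge> \<epsilon>' * t"
    proof (rule hopf_lemma[OF tr])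
      have "cball e' (\<tau> * \<rho>) \<subseteq> H2" using ce incball by blast
      then show "continuous_on (cball e' (\<tau> * \<rho>)) w" unfolding w_def
        by (intro continuous_intros continuous_on_subset[OF u_cont ch] continuous_on_subset[OF V_cont1[OF c0]])
      show "\<exists>L\<le>0. has_lap w z L" if "z \<in> ball e' (\<tau> * \<rho>)" for z using wlap that subK sub2 by blast
      show "w z > 0" if "z \<in> ball e' (\<tau> * \<rho>)" for z
      proof -
        have "z \<in> K" "z \<in> ball e \<rho>" using that subK sub2 by auto
        then show ?thesis using below[of z] contact[of z] by (auto simp: w_def)
      qed
      show "cmod (z0 - e') = \<tau> * \<rho>" using nd by (simp add: e'_def)
    qed
    then obtain \<epsilon>' where \<epsilon>': "\<epsilon>' > 0" "\<And>t. 0 < t \<Longrightarrow> t < 1/2 \<Longrightarrow> w (z0 + of_real t * d) \<ge> \<epsilon>' * t"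
      by (auto simp: e'_def)
    have ul: "((\<lambda>t. u (z0 + of_real t * d) / t) \<longlongrightarrow> Du z0 d) (at_right 0)"
    proof (rule boundary_derivative[OF C2u _ u_bdry[OF z0bd], of 1])
      show "z0 \<in> hclosure \<Omega>" using ch z0c by blast
      show "z0 + of_real s * d \<in> \<Omega> \<inter> H2" if "0 < s" "s \<le> 1" for s
      proof -
        have "e' - (z0 + of_real s * d) = of_real (1 - s) * d" by (simp add: e'_def algebra_simps)
        then have "dist e' (z0 + of_real s * d) = (1 - s) * (\<tau> * \<rho>)"
          using that nd by (metis abs_of_nonneg diff_ge_0_iff_ge dist_norm norm_mult norm_of_real)
        also have "\<dots> < \<tau> * \<rho>" using that tr mult_strict_right_mono[of "1 - s" 1 "\<tau> * \<rho>"] by simp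
        finally have "z0 + of_real s * d \<in> ball e' (\<tau> * \<rho>)" by simp
        then show ?thesis using sub\<Omega> \<Omega>(1) by blast
      qed
    qed simp
    obtain L where L: "((\<lambda>t. V c0 (z0 + of_real t * d) / t) \<longlongrightarrow> L) (at_right 0)" "Im z0 * L = - \<alpha> * (\<tau> * \<rho>)"
      unfolding \<rho>_def by (rule V_boundary_derivative[OF c0 z0E(2) dR \<tau>, of d]) (auto simp: d_def e_def)
    \<comment> \<open>The small disc touches both boundaries at \<open>z0\<close>, so the normals
      coincide and the one-sided derivatives of \<open>u\<close> and \<open>V c0\<close> along
      \<open>d\<close> agree, whereas the Hopf lemma demands a positive gap \<epsilon>'.\<close>
    have "Im z0 * Du z0 (z0 - e') = \<alpha> * (\<tau> * \<rho>)"
    proof -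
      obtain r phi Dphi where "local_defining \<Omega> z0 r phi Dphi" using \<Omega>(4) z0bd unfolding C2_boundary_def by blast
      then show ?thesis
        by (rule normal_deriv_at_tangent_ball[OF _ u_nd z0bd z0\<Omega> sub\<Omega>]) (use nd tr in \<open>auto simp: e'_def\<close>)
    qed
    then have "Im z0 * Du z0 d = - \<alpha> * (\<tau> * \<rho>)" by (simp add: e'_def blinfun.minus_right)
    then have "Im z0 * Du z0 d = Im z0 * L" using L by simp
    then have DL: "Du z0 d = L" using z0E(2) by (simp add: H2_def)
    have "((\<lambda>t. u (z0 + of_real t * d) / t - V c0 (z0 + of_real t * d) / t) \<longlongrightarrow> Du z0 d - L) (at_right 0)"
      by (intro tendsto_intros ul L)
    moreover have "\<forall>\<^sub>F t in at_right (0::real). \<epsilon>' \<le> u (z0 + of_real t * d) / t - V c0 (z0 + of_real t * d) / t"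
      unfolding eventually_at_right_field
    proof (intro exI[of _ "1/2"] conjI allI impI)
      fix t :: real assume t: "0 < t" "t < 1/2"
      then have "w (z0 + of_real t * d) / t \<ge> \<epsilon>'" using \<epsilon>'(2)[OF t] by (simp add: pos_le_divide_eq)
      then show "\<epsilon>' \<le> u (z0 + of_real t * d) / t - V c0 (z0 + of_real t * d) / t" by (simp add: w_def diff_divide_distrib)
    qed simp
    ultimately have "\<epsilon>' \<le> Du z0 d - L" using tendsto_lowerbound trivial_limit_at_right_real by blast
    then show False using DL \<epsilon>'(1) by simp
  qed
qed

end


section \<open>From long paths to the diameter bound\<close>

context extremal
begin

text \<open>Centres on the bisector are at distance at least \<open>R\<close> from both endpoints,
  so \<open>above\<close> asks only for such centres. This weaker demand is what allows a path that
  runs slightly outside the component.\<close>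

lemma no_long_path:
  assumes \<gamma>: "path \<gamma>" "path_image \<gamma> \<subseteq> \<Omega>" and far: "hdist (pathstart \<gamma>) (pathfinish \<gamma>) > 2 * R"
    and above: "\<And>c z. c \<in> H2 \<Longrightarrow> z \<in> path_image \<gamma> \<Longrightarrow> hdist c (pathstart \<gamma>) \<ge> R \<Longrightarrow>
       hdist c (pathfinish \<gamma>) \<ge> R \<Longrightarrow> V c z < u z"
  shows False
proof -
  define a b where "a = pathstart \<gamma>" and "b = pathfinish \<gamma>"
  have \<gamma>H: "path_image \<gamma> \<subseteq> H2" using \<gamma> \<Omega>(1) by blast
  have ab\<gamma>: "a \<in> path_image \<gamma>" "b \<in> path_image \<gamma>" by (auto simp: a_def b_def)
  then have ab: "a \<in> H2" "b \<in> H2" using \<gamma>H by auto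
  define X where "X = sinh (hdist a b / 2)"
  have X: "sinh R < X" using far by (simp add: X_def a_def b_def)
  moreover have "sinh R > 0" using R by simp
  ultimately have X0: "X > 0" by linarith
  obtain M where M: "hiso M" "Re (M a) / Im (M a) = - X" "Re (M b) / Im (M b) = X"
    unfolding X_def using hiso_bisector[OF ab] by blast
  obtain N where N: "hiso N" "\<And>z. z \<in> H2 \<Longrightarrow> N (M z) = z" "\<And>z. z \<in> H2 \<Longrightarrow> M (N z) = z"
    by (rule hiso_inverse[OF M(1)]) simp
  have MH: "M z \<in> H2" if "z \<in> H2" for z using hiso_H2[OF M(1) that] .
  have cM: "continuous_on H2 M" by (rule hiso_continuous[OF M(1)])
  \<comment> \<open>Coordinates in which the curves equidistant from the imaginary axis become
    vertical lines: the tube turns into the strip \<open>|Re z| \<le> sinh R\<close>, and the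
    endpoints of the path lie beyond it at real parts \<open>- X\<close> and
    \<open>X\<close>.\<close>
  define \<Phi> where "\<Phi> = (\<lambda>z. Complex (Re (M z) / Im (M z)) (Im (M z)))"
  have c\<Phi>: "continuous_on H2 \<Phi>" unfolding \<Phi>_def
    by (intro continuous_intros cM) (use MH in \<open>force simp: H2_def\<close>)
  have inj: "z = w" if "z \<in> H2" "w \<in> H2" "\<Phi> z = \<Phi> w" for z w
  proof -
    have "Im (M z) \<noteq> 0" using MH[OF that(1)] by (simp add: H2_def)
    moreover have "Im (M z) = Im (M w)" "Re (M z) / Im (M z) = Re (M w) / Im (M w)" using that(3) by (auto simp: \<Phi>_def)
    ultimately have "M z = M w" by (simp add: complex_eq_iff)
    then show ?thesis using N(2) that by metis
  qed
  have p\<Phi>: "path (\<Phi> \<circ> \<gamma>)" using \<gamma>(1) \<gamma>H c\<Phi> by (intro path_continuous_image) (auto intro: continuous_on_subset)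
  have cI: "continuous_on (path_image \<gamma>) (\<lambda>z. Im (M z))"
    by (intro continuous_intros continuous_on_subset[OF cM \<gamma>H])
  obtain m1 where m1: "m1 \<in> path_image \<gamma>" "\<And>z. z \<in> path_image \<gamma> \<Longrightarrow> Im (M m1) \<le> Im (M z)"
    using continuous_attains_inf[OF compact_path_image[OF \<gamma>(1)] _ cI] ab\<gamma> by blast
  obtain m2 where m2: "m2 \<in> path_image \<gamma>" "\<And>z. z \<in> path_image \<gamma> \<Longrightarrow> Im (M z) \<le> Im (M m2)"
    using continuous_attains_sup[OF compact_path_image[OF \<gamma>(1)] _ cI] ab\<gamma> by blast
  define Y\<^sub>1 Y\<^sub>2 where "Y\<^sub>1 = Im (M m1)" and "Y\<^sub>2 = Im (M m2)"
  have Y: "0 < Y\<^sub>1" "Y\<^sub>1 \<le> Y\<^sub>2" using MH[of m1] m1 m2 \<gamma>H by (auto simp: Y\<^sub>1_def Y\<^sub>2_def H2_def)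
  have "\<exists>K. closed K \<and> (\<forall>z\<in>K. \<bar>Re z\<bar> < X \<longrightarrow> Im z \<ge> Y\<^sub>1) \<and>
    (\<forall>z. \<bar>Re z\<bar> < X \<longrightarrow> Im z > Y\<^sub>2 \<longrightarrow> z \<in> K) \<and>
    (\<forall>z\<in>K. \<bar>Re z\<bar> < X \<longrightarrow> z \<notin> path_image (\<Phi> \<circ> \<gamma>) \<longrightarrow> (\<exists>e>0. ball z e \<subseteq> K))"
  proof (rule strip_separation[OF p\<Phi> _ _ X0])
    show "Re (pathstart (\<Phi> \<circ> \<gamma>)) \<le> - X" "Re (pathfinish (\<Phi> \<circ> \<gamma>)) \<ge> X"
      using M by (auto simp: pathstart_compose pathfinish_compose \<Phi>_def a_def b_def)
    show "Y\<^sub>1 \<le> Im z \<and> Im z \<le> Y\<^sub>2" if "z \<in> path_image (\<Phi> \<circ> \<gamma>)" for z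
      using that m1(2) m2(2) by (auto simp: path_image_compose \<Phi>_def Y\<^sub>1_def Y\<^sub>2_def)
  qed
  then obtain K0 where K0: "closed K0" "\<And>z. z \<in> K0 \<Longrightarrow> \<bar>Re z\<bar> < X \<Longrightarrow> Im z \<ge> Y\<^sub>1"
    "\<And>z. \<bar>Re z\<bar> < X \<Longrightarrow> Im z > Y\<^sub>2 \<Longrightarrow> z \<in> K0"
    "\<And>z. z \<in> K0 \<Longrightarrow> \<bar>Re z\<bar> < X \<Longrightarrow> z \<notin> path_image (\<Phi> \<circ> \<gamma>) \<Longrightarrow> \<exists>e>0. ball z e \<subseteq> K0"
    by metis
  define K where "K = H2 \<inter> \<Phi> -` K0"
  define c where "c = (\<lambda>s. N (\<i> * of_real s))"
  \<comment> \<open>Balls at parameter \<open>s\<close> have heights between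
    \<open>s * exp (- R)\<close> and \<open>s * exp R\<close>. The first ball thus stays below half
    the lowest height of the path, the last above twice the highest.\<close>
  define s\<^sub>1 s\<^sub>2 where "s\<^sub>1 = Y\<^sub>1 * exp (- R) / 2" and "s\<^sub>2 = 2 * Y\<^sub>2 * exp R"
  have s1: "s\<^sub>1 > 0" using Y by (simp add: s\<^sub>1_def)
  have isH: "\<i> * of_real s \<in> H2" if "s > 0" for s using that by (simp add: H2_def)
  have cH: "c s \<in> H2" if "s > 0" for s unfolding c_def using hiso_H2[OF N(1) isH[OF that]] .
  have near: "\<bar>Re (\<Phi> z)\<bar> \<le> sinh R" "s * exp (- R) \<le> Im (\<Phi> z)" "Im (\<Phi> z) \<le> s * exp R"
    if "z \<in> H2" "s > 0" "hdist (c s) z \<le> R" for z s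
  proof -
    have "hdist (\<i> * of_real s) (M z) \<le> R"
      using hiso_hdist[OF M(1) cH[OF that(2)] that(1)] N(3)[OF isH[OF that(2)]] that(3) by (simp add: c_def)
    then show "\<bar>Re (\<Phi> z)\<bar> \<le> sinh R" "s * exp (- R) \<le> Im (\<Phi> z)" "Im (\<Phi> z) \<le> s * exp R"
      using hball_imaginary_axis[OF MH[OF that(1)] that(2) less_imp_le[OF R]] by (simp_all add: \<Phi>_def)
  qed
  have "\<bar>Re (\<Phi> a)\<bar> = X" "\<bar>Re (\<Phi> b)\<bar> = X" using M X0 by (simp_all add: \<Phi>_def)
  then have ends: "R \<le> hdist (c s) a" "R \<le> hdist (c s) b" if "s > 0" for s
    using near(1)[OF ab(1) that] near(1)[OF ab(2) that] X by linarith+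
  show False
  proof (rule sweep[of s\<^sub>1 s\<^sub>2 c K "path_image \<gamma>"])
    show "continuous_on {s\<^sub>1..s\<^sub>2} c" unfolding c_def
      by (rule continuous_on_compose2[OF hiso_continuous[OF N(1)]]) (use s1 in \<open>auto intro!: continuous_intros simp: H2_def\<close>)
    show "c s \<in> H2" if "s \<in> {s\<^sub>1..s\<^sub>2}" for s using cH s1 that by auto
    show "s\<^sub>1 \<le> s\<^sub>2"
    proof -
      have "Y\<^sub>1 * exp (- R) \<le> Y\<^sub>1 * 1" using Y R by (intro mult_left_mono) auto
      then have "s\<^sub>1 \<le> Y\<^sub>1 * 1" unfolding s\<^sub>1_def using Y by linarith
      also have "\<dots> \<le> (2 * Y\<^sub>2) * exp R" using Y R by (intro mult_mono) auto
      finally show ?thesis by (simp add: s\<^sub>2_def)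
    qed
    show "closedin (top_of_set H2) K" unfolding K_def by (rule continuous_closedin_preimage[OF c\<Phi> K0(1)])
    show "path_image \<gamma> \<subseteq> \<Omega>" "path_image \<gamma> \<noteq> {}" using \<gamma> ab\<gamma> by auto
    show "V (c s) z < u z" if "s \<in> {s\<^sub>1..s\<^sub>2}" "z \<in> path_image \<gamma>" for s z
    proof -
      have "s > 0" using that s1 by auto
      then show ?thesis using above[OF cH that(2)] ends by (simp add: a_def b_def)
    qed
    show "\<exists>\<epsilon>>0. ball z \<epsilon> \<subseteq> K" if z: "s \<in> {s\<^sub>1..s\<^sub>2}" "z \<in> K" "hdist (c s) z \<le> R" "z \<notin> path_image \<gamma>" for s z
    proof -
      have zH: "z \<in> H2" "\<Phi> z \<in> K0" "s > 0" using z s1 by (auto simp: K_def)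
      have "\<Phi> z \<notin> path_image (\<Phi> \<circ> \<gamma>)" using inj[OF zH(1)] \<gamma>H z(4) by (auto simp: path_image_compose)
      moreover have "\<bar>Re (\<Phi> z)\<bar> < X" using near(1)[OF zH(1,3) z(3)] X by linarith
      ultimately obtain e where e: "e > 0" "ball (\<Phi> z) e \<subseteq> K0" using K0(4)[OF zH(2)] by blast
      have "open (H2 \<inter> \<Phi> -` ball (\<Phi> z) e)" by (rule continuous_open_preimage[OF c\<Phi> open_H2 open_ball])
      moreover have "z \<in> H2 \<inter> \<Phi> -` ball (\<Phi> z) e" using zH e by simp
      ultimately obtain \<epsilon> where "\<epsilon> > 0" "ball z \<epsilon> \<subseteq> H2 \<inter> \<Phi> -` ball (\<Phi> z) e"
        unfolding open_contains_ball by blast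
      then show ?thesis using e(2) unfolding K_def by blast
    qed
    show "\<not> hdist (c s\<^sub>1) z \<le> R" if "z \<in> K" for z
    proof
      assume h: "hdist (c s\<^sub>1) z \<le> R"
      have zH: "z \<in> H2" "\<Phi> z \<in> K0" using that by (auto simp: K_def)
      have "Im (\<Phi> z) \<le> Y\<^sub>1 / 2" 
      proof -
        have "s\<^sub>1 * exp R = Y\<^sub>1 / 2" by (simp add: s\<^sub>1_def exp_minus field_simps)
        then show ?thesis using near(3)[OF zH(1) s1 h] by simp
      qed
      moreover have "Im (\<Phi> z) \<ge> Y\<^sub>1" using K0(2)[OF zH(2)] near(1)[OF zH(1) s1 h] X by linarith
      ultimately show False using Y by linarith
    qed
    show "z \<in> K" if z: "z \<in> H2" "hdist (c s\<^sub>2) z \<le> R" for z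
    proof -
      have s2: "s\<^sub>2 > 0" using Y by (simp add: s\<^sub>2_def)
      have "2 * Y\<^sub>2 \<le> Im (\<Phi> z)" 
      proof -
        have "s\<^sub>2 * exp (- R) = 2 * Y\<^sub>2" by (simp add: s\<^sub>2_def exp_minus field_simps)
        then show ?thesis using near(2)[OF z(1) s2 z(2)] by simp
      qed
      then have "Im (\<Phi> z) > Y\<^sub>2" using Y by linarith
      moreover have "\<bar>Re (\<Phi> z)\<bar> < X" using near(1)[OF z(1) s2 z(2)] X by linarith
      ultimately show ?thesis using K0(3) z by (simp add: K_def)
    qed
  qed
qed

text \<open>Two points of \<open>W\<close> more than \<open>2 * R\<close> apart are joined by a path
  in \<open>W\<close>, where \<open>u > v p \<ge> V c\<close>. Otherwise the closure of
  \<open>W\<close> is compact and the diameter \<open>2 * R\<close> is attained at \<open>a\<close>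
  and \<open>b\<close> in it. Then \<open>b\<close> is pushed outward, and the path uses two small
  discs where \<open>u\<close> may drop below \<open>v p\<close> but the admissible
  \<open>V c\<close> are less than half of it.\<close>

lemma hdiam_component_less:
  assumes comp: "W \<in> components {x \<in> \<Omega>. u x > v p}"
  shows "hdiam W < ereal (2 * R)"
proof (rule ccontr)
  assume "\<not> hdiam W < ereal (2 * R)"
  then have diam: "ereal (2 * R) \<le> hdiam W" by simp
  have "{x \<in> \<Omega>. u x > v p} = \<Omega> \<inter> u -` {v p<..}" by auto
  then have op: "open {x \<in> \<Omega>. u x > v p}" using continuous_open_preimage[OF u_cont' \<Omega>(2) open_greaterThan] by simp
  have W: "open W" "connected W" "W \<noteq> {}" "W \<subseteq> \<Omega>" "\<And>x. x \<in> W \<Longrightarrow> u x > v p"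
    using open_components[OF op comp] in_components_connected[OF comp] in_components_nonempty[OF comp]
      in_components_subset[OF comp] by auto
  show False
  proof (cases "\<exists>a\<in>W. \<exists>b\<in>W. hdist a b > 2 * R")
    case True
    then obtain a b where ab: "a \<in> W" "b \<in> W" "hdist a b > 2 * R" by blast
    obtain \<gamma> where \<gamma>: "path \<gamma>" "path_image \<gamma> \<subseteq> W" "pathstart \<gamma> = a" "pathfinish \<gamma> = b"
      using connected_open_path_connected[OF W(1,2)] ab unfolding path_connected_def by blast
    show False
      by (rule no_long_path[OF \<gamma>(1)]) (use \<gamma> W ab V_le le_less_trans in \<open>blast+\<close>)
  next
    case False
    then have le: "\<And>a b. a \<in> W \<Longrightarrow> b \<in> W \<Longrightarrow> hdist a b \<le> 2 * R" by force
    have WH: "W \<subseteq> H2" using W \<Omega> by blast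
    define C where "C = closure W"
    obtain x0 where x0: "x0 \<in> W" using W(3) by blast
    have x0H: "x0 \<in> H2" using x0 WH by blast
    have "W \<subseteq> cball (hcen x0 (2 * R)) (hrad x0 (2 * R))"
      using le[OF x0] WH hcball_eq_cball[OF x0H, of "2 * R"] R by auto
    then have C1: "C \<subseteq> cball (hcen x0 (2 * R)) (hrad x0 (2 * R))" unfolding C_def by (rule closure_minimal) simp
    then have CH: "C \<subseteq> H2" using cball_hcen_subset[OF x0H, of "2 * R"] R by auto
    have "bounded C" using C1 bounded_cball bounded_subset by blast
    then have C: "compact C" by (simp add: C_def compact_eq_bounded_closed)
    have WC: "W \<subseteq> C" by (simp add: C_def closure_subset)
    have Cc: "C \<subseteq> hclosure \<Omega>" using CH closure_mono[OF W(4)] by (auto simp: C_def hclosure_def)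
    have uC: "u x \<ge> v p" if "x \<in> C" for x
      using continuous_ge_on_closure[of W u x "v p"] continuous_on_subset[OF u_cont Cc] that W(5)
      by (auto simp: C_def less_imp_le)
    \<comment> \<open>On the closure \<open>u \<ge> v p > 0\<close>, which keeps it away from the
      boundary of \<Omega>, where \<open>u\<close> vanishes.\<close>
    have C\<Omega>: "C \<subseteq> \<Omega>"
    proof
      fix x assume x: "x \<in> C"
      show "x \<in> \<Omega>"
      proof (rule ccontr)
        assume "x \<notin> \<Omega>"
        then have "u x = 0" using u_bdry hbdry_\<Omega> Cc x by blast
        then show False using uC[OF x] vp_pos by linarith
      qed
    qed
    have "continuous_on (C \<times> C) (\<lambda>x. hdist (fst x) (snd x))"
      by (rule continuous_on_subset[OF hdist_continuous]) (use CH in auto)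
    moreover have "compact (C \<times> C)" using C by (rule compact_Times[OF _ C])
    moreover have "C \<times> C \<noteq> {}" using x0 WC by auto
    ultimately obtain y where y: "y \<in> C \<times> C" "\<And>x. x \<in> C \<times> C \<Longrightarrow> hdist (fst x) (snd x) \<le> hdist (fst y) (snd y)"
      using continuous_attains_sup[of "C \<times> C" "\<lambda>x. hdist (fst x) (snd x)"] by blast
    define a b where "a = fst y" and "b = snd y"
    have ab: "a \<in> C" "b \<in> C" using y by (auto simp: a_def b_def)
    have max: "hdist x x' \<le> hdist a b" if "x \<in> C" "x' \<in> C" for x x' using y(2)[of "(x, x')"] that by (simp add: a_def b_def)
    have "hdiam W \<le> ereal (hdist a b)" unfolding hdiam_def
      by (intro SUP_least) (use max WC in auto)
    then have dab: "hdist a b \<ge> 2 * R" using diam order_trans by fastforce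
    obtain \<eta> where \<eta>: "\<eta> < R" "\<And>c z. c \<in> H2 \<Longrightarrow> z \<in> H2 \<Longrightarrow> hdist c z > \<eta> \<Longrightarrow> V c z < v p / 2"
      using V_small_near_boundary by blast
    \<comment> \<open>From a point \<open>z\<close> near \<open>b\<close> to the endpoint
      \<open>b'\<close> there are two legs, \<open>z\<close> to \<open>b\<close> and
      \<open>b\<close> to \<open>b'\<close>, each shorter than \<mu>. Hence
      \<open>hdist c z > R - 2 * \<mu> = \<eta>\<close>.\<close>
    define \<mu> where "\<mu> = (R - \<eta>) / 2"
    have \<mu>: "\<mu> > 0" using \<eta> by (simp add: \<mu>_def)
    have nb: "\<exists>\<epsilon>>0. ball x \<epsilon> \<subseteq> \<Omega> \<and> (\<forall>z\<in>ball x \<epsilon>. u z > v p / 2 \<and> hdist x z < \<mu>)" if x: "x \<in> C" for x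
    proof -
      have xx: "x \<in> \<Omega>" "x \<in> H2" using x C\<Omega> CH by auto
      have "continuous_on \<Omega> (\<lambda>z. hdist x z)"
        using continuous_on_compose2[OF hdist_continuous, of \<Omega> "\<lambda>z. (x, z)"] xx \<Omega>(1) by (force intro!: continuous_intros)
      then have "open (\<Omega> \<inter> (\<lambda>z. hdist x z) -` {..<\<mu>})" by (rule continuous_open_preimage[OF _ \<Omega>(2) open_lessThan])
      moreover have "open (\<Omega> \<inter> u -` {v p / 2<..})" by (rule continuous_open_preimage[OF u_cont' \<Omega>(2) open_greaterThan])
      ultimately have "open ((\<Omega> \<inter> (\<lambda>z. hdist x z) -` {..<\<mu>}) \<inter> (\<Omega> \<inter> u -` {v p / 2<..}))" by (rule open_Int)
      moreover have "x \<in> (\<Omega> \<inter> (\<lambda>z. hdist x z) -` {..<\<mu>}) \<inter> (\<Omega> \<inter> u -` {v p / 2<..})"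
        using xx \<mu> uC[OF x] vp_pos by auto
      ultimately obtain \<epsilon> where "\<epsilon> > 0" "ball x \<epsilon> \<subseteq> (\<Omega> \<inter> (\<lambda>z. hdist x z) -` {..<\<mu>}) \<inter> (\<Omega> \<inter> u -` {v p / 2<..})"
        unfolding open_contains_ball by blast
      then show ?thesis by blast
    qed
    obtain \<epsilon>1 where \<epsilon>1: "\<epsilon>1 > 0" "ball a \<epsilon>1 \<subseteq> \<Omega>" "\<And>z. z \<in> ball a \<epsilon>1 \<Longrightarrow> u z > v p / 2 \<and> hdist a z < \<mu>"
      using nb[OF ab(1)] by blast
    obtain \<epsilon>2 where \<epsilon>2: "\<epsilon>2 > 0" "ball b \<epsilon>2 \<subseteq> \<Omega>" "\<And>z. z \<in> ball b \<epsilon>2 \<Longrightarrow> u z > v p / 2 \<and> hdist b z < \<mu>"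
      using nb[OF ab(2)] by blast
    have abH: "a \<in> H2" "b \<in> H2" using ab CH by auto
    obtain b' where b': "b' \<in> H2" "dist b b' < \<epsilon>2" "hdist a b' > hdist a b"
      by (rule hdist_no_local_max[OF abH \<epsilon>2(1)])
    have b'b: "b' \<in> ball b \<epsilon>2" using b' by simp
    define G where "G = W \<union> ball a \<epsilon>1 \<union> ball b \<epsilon>2"
    have meet: "W \<inter> ball x \<epsilon> \<noteq> {}" if "x \<in> C" "\<epsilon> > 0" for x \<epsilon>
      using that unfolding C_def closure_approachable by (fastforce simp: dist_commute)
    have "connected (W \<union> ball a \<epsilon>1)" using W(2) meet[OF ab(1) \<epsilon>1(1)] by (intro connected_Un) auto
    then have "connected G" unfolding G_def
      by (rule connected_Un) (use meet[OF ab(2) \<epsilon>2(1)] in auto)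
    moreover have "open G" using W(1) by (auto simp: G_def)
    ultimately have "path_connected G" using connected_open_path_connected by blast
    moreover have "a \<in> G" "b' \<in> G" using \<epsilon>1(1) b'b by (auto simp: G_def)
    ultimately obtain \<gamma> where \<gamma>: "path \<gamma>" "path_image \<gamma> \<subseteq> G" "pathstart \<gamma> = a" "pathfinish \<gamma> = b'"
      unfolding path_connected_def by blast
    have G\<Omega>: "G \<subseteq> \<Omega>" using W \<epsilon>1 \<epsilon>2 by (auto simp: G_def)
    show False
    proof (rule no_long_path[OF \<gamma>(1)])
      show "path_image \<gamma> \<subseteq> \<Omega>" using \<gamma> G\<Omega> by blast
      show "hdist (pathstart \<gamma>) (pathfinish \<gamma>) > 2 * R" using \<gamma> b' dab by simp
      fix c z assume c: "c \<in> H2" and z: "z \<in> path_image \<gamma>" and ra: "hdist c (pathstart \<gamma>) \<ge> R"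
        and rb: "hdist c (pathfinish \<gamma>) \<ge> R"
      have zG: "z \<in> G" "z \<in> H2" using z \<gamma> G\<Omega> \<Omega>(1) by auto
      then consider "z \<in> W" | "z \<in> ball a \<epsilon>1" | "z \<in> ball b \<epsilon>2" unfolding G_def by blast
      then show "V c z < u z"
      proof cases
        case 1
        then show ?thesis using W(5) V_le le_less_trans by blast
      next
        case 2
        have "hdist c a \<le> hdist c z + hdist z a" by (rule hdist_triangle[OF c zG(2) abH(1)])
        then have "hdist c z > \<eta>" using ra \<gamma>(3) \<epsilon>1(3)[OF 2] \<mu> by (simp add: \<mu>_def hdist_commute[of z a])
        then show ?thesis using \<eta>(2)[OF c zG(2)] \<epsilon>1(3)[OF 2] by fastforce
      next
        case 3
        have "hdist c b' \<le> hdist c z + hdist z b'" "hdist z b' \<le> hdist z b + hdist b b'"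
          using hdist_triangle c zG b' abH by blast+
        then have "hdist c z > \<eta>" using rb \<gamma>(4) \<epsilon>2(3)[OF 3] \<epsilon>2(3)[OF b'b] \<mu> by (simp add: \<mu>_def hdist_commute[of z b])
        then show ?thesis using \<eta>(2)[OF c zG(2)] \<epsilon>2(3)[OF 3] by fastforce
      qed
    qed
  qed
qed

end

theorem theorem5p3:
  fixes \<Omega> :: "complex set" and u :: "complex \<Rightarrow> real"
    and Du :: "complex \<Rightarrow> complex \<Rightarrow>\<^sub>L real"
    and D2u :: "complex \<Rightarrow> complex \<Rightarrow>\<^sub>L (complex \<Rightarrow>\<^sub>L real)"
    and f :: "real \<Rightarrow> real" and \<alpha> lam :: real
    and p :: complex and R :: real and v :: "complex \<Rightarrow> real"
    and Dv :: "complex \<Rightarrow> complex \<Rightarrow>\<^sub>L real"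
    and D2v :: "complex \<Rightarrow> complex \<Rightarrow>\<^sub>L (complex \<Rightarrow>\<^sub>L real)"
    and h\<^sub>0 :: real
  assumes dom: "\<Omega> \<subseteq> H2" "open \<Omega>" "connected \<Omega>" "\<not> hbounded \<Omega>" "C2_boundary \<Omega>"
    and alpha: "\<alpha> \<le> 0" "\<alpha> \<noteq> 0"
    and f_lip: "\<exists>L. L-lipschitz_on {0<..} f"
    and lam: "lam > 1/4" "\<forall>t>0. f t \<ge> lam * t"
    and u_C2: "C2_upto \<Omega> u Du D2u"
    and u_eq: "\<forall>z\<in>\<Omega>. hlap D2u z + f (u z) = 0"
    and u_pos: "\<forall>z\<in>\<Omega>. u z > 0"
    and u_bdry: "\<forall>z\<in>hbdry \<Omega>. u z = 0"
    and u_normal: "normal_deriv_eq \<Omega> Du \<alpha>"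
    and ball: "p \<in> H2" "R > 0" "first_dirichlet_eigenvalue (hball p R) = lam"
    and v_eig: "dirichlet_eigenfunction (hball p R) lam v Dv D2v"
    and v_pos: "\<forall>z\<in>hball p R. v z > 0"
    and v_normal: "normal_deriv_eq (hball p R) Dv \<alpha>"
    and h0: "h\<^sub>0 = v p"
  shows "\<forall>\<Omega>'\<in>components {x\<in>\<Omega>. u x > h\<^sub>0}. hdiam \<Omega>' < ereal (2 * R)"
proof -
  interpret extremal p R lam \<alpha> v Dv D2v \<Omega> u Du D2u f
    by unfold_locales (use assms in auto)
  show ?thesis unfolding h0 using hdiam_component_less by blast
qed

end
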